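(* Let $(c,E)$ be real parameters in one of the four regimes: (i) $|c|<1$, $E<0$; (ii) $|c|>1$, $E>2$; (iii) $|c|<1$, $0<E\le 2$; (iv) $|c|>1$, $0<E\le 2$. Then for every nonzero real $\zeta$, $\operatorname{Re}\,I(\zeta)=0$, where $I(\zeta)$ is defined in the context.
   Context: Let $g_2=\frac{4-2E+E^2}{3(c^2-1)^2}$ and $g_3=\frac{8-6E-3E^2+E^3}{27(c^2-1)^3}$, let $\wp(\cdot)=\wp(\cdot;g_2,g_3)$ be the Weierstrass elliptic function with these invariants and $\zeta_w$ the corresponding Weierstrass zeta function, and let $e_1>e_2>e_3$ be the (real) roots of $4s^3-g_2s-g_3$ (they are $\frac{E-1}{3(c^2-1)}$, $\frac{E+2}{6(1-c^2)}$, $\frac{4-E}{6(c^2-1)}$ in some order). Let $\omega_1=\int_{e_1}^{\infty}\frac{ds}{\sqrt{4s^3-g_2s-g_3}}$ be the real half-period. For $\zeta\in\mathbb{C}\setminus\{0\}$ let $\Omega(\zeta)$ be a complex number with $$\Omega(\zeta)^2=\frac{1}{64}\left(-8(c^2-1)(E-1)-\frac{(c-1)^2}{\zeta^2}-16(c+1)^2\zeta^2\right),$$ let $C_4=\frac{8}{3}\zeta\left((c-1)(E-1)+12(c+1)\zeta^2-24i\zeta\Omega(\zeta)\right)$, $C_5=16(c-1)^2(c+1)\zeta$, let $\rho$ be any complex number with $\wp(\rho)=-C_4/C_5$, and let $\nu=+1$ if $-\frac{\pi}{2}<\arg\left(\frac{\zeta\left(-i(c-1)(E-1)-4i(c+1)\zeta^2-8\zeta\Omega(\zeta)\right)}{(c-1)^3(c+1)}\right)\le\frac{\pi}{2}$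 and $\nu=-1$ otherwise. Then $$I(\zeta)=\frac{2\omega_1\left(i\zeta+\Omega(\zeta)\right)}{c-1}+2\nu\left(\zeta_w(\rho)\,\omega_1-\zeta_w(\omega_1)\,\rho\right).$$ The condition $\operatorname{Re} I(\zeta)=0$ characterizes the Lax spectrum: the set of $\zeta$ for which the $z$-part of the sine-Gordon Lax pair, evaluated at the stationary periodic solution $\cos f(z)=\alpha+\frac{\beta}{k^2\lambda^2}(\wp(z+\omega_3)-e_3)$ of $(c^2-1)f''+\sin f=0$ with energy $\frac12(c^2-1)f'^2+1-\cos f=E$, has a bounded solution. *)

theory Defs
  imports "HOL-Analysis.Analysis"
begin

definition lattice_gen :: "complex \<Rightarrow> complex \<Rightarrow> complex set" where
  "lattice_gen a b = {of_int m * a + of_int n * b | m n. True}"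

text \<open>A period lattice: either a genuine rank-2 lattice, or (degenerate case,
  discriminant zero) a rank-1 lattice, for which the lattice sums below give the
  usual trigonometric degenerations of the Weierstrass functions.\<close>
definition period_lattice :: "complex set \<Rightarrow> bool" where
  "period_lattice L \<longleftrightarrow>
     (\<exists>a b. a \<noteq> 0 \<and> b \<noteq> 0 \<and> Im (b / a) \<noteq> 0 \<and> L = lattice_gen a b)
     \<or> (\<exists>a. a \<noteq> 0 \<and> L = lattice_gen a 0)"

definition lattice_g2 :: "complex set \<Rightarrow> complex" where
  "lattice_g2 L = 60 * infsum (\<lambda>w. 1 / w ^ 4) (L - {0})"

definition lattice_g3 :: "complex set \<Rightarrow> complex" where
  "lattice_g3 L = 140 * infsum (\<lambda>w. 1 / w ^ 6) (L - {0})"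

definition wlattice :: "complex \<Rightarrow> complex \<Rightarrow> complex set" where
  "wlattice g2 g3 = (SOME L. period_lattice L \<and> lattice_g2 L = g2 \<and> lattice_g3 L = g3)"

definition wp_lat :: "complex set \<Rightarrow> complex \<Rightarrow> complex" where
  "wp_lat L z = 1 / z ^ 2 + infsum (\<lambda>w. 1 / (z - w) ^ 2 - 1 / w ^ 2) (L - {0})"

definition wzeta_lat :: "complex set \<Rightarrow> complex \<Rightarrow> complex" where
  "wzeta_lat L z = 1 / z + infsum (\<lambda>w. 1 / (z - w) + 1 / w + z / w ^ 2) (L - {0})"

definition sg_g2 :: "real \<Rightarrow> real \<Rightarrow> real" where
  "sg_g2 c E = (4 - 2 * E + E ^ 2) / (3 * (c ^ 2 - 1) ^ 2)"

definition sg_g3 :: "real \<Rightarrow> real \<Rightarrow> real" where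
  "sg_g3 c E = (8 - 6 * E - 3 * E ^ 2 + E ^ 3) / (27 * (c ^ 2 - 1) ^ 3)"

definition sg_lattice :: "real \<Rightarrow> real \<Rightarrow> complex set" where
  "sg_lattice c E = wlattice (of_real (sg_g2 c E)) (of_real (sg_g3 c E))"

definition sg_wp :: "real \<Rightarrow> real \<Rightarrow> complex \<Rightarrow> complex" where
  "sg_wp c E = wp_lat (sg_lattice c E)"

definition sg_wzeta :: "real \<Rightarrow> real \<Rightarrow> complex \<Rightarrow> complex" where
  "sg_wzeta c E = wzeta_lat (sg_lattice c E)"

definition sg_e1 :: "real \<Rightarrow> real \<Rightarrow> real" where
  "sg_e1 c E = Max {s::real. 4 * s ^ 3 - sg_g2 c E * s - sg_g3 c E = 0}"

definition sg_omega1 :: "real \<Rightarrow> real \<Rightarrow> real" where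
  "sg_omega1 c E = integral {sg_e1 c E..}
     (\<lambda>s. 1 / sqrt (4 * s ^ 3 - sg_g2 c E * s - sg_g3 c E))"

definition sg_Omega_sq :: "real \<Rightarrow> real \<Rightarrow> complex \<Rightarrow> complex" where
  "sg_Omega_sq c E z = (1 / 64) * (- 8 * (c ^ 2 - 1) * (E - 1) - (c - 1) ^ 2 / z ^ 2
      - 16 * (c + 1) ^ 2 * z ^ 2)"

definition sg_C4 :: "real \<Rightarrow> real \<Rightarrow> complex \<Rightarrow> complex \<Rightarrow> complex" where
  "sg_C4 c E z \<Omega> = (8 / 3) * z * ((c - 1) * (E - 1) + 12 * (c + 1) * z ^ 2 - 24 * \<i> * z * \<Omega>)"

definition sg_C5 :: "real \<Rightarrow> complex \<Rightarrow> complex" where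
  "sg_C5 c z = 16 * (c - 1) ^ 2 * (c + 1) * z"

definition sg_nu :: "real \<Rightarrow> real \<Rightarrow> complex \<Rightarrow> complex \<Rightarrow> complex" where
  "sg_nu c E z \<Omega> =
     (let X = z * (- \<i> * (c - 1) * (E - 1) - 4 * \<i> * (c + 1) * z ^ 2 - 8 * z * \<Omega>)
              / ((c - 1) ^ 3 * (c + 1))
      in if - (pi / 2) < Arg X \<and> Arg X \<le> pi / 2 then 1 else -1)"

definition sg_I :: "real \<Rightarrow> real \<Rightarrow> complex \<Rightarrow> complex \<Rightarrow> complex \<Rightarrow> complex" where
  "sg_I c E z \<Omega> \<rho> =
     2 * of_real (sg_omega1 c E) * (\<i> * z + \<Omega>) / (c - 1)
     + 2 * sg_nu c E z \<Omega> *
         (sg_wzeta c E \<rho> * of_real (sg_omega1 c E)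
          - sg_wzeta c E (of_real (sg_omega1 c E)) * \<rho>)"

end

theory Submission
  imports Defs "HOL-Complex_Analysis.Complex_Analysis"
begin

text \<open>For real \<open>\<zeta>\<close> the inequality between arithmetic and geometric means gives \<open>\<Omega>^2 \<le> 0\<close>, so the
  first summand of \<open>I(\<zeta>)\<close> is imaginary, \<open>\<wp>(\<rho>)\<close> is real, and a computation shows \<open>\<wp>'(\<rho>)^2 \<le> 0\<close>.
  The lattice is rectangular (or generated by one real period if \<open>E = 2\<close>), so \<open>\<wp>\<close> and \<open>\<wp>'\<close> agree at
  \<open>\<rho>\<close> and \<open>- cnj \<rho>\<close>. As solutions of \<open>\<wp>'' = 6 \<wp>^2 - g2/2\<close> are determined by their initial data, the
  two points differ by a period, which is real and hence a multiple of \<open>2 \<omega>1\<close>; the quasi-periodicity of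
  the zeta function then cancels the real part of the bracket. Since the lattice is only given by its
  invariants, one needs that a rectangular lattice with these invariants exists (intermediate value
  theorem) and that it is the only one (again uniqueness for the differential equation). If
  \<open>E = 2\<close> and \<open>|c| > 1\<close>, the integral defining \<open>\<omega>1\<close> diverges and has the junk value 0.\<close>

section \<open>Summable lattices\<close>

text \<open>At discriminant zero (E = 2) the lattice has rank one: there wp omits a value, and
  counting zeros and poles in a period parallelogram makes no sense. The arguments therefore use
  only what both ranks share: convergence of the sums, the double poles, the differential equations
  and uniqueness for given initial data. This also stands in for the classical fact that an elliptic
  function of order two takes each value twice: wp and wp' together separate points modulo periods
  because translates with equal initial data have equal poles. A second gap lies in the definitions:
  \<open>sg_omega1\<close> is an integral and knows nothing of the lattice. It is identified with
  half of the real period by the substitution s = wp(x), for which the range of wp on the real axis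
  has to be determined. The pair E = 2, |c| > 1 stands apart because the double root of the cubic is
  then the largest one and g3 < 0, whereas a rank one lattice with a real period has g3 > 0.\<close>

locale summable_lattice =
  fixes L :: "complex set"
  assumes zero_mem: "0 \<in> L"
    and add_mem: "\<And>v w. v \<in> L \<Longrightarrow> w \<in> L \<Longrightarrow> v + w \<in> L"
    and uminus_mem: "\<And>w. w \<in> L \<Longrightarrow> - w \<in> L"
    and summable_cubes: "(\<lambda>w. 1 / norm w ^ 3) summable_on (L - {0})"
begin

lemma diff_mem: "v \<in> L \<Longrightarrow> w \<in> L \<Longrightarrow> v - w \<in> L"
  using add_mem[of v "- w"] uminus_mem by simp

lemma uminus_mem_iff: "- w \<in> L \<longleftrightarrow> w \<in> L"
  using uminus_mem[of w] uminus_mem[of "- w"] by auto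

lemma add_mem_iff: "w \<in> L \<Longrightarrow> z + w \<in> L \<longleftrightarrow> z \<in> L"
  using add_mem[of z w] diff_mem[of "z + w" w] by auto

text \<open>Summability of the cubes is the locale's form of discreteness: each nonzero point of the
  disc contributes at least 1 / R'^3, so the total sum caps their number. Closedness and
  countability of L, and through the latter connectedness of its complement, rest on this.\<close>

lemma finite_bounded: "finite {w \<in> L. norm w \<le> R}"
proof -
  define R' where "R' = max R 1"
  define S where "S = infsum (\<lambda>w. 1 / norm w ^ 3) (L - {0})"
  have R': "R' > 0" "R \<le> R'" by (auto simp: R'_def)
  have "finite {w \<in> L - {0}. norm w \<le> R'}"
  proof (rule ccontr)
    assume inf: "infinite {w \<in> L - {0}. norm w \<le> R'}"
    obtain n :: nat where n: "S * R' ^ 3 < real n" using reals_Archimedean2 by blast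
    obtain B where B: "B \<subseteq> {w \<in> L - {0}. norm w \<le> R'}" "finite B" "card B = n"
      using infinite_arbitrarily_large[OF inf] by metis
    have "real n * (1 / R' ^ 3) \<le> (\<Sum>w\<in>B. 1 / norm w ^ 3)"
      unfolding B(3)[symmetric]
    proof (rule sum_bounded_below)
      fix w assume "w \<in> B"
      hence "w \<noteq> 0" "norm w \<le> R'" using B by auto
      thus "1 / R' ^ 3 \<le> 1 / norm w ^ 3"
        by (intro divide_left_mono power_mono mult_pos_pos zero_less_power) (use R' in auto)
    qed
    also have "\<dots> \<le> S" unfolding S_def
      by (rule finite_sum_le_infsum[OF summable_cubes]) (use B in auto)
    finally show False using n R' by (simp add: field_simps)
  qed
  hence "finite (insert 0 {w \<in> L - {0}. norm w \<le> R'})" by simp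
  thus ?thesis by (rule finite_subset[rotated]) (use R' in auto)
qed

lemma closed_translate: "closed ((\<lambda>w. z + w) ` L)"
proof -
  have "closed L"
    unfolding closed_limpt islimpt_iff_eventually
  proof (intro allI impI)
    fix x assume "\<not> (\<forall>\<^sub>F y in at x. y \<notin> L)"
    have fin: "finite ({w \<in> L. norm w \<le> norm x + 1} - {x})"
      using finite_bounded by blast
    from finite_imp_closed[OF fin] have "open (- ({w \<in> L. norm w \<le> norm x + 1} - {x}))"
      by (rule open_Compl)
    hence "\<forall>\<^sub>F y in at x. y \<in> - ({w \<in> L. norm w \<le> norm x + 1} - {x})"
      by (intro eventually_at_in_open') auto
    moreover have "\<forall>\<^sub>F y in at x. y \<in> ball x 1 - {x}"
      by (intro eventually_at_in_open) auto
    ultimately have "\<forall>\<^sub>F y in at x. y \<notin> L"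
    proof eventually_elim
      case (elim y)
      have "norm y \<le> norm x + 1"
        using elim(2) norm_triangle_ineq2[of y x] by (auto simp: dist_norm norm_minus_commute)
      thus ?case using elim by auto
    qed
    with \<open>\<not> _\<close> show "x \<in> L" by contradiction
  qed
  thus ?thesis by (rule closed_translation)
qed

lemma closed_L: "closed L"
  using closed_translate[of 0] by simp

lemma open_Compl_L: "open (- L)"
  using closed_L by auto

lemma countable_L: "countable L"
proof -
  have "countable (\<Union>n::nat. {w \<in> L. norm w \<le> real n})"
    by (rule countable_UN[OF _ countable_finite[OF finite_bounded]]) auto
  also have "(\<Union>n::nat. {w \<in> L. norm w \<le> real n}) = L"
    by (auto intro: real_arch_simple)
  finally show ?thesis .
qed

lemma connected_Compl_L: "connected (- L)"
  by (intro path_connected_imp_connected path_connected_complement_countable countable_L) auto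

lemma closed_nonzero: "closed (L - {0})"
proof -
  have "finite ({w \<in> L. norm w \<le> 1} - {0})" using finite_bounded by auto
  moreover have "closed (L - ball 0 1)" by (intro closed_Diff closed_L) auto
  ultimately have "closed (({w \<in> L. norm w \<le> 1} - {0}) \<union> (L - ball 0 1))"
    by (rule closed_Un[OF finite_imp_closed])
  also have "({w \<in> L. norm w \<le> 1} - {0}) \<union> (L - ball 0 1) = L - {0}" by auto
  finally show ?thesis .
qed

lemma nonlattice_near_0: "\<exists>\<delta>>0. \<forall>w\<in>L - {0}. \<delta> \<le> norm w"
proof -
  obtain d where "d > 0" "\<forall>w\<in>L - {0}. d \<le> dist 0 w"
    using separate_point_closed[OF closed_nonzero, of 0] by blast
  thus ?thesis by auto
qed

lemma summable_if_cubic_decay: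
  fixes g :: "complex \<Rightarrow> complex"
  assumes "\<And>w. w \<in> L - {0} \<Longrightarrow> R \<le> norm w \<Longrightarrow> norm (g w) \<le> C / norm w ^ 3"
  shows "(\<lambda>w. norm (g w)) summable_on (L - {0})"
proof -
  define B where "B = {w \<in> L - {0}. norm w < R}"
  have "finite B" by (rule finite_subset[OF _ finite_bounded[of R]]) (auto simp: B_def)
  have "(\<lambda>w. C * (1 / norm w ^ 3)) summable_on (L - {0} - B)"
    by (intro summable_on_cmult_right summable_on_subset_banach[OF summable_cubes]) auto
  hence "(\<lambda>w. norm (g w)) summable_on (L - {0} - B)"
    by (rule Infinite_Sum.abs_summable_on_comparison_test') (use assms in \<open>auto simp: B_def\<close>)
  hence "(\<lambda>w. norm (g w)) summable_on ((L - {0} - B) \<union> B)"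
    by (rule summable_on_Un_disjoint) (use \<open>finite B\<close> in auto)
  thus ?thesis by (rule back_subst[of "\<lambda>A. _ summable_on A"]) (auto simp: B_def)
qed

text \<open>The finite partial sums converge uniformly on a closed disc by the M-test, and for
  holomorphic functions the derivatives then converge as well. Decay is asked only for
  \<open>2 * R \<le> norm w\<close>, where every x in the disc has distance at least norm w / 2 from
  w; the finitely many other terms are bounded by compactness.\<close>

lemma termwise_derivative:
  fixes F F' :: "complex \<Rightarrow> complex \<Rightarrow> complex"
  assumes S: "open S" "z \<in> S"
    and der: "\<And>w x. w \<in> L - {0} \<Longrightarrow> x \<in> S \<Longrightarrow> (F w has_field_derivative F' w x) (at x)"
    and bound: "\<And>R. \<exists>C. \<forall>w\<in>L - {0}. \<forall>x. norm x \<le> R \<longrightarrow> 2 * R \<le> norm w \<longrightarrow> norm (F w x) \<le> C / norm w ^ 3"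
  shows "(\<lambda>w. F w z) summable_on (L - {0})"
    and "\<exists>d. ((\<lambda>x. \<Sum>\<^sub>\<infinity>w\<in>L - {0}. F w x) has_field_derivative d) (at z)
           \<and> ((\<lambda>w. F' w z) has_sum d) (L - {0})"
proof -
  obtain r where r: "r > 0" "cball z r \<subseteq> S"
    using S open_contains_cball by blast
  define R where "R = norm z + r"
  have R: "norm x \<le> R" if "x \<in> cball z r" for x
    using that norm_triangle_ineq2[of x z] by (auto simp: R_def dist_norm norm_minus_commute)
  obtain C where C: "\<And>w x. w \<in> L - {0} \<Longrightarrow> norm x \<le> R \<Longrightarrow> 2 * R \<le> norm w \<Longrightarrow> norm (F w x) \<le> C / norm w ^ 3"
    using bound[of R] by blast
  have "\<exists>M. \<forall>x\<in>cball z r. norm (F w x) \<le> M" if "w \<in> L - {0}" for w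
  proof -
    have "continuous_on (cball z r) (F w)"
      by (rule DERIV_continuous_on[of _ _ "F' w"], rule has_field_derivative_at_within, rule der)
         (use r that in auto)
    hence "bounded (F w ` cball z r)"
      by (intro compact_imp_bounded compact_continuous_image) auto
    thus ?thesis by (auto simp: bounded_iff)
  qed
  then obtain M0 where M0: "\<And>w x. w \<in> L - {0} \<Longrightarrow> x \<in> cball z r \<Longrightarrow> norm (F w x) \<le> M0 w"
    by metis
  define M where "M = (\<lambda>w. if norm w < 2 * R then M0 w else C / norm w ^ 3)"
  have M: "norm (F w x) \<le> M w" if "w \<in> L - {0}" "x \<in> cball z r" for w x
    using C[OF that(1) R[OF that(2)]] M0[OF that] by (auto simp: M_def)
  have M_nonneg: "M w \<ge> 0" if "w \<in> L - {0}" for w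
    using order_trans[OF norm_ge_zero M[OF that, of z]] r by simp
  have "(\<lambda>w. norm (of_real (M w) :: complex)) summable_on (L - {0})"
  proof (rule summable_if_cubic_decay)
    fix w assume w: "w \<in> L - {0}" "2 * R \<le> norm w"
    have "norm (of_real (M w) :: complex) = M w"
      using M_nonneg[OF w(1)] by simp
    also have "\<dots> \<le> C / norm w ^ 3" using w(2) by (simp add: M_def)
    finally show "norm (of_real (M w) :: complex) \<le> C / norm w ^ 3" .
  qed
  hence summ: "M summable_on (L - {0})"
    by (rule summable_on_cong[THEN iffD1, rotated]) (use M_nonneg in auto)
  have "(\<lambda>w. norm (F w z)) summable_on (L - {0})"
    by (rule Infinite_Sum.abs_summable_on_comparison_test'[OF summ]) (use M r in auto)
  thus "(\<lambda>w. F w z) summable_on (L - {0})" by (rule abs_summable_summable)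
  have ulim: "uniform_limit (cball z r) (\<lambda>X y. \<Sum>w\<in>X. F w y)
      (\<lambda>y. \<Sum>\<^sub>\<infinity>w\<in>L - {0}. F w y) (finite_subsets_at_top (L - {0}))"
    by (rule Weierstrass_m_test_general[OF M summ])
  obtain g' where "\<And>w. w \<in> ball z r \<Longrightarrow>
       ((\<lambda>y. \<Sum>\<^sub>\<infinity>w\<in>L - {0}. F w y) has_field_derivative (g' w)) (at w) \<and>
       ((\<lambda>X. \<Sum>v\<in>X. F' v w) \<longlongrightarrow> g' w) (finite_subsets_at_top (L - {0}))"
  proof (rule has_complex_derivative_uniform_limit[OF _ ulim _ r(1), of "\<lambda>X y. \<Sum>w\<in>X. F' w y"])
    show "\<forall>\<^sub>F X in finite_subsets_at_top (L - {0}).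
        continuous_on (cball z r) (\<lambda>y. \<Sum>w\<in>X. F w y) \<and>
        (\<forall>w\<in>ball z r. ((\<lambda>y. \<Sum>w\<in>X. F w y) has_field_derivative (\<Sum>v\<in>X. F' v w)) (at w))"
    proof (rule eventually_finite_subsets_at_top_weakI, intro conjI ballI)
      fix X assume X: "finite X" "X \<subseteq> L - {0}"
      have d: "((\<lambda>y. \<Sum>w\<in>X. F w y) has_field_derivative (\<Sum>v\<in>X. F' v w)) (at w)"
        if "w \<in> cball z r" for w
        by (intro DERIV_sum der) (use that r X in auto)
      show "continuous_on (cball z r) (\<lambda>y. \<Sum>w\<in>X. F w y)"
        by (rule DERIV_continuous_on) (use d has_field_derivative_at_within in blast)
      show "((\<lambda>y. \<Sum>w\<in>X. F w y) has_field_derivative (\<Sum>v\<in>X. F' v w)) (at w)"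
        if "w \<in> ball z r" for w using d that by auto
    qed
  qed auto
  thus "\<exists>d. ((\<lambda>x. \<Sum>\<^sub>\<infinity>w\<in>L - {0}. F w x) has_field_derivative d) (at z)
           \<and> ((\<lambda>w. F' w z) has_sum d) (L - {0})"
    using r unfolding has_sum_def by (intro exI[of _ "g' z"]) auto
qed

end

section \<open>The functions \<open>\<zeta>\<close> and \<open>\<wp>\<close>\<close>

lemma inverse_square_deriv:
  fixes x w :: complex
  assumes "x \<noteq> w"
  shows "((\<lambda>x. 1 / (x - w) ^ 2) has_field_derivative -2 / (x - w) ^ 3) (at x)"
proof -
  have "x - w \<noteq> 0" using assms by simp
  moreover have "2 * w - 2 * x = -2 * (x - w)" "(x - w) ^ 4 = (x - w) * (x - w) ^ 3"
    by (simp_all add: eval_nat_numeral)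
  ultimately have "(2 * w - 2 * x) / (x - w) ^ 4 = - (2 / (x - w) ^ 3)"
    by (metis minus_divide_left nonzero_mult_divide_mult_cancel_left mult.commute)
  thus ?thesis using assms by (auto intro!: derivative_eq_intros)
qed

context summable_lattice
begin

lemma half_norm_le:
  fixes x w :: complex
  assumes "norm x \<le> R" "2 * R \<le> norm w"
  shows "norm w / 2 \<le> norm (x - w)"
proof -
  have "norm w - norm x \<le> norm (w - x)" by (rule norm_triangle_ineq2)
  thus ?thesis using assms by (simp add: norm_minus_commute)
qed

lemma infsum_reflect: "infsum (\<lambda>w. f (- w)) (L - {0}) = infsum f (L - {0})"
  by (rule infsum_reindex_bij_witness[of _ uminus uminus]) (auto simp: uminus_mem_iff)

lemma wzeta_term_bound:
  fixes x w :: complex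
  assumes "w \<noteq> 0" "norm x \<le> R" "2 * R \<le> norm w"
  shows "norm (1 / (x - w) + 1 / w + x / w ^ 2) \<le> (2 * R\<^sup>2) / norm w ^ 3"
proof -
  have xw: "norm w / 2 \<le> norm (x - w)" by (rule half_norm_le[OF assms(2,3)])
  with assms have "x - w \<noteq> 0" by auto
  hence "1 / (x - w) + 1 / w + x / w ^ 2 = x ^ 2 / (w ^ 2 * (x - w))"
    using assms by (simp add: field_simps power2_eq_square)
  also have "norm \<dots> = norm x ^ 2 / (norm w ^ 2 * norm (x - w))"
    by (simp add: norm_divide norm_mult norm_power)
  also have "\<dots> \<le> R ^ 2 / (norm w ^ 2 * (norm w / 2))"
    by (intro frac_le power_mono mult_left_mono xw assms(2)) (use assms in auto)
  also have "\<dots> = (2 * R\<^sup>2) / norm w ^ 3"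
    using assms by (simp add: field_simps power2_eq_square power3_eq_cube)
  finally show ?thesis .
qed

lemma wp_term_bound:
  fixes x w :: complex
  assumes "w \<noteq> 0" "norm x \<le> R" "2 * R \<le> norm w"
  shows "norm (1 / (x - w) ^ 2 - 1 / w ^ 2) \<le> (10 * R) / norm w ^ 3"
proof -
  have xw: "norm w / 2 \<le> norm (x - w)" by (rule half_norm_le[OF assms(2,3)])
  with assms have "x - w \<noteq> 0" by auto
  have R: "R \<ge> 0" using assms(2) norm_ge_zero order_trans by blast
  have "1 / (x - w) ^ 2 - 1 / w ^ 2 = x * (2 * w - x) / (w ^ 2 * (x - w) ^ 2)"
    using assms \<open>x - w \<noteq> 0\<close> by (simp add: divide_simps) (simp add: algebra_simps power2_eq_square)
  also have "norm \<dots> = norm x * norm (2 * w - x) / (norm w ^ 2 * norm (x - w) ^ 2)"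
    by (simp add: norm_divide norm_mult norm_power)
  also have "\<dots> \<le> R * (5 / 2 * norm w) / (norm w ^ 2 * (norm w / 2) ^ 2)"
  proof (intro frac_le mult_mono power_mono xw assms(2))
    show "norm (2 * w - x) \<le> 5 / 2 * norm w"
      using norm_triangle_ineq4[of "2 * w" x] assms by (simp add: norm_mult)
  qed (use assms R in auto)
  also have "\<dots> = (10 * R) / norm w ^ 3"
    using assms by (simp add: field_simps power2_eq_square power3_eq_cube)
  finally show ?thesis .
qed

lemma wp_summable: "(\<lambda>w. 1 / (z - w) ^ 2 - 1 / w ^ 2) summable_on (L - {0})"
proof (rule abs_summable_summable, rule summable_if_cubic_decay)
  fix w assume "w \<in> L - {0}" "2 * norm z \<le> norm w"
  thus "norm (1 / (z - w) ^ 2 - 1 / w ^ 2) \<le> (10 * norm z) / norm w ^ 3"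
    using wp_term_bound[of w z "norm z"] by simp
qed

lemma wzeta_deriv:
  assumes z: "z \<notin> L"
  shows "(wzeta_lat L has_field_derivative - wp_lat L z) (at z)"
proof -
  have nz: "z \<noteq> 0" using z zero_mem by auto
  have "\<exists>d. ((\<lambda>x. \<Sum>\<^sub>\<infinity>w\<in>L - {0}. 1 / (x - w) + 1 / w + x / w ^ 2) has_field_derivative d) (at z)
           \<and> ((\<lambda>w. - (1 / (z - w) ^ 2 - 1 / w ^ 2)) has_sum d) (L - {0})"
  proof (rule termwise_derivative(2)[OF open_Compl_L])
    fix w x assume "w \<in> L - {0}" "x \<in> - L"
    hence "x - w \<noteq> 0" "w \<noteq> 0" by auto
    thus "((\<lambda>x. 1 / (x - w) + 1 / w + x / w ^ 2) has_field_derivative - (1 / (x - w) ^ 2 - 1 / w ^ 2)) (at x)"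
      by (auto intro!: derivative_eq_intros simp: power2_eq_square)
  next
    fix R :: real
    show "\<exists>C. \<forall>w\<in>L - {0}. \<forall>x. norm x \<le> R \<longrightarrow> 2 * R \<le> norm w \<longrightarrow>
        norm (1 / (x - w) + 1 / w + x / w\<^sup>2) \<le> C / norm w ^ 3"
      using wzeta_term_bound[of _ _ R] by (intro exI[of _ "2 * R\<^sup>2"]) auto
  qed (use z in auto)
  then obtain d where d: "((\<lambda>x. \<Sum>\<^sub>\<infinity>w\<in>L - {0}. 1 / (x - w) + 1 / w + x / w ^ 2) has_field_derivative d) (at z)"
     "((\<lambda>w. - (1 / (z - w) ^ 2 - 1 / w ^ 2)) has_sum d) (L - {0})" by blast
  have "d = - (\<Sum>\<^sub>\<infinity>w\<in>L - {0}. 1 / (z - w) ^ 2 - 1 / w ^ 2)"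
    using d(2) by (metis (no_types, lifting) infsumI infsum_uminus infsum_cong)
  hence "- wp_lat L z = - (1 / z ^ 2) + d" by (simp add: wp_lat_def)
  moreover have "wzeta_lat L = (\<lambda>z. 1 / z + (\<Sum>\<^sub>\<infinity>w\<in>L - {0}. 1 / (z - w) + 1 / w + z / w ^ 2))"
    by (rule ext) (simp add: wzeta_lat_def)
  ultimately show ?thesis
    using nz d(1) by (auto intro!: derivative_eq_intros simp: power2_eq_square)
qed

text \<open>The derivative of the pole term 1 / z^2 becomes the term w = 0 of the derived series.
  The sum then runs over all of L and is visibly invariant under translation by periods, which the
  series of wp itself is not.\<close>

lemma wp_deriv_aux:
  assumes z: "z \<notin> L"
  shows "\<exists>d. (wp_lat L has_field_derivative d) (at z) \<and> ((\<lambda>w. -2 / (z - w) ^ 3) has_sum d) L"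
proof -
  have nz: "z \<noteq> 0" using z zero_mem by auto
  have "\<exists>d. ((\<lambda>x. \<Sum>\<^sub>\<infinity>w\<in>L - {0}. 1 / (x - w) ^ 2 - 1 / w ^ 2) has_field_derivative d) (at z)
           \<and> ((\<lambda>w. -2 / (z - w) ^ 3) has_sum d) (L - {0})"
  proof (rule termwise_derivative(2)[OF open_Compl_L])
    fix w x assume "w \<in> L - {0}" "x \<in> - L"
    hence "x \<noteq> w" by auto
    thus "((\<lambda>x. 1 / (x - w) ^ 2 - 1 / w ^ 2) has_field_derivative -2 / (x - w) ^ 3) (at x)"
      using DERIV_diff[OF inverse_square_deriv DERIV_const] by fastforce
  next
    fix R :: real
    show "\<exists>C. \<forall>w\<in>L - {0}. \<forall>x. norm x \<le> R \<longrightarrow> 2 * R \<le> norm w \<longrightarrow>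
        norm (1 / (x - w) ^ 2 - 1 / w\<^sup>2) \<le> C / norm w ^ 3"
      using wp_term_bound[of _ _ R] by (intro exI[of _ "10 * R"]) auto
  qed (use z in auto)
  then obtain d where d: "((\<lambda>x. \<Sum>\<^sub>\<infinity>w\<in>L - {0}. 1 / (x - w) ^ 2 - 1 / w ^ 2) has_field_derivative d) (at z)"
     "((\<lambda>w. -2 / (z - w) ^ 3) has_sum d) (L - {0})" by blast
  have "((\<lambda>w. -2 / (z - w) ^ 3) has_sum (-2 / (z - 0) ^ 3 + d)) (insert 0 (L - {0}))"
    by (rule has_sum_insert) (use d in auto)
  moreover have "insert 0 (L - {0}) = L" using zero_mem by auto
  moreover have "wp_lat L = (\<lambda>z. 1 / z ^ 2 + (\<Sum>\<^sub>\<infinity>w\<in>L - {0}. 1 / (z - w) ^ 2 - 1 / w ^ 2))"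
    by (rule ext) (simp add: wp_lat_def)
  hence "(wp_lat L has_field_derivative (-2 / (z - 0) ^ 3 + d)) (at z)"
    using DERIV_add[OF inverse_square_deriv[OF nz] d(1)] by simp
  ultimately show ?thesis by metis
qed

definition wp' :: "complex \<Rightarrow> complex" where "wp' = deriv (wp_lat L)"

lemma wp_deriv: "z \<notin> L \<Longrightarrow> (wp_lat L has_field_derivative wp' z) (at z)"
  using wp_deriv_aux[of z] DERIV_imp_deriv unfolding wp'_def by metis

lemma wp'_has_sum: "z \<notin> L \<Longrightarrow> ((\<lambda>w. -2 / (z - w) ^ 3) has_sum wp' z) L"
  using wp_deriv_aux[of z] DERIV_imp_deriv unfolding wp'_def by metis

lemma wp_holomorphic: "wp_lat L holomorphic_on - L"
  using wp_deriv open_Compl_L by (subst holomorphic_on_open) auto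

lemma wp'_holomorphic: "wp' holomorphic_on - L"
  unfolding wp'_def by (intro holomorphic_deriv wp_holomorphic open_Compl_L)

lemma wp'_deriv: "z \<notin> L \<Longrightarrow> (wp' has_field_derivative deriv wp' z) (at z)"
  by (rule holomorphic_derivI[OF wp'_holomorphic open_Compl_L]) auto

lemma wp_even: "wp_lat L (- z) = wp_lat L z"
proof -
  have "(- z - w) ^ 2 = (z - (- w)) ^ 2" for w :: complex
    by (simp add: power2_eq_square algebra_simps)
  hence "infsum (\<lambda>w. 1 / (- z - w) ^ 2 - 1 / w ^ 2) (L - {0})
     = infsum (\<lambda>w. 1 / (z - (- w)) ^ 2 - 1 / (- w) ^ 2) (L - {0})" by simp
  also have "\<dots> = infsum (\<lambda>w. 1 / (z - w) ^ 2 - 1 / w ^ 2) (L - {0})"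
    by (rule infsum_reflect)
  finally show ?thesis by (simp add: wp_lat_def)
qed

lemma wzeta_odd: "wzeta_lat L (- z) = - wzeta_lat L z"
proof -
  have "1 / (- z - w) + 1 / w + (- z) / w ^ 2 = - (1 / (z - (- w)) + 1 / (- w) + z / (- w) ^ 2)"
    for w :: complex
  proof -
    have "- z - w = - (z - (- w))" by simp
    hence "1 / (- z - w) = - (1 / (z - (- w)))" by (metis divide_minus_right)
    thus ?thesis by simp
  qed
  hence "infsum (\<lambda>w. 1 / (- z - w) + 1 / w + (- z) / w ^ 2) (L - {0})
     = infsum (\<lambda>w. - (1 / (z - (- w)) + 1 / (- w) + z / (- w) ^ 2)) (L - {0})"
    by (rule infsum_cong)
  also have "\<dots> = - infsum (\<lambda>w. 1 / (z - (- w)) + 1 / (- w) + z / (- w) ^ 2) (L - {0})"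
    by (rule infsum_uminus)
  also have "\<dots> = - infsum (\<lambda>w. 1 / (z - w) + 1 / w + z / w ^ 2) (L - {0})"
    by (rule arg_cong[OF infsum_reflect[of "\<lambda>w. 1 / (z - w) + 1 / w + z / w ^ 2"]])
  finally have eq: "infsum (\<lambda>w. 1 / (- z - w) + 1 / w + (- z) / w ^ 2) (L - {0})
    = - infsum (\<lambda>w. 1 / (z - w) + 1 / w + z / w ^ 2) (L - {0})" .
  show ?thesis unfolding wzeta_lat_def eq by simp
qed

lemma wp'_odd: "z \<notin> L \<Longrightarrow> wp' (- z) = - wp' z"
proof -
  assume z: "z \<notin> L"
  have "((\<lambda>x. wp_lat L (- x)) has_field_derivative wp' (- z) * (-1)) (at z)"
    by (rule DERIV_chain2[OF wp_deriv]) (use z in \<open>auto intro!: derivative_eq_intros simp: uminus_mem_iff\<close>)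
  hence "(wp_lat L has_field_derivative - wp' (- z)) (at z)" by (simp add: wp_even)
  with wp_deriv[OF z] have "wp' z = - wp' (- z)" by (rule DERIV_unique)
  thus ?thesis by simp
qed

lemma wp'_periodic:
  assumes "l \<in> L" "z \<notin> L"
  shows "wp' (z + l) = wp' z"
proof -
  have "z + l \<notin> L" using assms add_mem_iff by blast
  from wp'_has_sum[OF this] have "((\<lambda>w. -2 / (z + l - w) ^ 3) has_sum wp' (z + l)) L" .
  also have "?this \<longleftrightarrow> ((\<lambda>w. -2 / (z - w) ^ 3) has_sum wp' (z + l)) L"
    by (rule has_sum_reindex_bij_witness[of _ "\<lambda>w. w + l" "\<lambda>w. w - l"])
       (use assms in \<open>auto simp: diff_mem add_mem algebra_simps\<close>)
  finally show ?thesis using wp'_has_sum[OF assms(2)] has_sum_unique by blast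
qed

lemma constant_on_Compl_L:
  assumes "\<And>z. z \<notin> L \<Longrightarrow> (f has_field_derivative 0) (at z)"
  shows "\<exists>c. \<forall>z. z \<notin> L \<longrightarrow> f z = c"
proof -
  have "f constant_on - L"
    by (rule has_field_derivative_0_imp_constant_on[OF _ connected_Compl_L open_Compl_L])
       (use assms in auto)
  thus ?thesis by (auto simp: constant_on_def)
qed

text \<open>The difference has derivative zero, hence is a constant c; evenness turns its value at -
  (z + l) into - c. Unlike the usual evaluation at - l / 2, this also covers periods l whose half is
  again a period.\<close>

lemma wp_periodic:
  assumes "l \<in> L" "z \<notin> L"
  shows "wp_lat L (z + l) = wp_lat L z"
proof -
  have "\<exists>c. \<forall>z. z \<notin> L \<longrightarrow> wp_lat L (z + l) - wp_lat L z = c"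
  proof (rule constant_on_Compl_L)
    fix z assume z: "z \<notin> L"
    hence zl: "z + l \<notin> L" using assms add_mem_iff by blast
    have "((\<lambda>z. wp_lat L (z + l)) has_field_derivative wp' (z + l) * 1) (at z)"
      by (rule DERIV_chain2[where g = "\<lambda>z. z + l", OF wp_deriv[OF zl]]) (auto intro!: derivative_eq_intros)
    from DERIV_diff[OF this wp_deriv[OF z]]
    show "((\<lambda>z. wp_lat L (z + l) - wp_lat L z) has_field_derivative 0) (at z)"
      using wp'_periodic[OF assms(1) z] by simp
  qed
  then obtain c where c: "\<And>z. z \<notin> L \<Longrightarrow> wp_lat L (z + l) - wp_lat L z = c" by blast
  have "- (z + l) \<notin> L" using assms by (simp only: uminus_mem_iff add_mem_iff not_False_eq_True)
  from c[OF this] have "wp_lat L z - wp_lat L (z + l) = c"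
    using wp_even[of z] wp_even[of "z + l"] by simp
  moreover note c[OF assms(2)]
  ultimately have "2 * c = (wp_lat L z - wp_lat L (z + l)) + (wp_lat L (z + l) - wp_lat L z)"
    by simp
  hence "c = 0" by simp
  with c[OF assms(2)] show ?thesis by simp
qed

lemma wzeta_quasi_periodic:
  assumes "l \<in> L"
  shows "\<exists>\<eta>. \<forall>z. z \<notin> L \<longrightarrow> wzeta_lat L (z + l) = wzeta_lat L z + \<eta>"
proof -
  have "\<exists>c. \<forall>z. z \<notin> L \<longrightarrow> wzeta_lat L (z + l) - wzeta_lat L z = c"
  proof (rule constant_on_Compl_L)
    fix z assume z: "z \<notin> L"
    hence zl: "z + l \<notin> L" using assms add_mem_iff by blast
    have "((\<lambda>z. wzeta_lat L (z + l)) has_field_derivative - wp_lat L (z + l) * 1) (at z)"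
      by (rule DERIV_chain2[where g = "\<lambda>z. z + l", OF wzeta_deriv[OF zl]]) (auto intro!: derivative_eq_intros)
    from DERIV_diff[OF this wzeta_deriv[OF z]]
    show "((\<lambda>z. wzeta_lat L (z + l) - wzeta_lat L z) has_field_derivative 0) (at z)"
      using wp_periodic[OF assms(1) z] by simp
  qed
  then obtain c where "\<forall>z. z \<notin> L \<longrightarrow> wzeta_lat L (z + l) - wzeta_lat L z = c" by blast
  thus ?thesis by (intro exI[of _ c]) (auto simp: algebra_simps)
qed

text \<open>The quasi-period of l is found at z = - l / 2, where oddness gives 2 wzeta(l / 2); this
  point must not be a pole.\<close>

lemma wzeta_add_multiple:
  assumes "l \<in> L" "z \<notin> L" "l / 2 \<notin> L"
  shows "wzeta_lat L (z + of_int m * l) = wzeta_lat L z + 2 * of_int m * wzeta_lat L (l / 2)"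
proof -
  obtain \<eta> where \<eta>: "\<And>z. z \<notin> L \<Longrightarrow> wzeta_lat L (z + l) = wzeta_lat L z + \<eta>"
    using wzeta_quasi_periodic[OF assms(1)] by blast
  have "wzeta_lat L (- (l / 2) + l) = wzeta_lat L (- (l / 2)) + \<eta>"
    by (rule \<eta>) (use assms uminus_mem_iff in auto)
  hence eta: "\<eta> = 2 * wzeta_lat L (l / 2)" by (simp add: wzeta_odd)
  have mult: "of_int k * l \<in> L" for k
  proof (induction k rule: int_induct[where k = 0])
    case (step1 i)
    then show ?case using add_mem[OF step1(2) assms(1)] by (simp add: algebra_simps)
  next
    case (step2 i)
    then show ?case using diff_mem[OF step2(2) assms(1)] by (simp add: algebra_simps)
  qed (simp add: zero_mem)
  have notin: "z + of_int k * l \<notin> L" for k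
    using assms(2) mult add_mem_iff by blast
  show ?thesis
  proof (induction m rule: int_induct[where k = 0])
    case (step1 i)
    have "wzeta_lat L (z + of_int (i + 1) * l) = wzeta_lat L ((z + of_int i * l) + l)"
      by (simp add: algebra_simps)
    also have "\<dots> = wzeta_lat L (z + of_int i * l) + \<eta>" by (rule \<eta>[OF notin])
    finally show ?case using step1 by (simp add: eta algebra_simps)
  next
    case (step2 i)
    have "wzeta_lat L (z + of_int i * l) = wzeta_lat L ((z + of_int (i - 1) * l) + l)"
      by (simp add: algebra_simps)
    also have "\<dots> = wzeta_lat L (z + of_int (i - 1) * l) + \<eta>" by (rule \<eta>[OF notin])
    finally show ?case using step2 by (simp add: eta algebra_simps)
  qed simp
qed

end

section \<open>Expansion at the origin\<close>

lemma inverse_cube_deriv: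
  fixes x :: complex
  assumes "x \<noteq> 0"
  shows "((\<lambda>x. -2 / x ^ 3) has_field_derivative 6 / x ^ 4) (at x)"
proof -
  have "((\<lambda>x. -2 * inverse (x ^ 3)) has_field_derivative -2 * - (inverse (x ^ 3) * (3 * x ^ 2) * inverse (x ^ 3))) (at x)"
    using assms by (auto intro!: derivative_eq_intros)
  also have "-2 * - (inverse (x ^ 3) * (3 * x ^ 2) * inverse (x ^ 3)) = 6 / x ^ 4"
    using assms by (simp add: divide_simps eval_nat_numeral)
  finally show ?thesis by (simp add: divide_inverse)
qed

context summable_lattice
begin

lemma power_summable:
  assumes "k \<ge> 3"
  shows "(\<lambda>w::complex. 1 / w ^ k) summable_on (L - {0})"
proof (rule abs_summable_summable, rule summable_if_cubic_decay)
  fix w :: complex assume "w \<in> L - {0}" "1 \<le> norm w"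
  hence "norm w ^ 3 \<le> norm w ^ k" by (intro power_increasing assms) auto
  hence "1 / norm w ^ k \<le> 1 / norm w ^ 3"
    using \<open>1 \<le> norm w\<close> by (intro divide_left_mono mult_pos_pos zero_less_power) auto
  thus "norm (1 / w ^ k) \<le> 1 / norm w ^ 3"
    by (simp add: norm_divide norm_power)
qed

lemma odd_power_has_sum:
  assumes "k \<ge> 3" "odd k"
  shows "((\<lambda>w::complex. 1 / w ^ k) has_sum 0) (L - {0})"
proof -
  define s where "s = infsum (\<lambda>w::complex. 1 / w ^ k) (L - {0})"
  have "s = infsum (\<lambda>w. 1 / (- w) ^ k) (L - {0})"
    unfolding s_def by (rule infsum_reflect[symmetric])
  also have "\<dots> = infsum (\<lambda>w. - (1 / w ^ k)) (L - {0})"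
    using assms by (simp add: power_minus_odd)
  also have "\<dots> = - s" unfolding s_def by (rule infsum_uminus)
  finally have "s = 0" by simp
  thus ?thesis using power_summable[OF assms(1)] by (metis s_def has_sum_infsum)
qed

text \<open>The expansion stops at z^4 with an explicit remainder: this is just far enough to see
  the principal parts and constant terms of both differential equations cancel. The odd power sums
  drop out by reflection, and 60 / 20 = 3 and 140 / 28 = 5 are the Taylor coefficients.\<close>

lemma wp_expansion:
  obtains k where "k holomorphic_on - (L - {0})"
    "\<And>z. z \<notin> L \<Longrightarrow> wp_lat L z = 1 / z ^ 2 + lattice_g2 L / 20 * z ^ 2 + lattice_g3 L / 28 * z ^ 4 + z ^ 5 * k z"
proof
  \<comment> \<open>With t = x / w, this is the closed form of the tail of (n + 1) t^n from n = 5
    on, t^5 (6 - 5 t) / (1 - t)^2, after division by w^2 x^5.\<close>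
  define K where "K = (\<lambda>w x :: complex. (6 * w - 5 * x) / (w ^ 6 * (x - w) ^ 2))"
  define k where "k = (\<lambda>x. infsum (\<lambda>w. K w x) (L - {0}))"
  have op: "open (- (L - {0}))" by (rule open_Compl[OF closed_nonzero])
  have der: "(K w has_field_derivative deriv (K w) x) (at x)"
    if "w \<in> L - {0}" "x \<in> - (L - {0})" for w x
    by (rule holomorphic_derivI[OF _ op that(2)])
       (use that in \<open>auto simp: K_def intro!: holomorphic_intros\<close>)
  obtain \<delta> where \<delta>: "\<delta> > 0" "\<And>w. w \<in> L - {0} \<Longrightarrow> \<delta> \<le> norm w"
    using nonlattice_near_0 by blast
  have bound: "\<exists>C. \<forall>w\<in>L - {0}. \<forall>x. norm x \<le> R \<longrightarrow> 2 * R \<le> norm w \<longrightarrow> norm (K w x) \<le> C / norm w ^ 3"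
    for R
  proof (intro exI ballI allI impI)
    fix w x :: complex assume w: "w \<in> L - {0}" and x: "norm x \<le> R" "2 * R \<le> norm w"
    have n: "norm w > 0" using w by auto
    have xw: "norm w / 2 \<le> norm (x - w)" by (rule half_norm_le[OF x])
    have "norm (6 * w - 5 * x) \<le> norm (6 * w) + norm (5 * x)" by (rule norm_triangle_ineq4)
    also have "\<dots> \<le> 9 * norm w" using x norm_ge_zero[of w] by (simp add: norm_mult del: norm_ge_zero)
    finally have "norm (K w x) \<le> (9 * norm w) / (norm w ^ 6 * (norm w / 2) ^ 2)"
      unfolding K_def norm_divide norm_mult norm_power
      by (intro frac_le mult_left_mono power_mono xw) (use n in auto)
    also have "\<dots> = 36 / norm w ^ 4 / norm w ^ 3"
      using n by (simp add: field_simps eval_nat_numeral)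
    also have "\<dots> \<le> 36 / \<delta> ^ 4 / norm w ^ 3"
      by (intro divide_right_mono divide_left_mono power_mono \<delta> w mult_pos_pos zero_less_power) (use n \<delta> in auto)
    finally show "norm (K w x) \<le> 36 / \<delta> ^ 4 / norm w ^ 3" .
  qed
  note tw = termwise_derivative[OF op _ der bound]
  show "k holomorphic_on - (L - {0})"
    unfolding holomorphic_on_open[OF op] k_def using tw(2) by blast
  fix z assume z: "z \<notin> L"
  have nz: "z \<noteq> 0" using z zero_mem by auto
  have hs: "((\<lambda>w. 2 * z * (1 / w ^ 3) + 3 * z ^ 2 * (1 / w ^ 4) + 4 * z ^ 3 * (1 / w ^ 5)
            + 5 * z ^ 4 * (1 / w ^ 6) + z ^ 5 * K w z) has_sum
        (2 * z * 0 + 3 * z ^ 2 * infsum (\<lambda>w. 1 / w ^ 4) (L - {0}) + 4 * z ^ 3 * 0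
           + 5 * z ^ 4 * infsum (\<lambda>w. 1 / w ^ 6) (L - {0}) + z ^ 5 * k z)) (L - {0})"
    unfolding k_def
    by (intro has_sum_add has_sum_cmult_right has_sum_infsum odd_power_has_sum power_summable tw(1))
       (use z in auto)
  have eq: "2 * z * (1 / w ^ 3) + 3 * z ^ 2 * (1 / w ^ 4) + 4 * z ^ 3 * (1 / w ^ 5)
            + 5 * z ^ 4 * (1 / w ^ 6) + z ^ 5 * K w z = 1 / (z - w) ^ 2 - 1 / w ^ 2"
    if "w \<in> L - {0}" for w
  proof -
    have "w \<noteq> 0" "z - w \<noteq> 0" using that z by auto
    thus ?thesis unfolding K_def
      by (simp add: divide_simps) algebra
  qed
  have "infsum (\<lambda>w. 1 / (z - w) ^ 2 - 1 / w ^ 2) (L - {0}) =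
      3 * z ^ 2 * infsum (\<lambda>w. 1 / w ^ 4) (L - {0}) + 5 * z ^ 4 * infsum (\<lambda>w. 1 / w ^ 6) (L - {0}) + z ^ 5 * k z"
    using infsumI[OF hs[THEN has_sum_cong[THEN iffD1, rotated]]] eq by simp
  thus "wp_lat L z = 1 / z ^ 2 + lattice_g2 L / 20 * z ^ 2 + lattice_g3 L / 28 * z ^ 4 + z ^ 5 * k z"
    by (simp add: wp_lat_def lattice_g2_def lattice_g3_def)
qed

text \<open>All negative powers of z cancel and a factor z remains, so both defects extend
  holomorphically to the origin with value 0. Here \<open>k1\<close> and \<open>k2\<close> are the
  first two derivatives of the remainder \<open>k\<close>.\<close>

lemma defect_expansion:
  obtains k k1 k2 where "k holomorphic_on - (L - {0})" "k1 holomorphic_on - (L - {0})"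
      "k2 holomorphic_on - (L - {0})"
    "\<And>z. z \<notin> L \<Longrightarrow> deriv wp' z - 6 * wp_lat L z ^ 2 + lattice_g2 L / 2 =
       z * (8 * z ^ 2 * k z + 10 * z ^ 3 * k1 z + z ^ 4 * k2 z
       - 6 * z ^ 3 * (lattice_g2 L / 20 + lattice_g3 L / 28 * z ^ 2 + z ^ 3 * k z) ^ 2)"
    "\<And>z. z \<notin> L \<Longrightarrow> wp' z ^ 2 - 4 * wp_lat L z ^ 3 + lattice_g2 L * wp_lat L z + lattice_g3 L =
       z * (- 32 * k z - 4 * z * k1 z
            + z * (lattice_g2 L / 10 + lattice_g3 L / 7 * z ^ 2 + 5 * z ^ 3 * k z + z ^ 4 * k1 z) ^ 2
            - 12 * z * (lattice_g2 L / 20 + lattice_g3 L / 28 * z ^ 2 + z ^ 3 * k z) ^ 2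
            - 4 * z ^ 5 * (lattice_g2 L / 20 + lattice_g3 L / 28 * z ^ 2 + z ^ 3 * k z) ^ 3
            + lattice_g2 L * z * (lattice_g2 L / 20 + lattice_g3 L / 28 * z ^ 2 + z ^ 3 * k z))"
proof -
  define a b where "a = lattice_g2 L / 20" and "b = lattice_g3 L / 28"
  have ab: "lattice_g2 L = 20 * a" "lattice_g3 L = 28 * b" by (simp_all add: a_def b_def)
  obtain k where k: "k holomorphic_on - (L - {0})"
    "\<And>z. z \<notin> L \<Longrightarrow> wp_lat L z = 1 / z ^ 2 + a * z ^ 2 + b * z ^ 4 + z ^ 5 * k z"
    using wp_expansion unfolding a_def b_def by blast
  define k1 k2 where "k1 = deriv k" and "k2 = deriv k1"
  have op: "open (- (L - {0}))" by (rule open_Compl[OF closed_nonzero])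
  have k1: "k1 holomorphic_on - (L - {0})" unfolding k1_def by (intro holomorphic_deriv k op)
  have k2: "k2 holomorphic_on - (L - {0})" unfolding k2_def by (intro holomorphic_deriv k1 op)
  have kd: "(k has_field_derivative k1 z) (at z)" if "z \<notin> L" for z
    unfolding k1_def by (rule holomorphic_derivI[OF k(1) op]) (use that in auto)
  have k1d: "(k1 has_field_derivative k2 z) (at z)" if "z \<notin> L" for z
    unfolding k2_def by (rule holomorphic_derivI[OF k1(1) op]) (use that in auto)
  have nz: "z \<noteq> 0" if "z \<notin> L" for z using that zero_mem by auto
  have wp1: "wp' z = -2 / z ^ 3 + (2 * a * z + 4 * b * z ^ 3 + 5 * z ^ 4 * k z + z ^ 5 * k1 z)"
    if z: "z \<notin> L" for z
  proof -
    have "((\<lambda>z. a * z ^ 2 + b * z ^ 4 + z ^ 5 * k z) has_field_derivative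
        (2 * a * z + 4 * b * z ^ 3 + 5 * z ^ 4 * k z + z ^ 5 * k1 z)) (at z)"
      by (rule derivative_eq_intros kd[OF z] refl)+ (simp add: algebra_simps)
    from DERIV_add[OF inverse_square_deriv[OF nz[OF z]] this]
    have "((\<lambda>z. 1 / z ^ 2 + (a * z ^ 2 + b * z ^ 4 + z ^ 5 * k z)) has_field_derivative
        (-2 / z ^ 3 + (2 * a * z + 4 * b * z ^ 3 + 5 * z ^ 4 * k z + z ^ 5 * k1 z))) (at z)" by simp
    hence "(wp_lat L has_field_derivative
        (-2 / z ^ 3 + (2 * a * z + 4 * b * z ^ 3 + 5 * z ^ 4 * k z + z ^ 5 * k1 z))) (at z)"
      by (rule has_field_derivative_transform_within_open[OF _ open_Compl_L]) (use z k(2) in auto)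
    thus ?thesis using wp_deriv[OF z] DERIV_unique by blast
  qed
  have wp2: "deriv wp' z = 6 / z ^ 4 + (2 * a + 12 * b * z ^ 2 + 20 * z ^ 3 * k z + 10 * z ^ 4 * k1 z + z ^ 5 * k2 z)"
    if z: "z \<notin> L" for z
  proof -
    have "((\<lambda>z. 2 * a * z + 4 * b * z ^ 3 + 5 * z ^ 4 * k z + z ^ 5 * k1 z) has_field_derivative
        (2 * a + 12 * b * z ^ 2 + 20 * z ^ 3 * k z + 10 * z ^ 4 * k1 z + z ^ 5 * k2 z)) (at z)"
      by (rule derivative_eq_intros kd[OF z] k1d[OF z] refl)+ (simp add: algebra_simps)
    from DERIV_add[OF inverse_cube_deriv[OF nz[OF z]] this]
    have "(wp' has_field_derivative
        (6 / z ^ 4 + (2 * a + 12 * b * z ^ 2 + 20 * z ^ 3 * k z + 10 * z ^ 4 * k1 z + z ^ 5 * k2 z))) (at z)"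
      by (rule has_field_derivative_transform_within_open[OF _ open_Compl_L]) (use z wp1 in auto)
    thus ?thesis using DERIV_imp_deriv by blast
  qed
  show ?thesis
  proof (rule that[OF k(1) k1 k2])
    fix z assume z: "z \<notin> L"
    \<comment> \<open>Writing y for 1 / z and keeping only the relation z y = 1 turns the
      cancellation of poles into polynomial identities.\<close>
    define y where "y = inverse z"
    have y: "z * y = 1" using nz[OF z] by (simp add: y_def)
    have e0: "wp_lat L z = y ^ 2 + a * z ^ 2 + b * z ^ 4 + z ^ 5 * k z"
      using k(2)[OF z] by (simp add: y_def power_inverse divide_inverse)
    have e1: "wp' z = -2 * y ^ 3 + (2 * a * z + 4 * b * z ^ 3 + 5 * z ^ 4 * k z + z ^ 5 * k1 z)"
      using wp1[OF z] by (simp add: y_def power_inverse divide_inverse)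
    have e2: "deriv wp' z = 6 * y ^ 4 + (2 * a + 12 * b * z ^ 2 + 20 * z ^ 3 * k z + 10 * z ^ 4 * k1 z + z ^ 5 * k2 z)"
      using wp2[OF z] by (simp add: y_def power_inverse divide_inverse)
    \<comment> \<open>\<open>h\<close> and \<open>d\<close> collect the regular parts: wp = y^2 +
      z^2 h and wp' = - 2 y^3 + z d.\<close>
    define h where "h = a + b * z ^ 2 + z ^ 3 * k z"
    define d where "d = 2 * a + 4 * b * z ^ 2 + 5 * z ^ 3 * k z + z ^ 4 * k1 z"
    have "deriv wp' z - 6 * wp_lat L z ^ 2 + 10 * a = z * (8 * z ^ 2 * k z + 10 * z ^ 3 * k1 z + z ^ 4 * k2 z
       - 6 * z ^ 3 * h ^ 2)"
    proof -
      have "wp_lat L z = y ^ 2 + z ^ 2 * h" unfolding e0 h_def by algebra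
      moreover have "z ^ 2 * y ^ 2 = 1" using y by algebra
      ultimately have "wp_lat L z ^ 2 = y ^ 4 + 2 * h + z ^ 4 * h ^ 2" by algebra
      thus ?thesis unfolding e2 h_def by algebra
    qed
    thus "deriv wp' z - 6 * wp_lat L z ^ 2 + lattice_g2 L / 2 =
       z * (8 * z ^ 2 * k z + 10 * z ^ 3 * k1 z + z ^ 4 * k2 z
       - 6 * z ^ 3 * (lattice_g2 L / 20 + lattice_g3 L / 28 * z ^ 2 + z ^ 3 * k z) ^ 2)"
      unfolding h_def by (simp add: ab)
    have "wp' z ^ 2 - 4 * wp_lat L z ^ 3 + 20 * a * wp_lat L z + 28 * b =
       z * (- 32 * k z - 4 * z * k1 z + z * d ^ 2 - 12 * z * h ^ 2 - 4 * z ^ 5 * h ^ 3 + 20 * a * z * h)"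
    proof -
      have y2: "z ^ 2 * y ^ 2 = 1" using y by algebra
      have w: "wp_lat L z = y ^ 2 + z ^ 2 * h" unfolding e0 h_def by algebra
      hence w3: "wp_lat L z ^ 3 = y ^ 6 + 3 * y ^ 2 * h + 3 * z ^ 2 * h ^ 2 + z ^ 6 * h ^ 3"
        using y2 by algebra
      have "wp' z = -2 * y ^ 3 + z * d" unfolding e1 d_def by algebra
      hence w1: "wp' z ^ 2 = 4 * y ^ 6 - 4 * y ^ 2 * d + z ^ 2 * d ^ 2" using y by algebra
      have yh: "y ^ 2 * h = y ^ 2 * a + b + z * k z" unfolding h_def using y by algebra
      have yd: "y ^ 2 * d = 2 * y ^ 2 * a + 4 * b + 5 * z * k z + z ^ 2 * k1 z" unfolding d_def using y by algebra
      show ?thesis unfolding w1 w3 using yh yd w by algebra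
    qed
    thus "wp' z ^ 2 - 4 * wp_lat L z ^ 3 + lattice_g2 L * wp_lat L z + lattice_g3 L =
       z * (- 32 * k z - 4 * z * k1 z
            + z * (lattice_g2 L / 10 + lattice_g3 L / 7 * z ^ 2 + 5 * z ^ 3 * k z + z ^ 4 * k1 z) ^ 2
            - 12 * z * (lattice_g2 L / 20 + lattice_g3 L / 28 * z ^ 2 + z ^ 3 * k z) ^ 2
            - 4 * z ^ 5 * (lattice_g2 L / 20 + lattice_g3 L / 28 * z ^ 2 + z ^ 3 * k z) ^ 3
            + lattice_g2 L * z * (lattice_g2 L / 20 + lattice_g3 L / 28 * z ^ 2 + z ^ 3 * k z))"
      unfolding h_def d_def by (simp add: ab)
  qed
qed

end

section \<open>Differential equations and uniqueness\<close>

context summable_lattice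
begin

lemma deriv_wp'_periodic:
  assumes "l \<in> L" "z \<notin> L"
  shows "deriv wp' (z + l) = deriv wp' z"
proof -
  have zl: "z + l \<notin> L" using assms add_mem_iff by blast
  have "((\<lambda>z. wp' (z + l)) has_field_derivative deriv wp' (z + l) * 1) (at z)"
    by (rule DERIV_chain2[where g = "\<lambda>z. z + l", OF wp'_deriv[OF zl]])
       (auto intro!: derivative_eq_intros)
  hence "(wp' has_field_derivative deriv wp' (z + l) * 1) (at z)"
    by (rule has_field_derivative_transform_within_open[OF _ open_Compl_L])
       (use assms wp'_periodic in auto)
  thus ?thesis using wp'_deriv[OF assms(2)] DERIV_unique by fastforce
qed

lemma square_times_wp_tendsto: "((\<lambda>z. z ^ 2 * wp_lat L z) \<longlongrightarrow> 1) (at 0)"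
proof -
  obtain k where k: "k holomorphic_on - (L - {0})"
    "\<And>z. z \<notin> L \<Longrightarrow> wp_lat L z = 1 / z ^ 2 + lattice_g2 L / 20 * z ^ 2 + lattice_g3 L / 28 * z ^ 4 + z ^ 5 * k z"
    using wp_expansion by blast
  have op: "open (- (L - {0}))" by (rule open_Compl[OF closed_nonzero])
  have "isCont k 0"
    using holomorphic_on_imp_continuous_on[OF k(1)] op by (simp add: continuous_on_eq_continuous_at)
  hence "((\<lambda>z. 1 + z ^ 2 * (lattice_g2 L / 20 * z ^ 2 + lattice_g3 L / 28 * z ^ 4 + z ^ 5 * k z))
      \<longlongrightarrow> 1 + 0 ^ 2 * (lattice_g2 L / 20 * 0 ^ 2 + lattice_g3 L / 28 * 0 ^ 4 + 0 ^ 5 * k 0)) (at 0)"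
    unfolding isCont_def by (intro tendsto_intros)
  moreover have "\<forall>\<^sub>F z in at 0. z \<in> - (L - {0}) - {0}"
    by (rule eventually_at_in_open[OF op]) simp
  hence "\<forall>\<^sub>F z in at 0. 1 + z ^ 2 * (lattice_g2 L / 20 * z ^ 2 + lattice_g3 L / 28 * z ^ 4 + z ^ 5 * k z)
      = z ^ 2 * wp_lat L z"
  proof eventually_elim
    case (elim z)
    hence "z \<notin> L" "z \<noteq> 0" by auto
    thus ?case using k(2)[of z] by (simp add: algebra_simps)
  qed
  ultimately show ?thesis by (simp add: filterlim_cong)
qed

lemma wp_no_limit_at_lattice:
  assumes "l \<in> L"
  shows "\<not> (wp_lat L \<longlongrightarrow> c) (at l)"
proof
  assume "(wp_lat L \<longlongrightarrow> c) (at l)"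
  hence "((\<lambda>z. wp_lat L (l + z)) \<longlongrightarrow> c) (at 0)" by (rule LIM_offset_zero)
  moreover have "\<forall>\<^sub>F z in at 0. z \<in> - (L - {0}) - {0}"
    by (rule eventually_at_in_open[OF open_Compl[OF closed_nonzero]]) simp
  hence "\<forall>\<^sub>F z in at 0. wp_lat L (l + z) = wp_lat L z"
    by eventually_elim (use wp_periodic[OF assms] in \<open>auto simp: add.commute\<close>)
  ultimately have "(wp_lat L \<longlongrightarrow> c) (at 0)" by (simp add: filterlim_cong)
  hence "((\<lambda>z. z ^ 2 * wp_lat L z) \<longlongrightarrow> 0 ^ 2 * c) (at 0)" by (intro tendsto_intros)
  with square_times_wp_tendsto show False
    using tendsto_unique[OF trivial_limit_at] by fastforce
qed

text \<open>Near 0 the function 1 / wp extends to z^2 / D(z) with value 0 at 0, and the open mapping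
  theorem makes it cover a disc around 0. Only large values are claimed, since wp of a rank one
  lattice omits a value; they suffice to find a common value for two lattices.\<close>

lemma wp_attains_large_values: "\<exists>M. \<forall>s. norm s > M \<longrightarrow> (\<exists>u. u \<notin> L \<and> wp_lat L u = s)"
proof -
  obtain k where k: "k holomorphic_on - (L - {0})"
    "\<And>z. z \<notin> L \<Longrightarrow> wp_lat L z = 1 / z ^ 2 + lattice_g2 L / 20 * z ^ 2 + lattice_g3 L / 28 * z ^ 4 + z ^ 5 * k z"
    using wp_expansion by blast
  define D where "D = (\<lambda>z. 1 + z ^ 2 * (lattice_g2 L / 20 * z ^ 2 + lattice_g3 L / 28 * z ^ 4 + z ^ 5 * k z))"
  have op: "open (- (L - {0}))" by (rule open_Compl[OF closed_nonzero])
  have D: "D holomorphic_on - (L - {0})" unfolding D_def by (intro holomorphic_intros k)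
  have wp: "wp_lat L z = D z / z ^ 2" if "z \<notin> L" for z
  proof -
    have "z \<noteq> 0" using that zero_mem by auto
    thus ?thesis using k(2)[OF that] by (simp add: D_def field_simps)
  qed
  have "open {z \<in> - (L - {0}). D z \<in> - {0}}"
    using continuous_open_preimage[OF holomorphic_on_imp_continuous_on[OF D] op, of "- {0}"]
    by (auto simp: vimage_def Int_def)
  moreover have "0 \<in> {z \<in> - (L - {0}). D z \<in> - {0}}" by (simp add: D_def)
  ultimately obtain r where r: "r > 0" "ball 0 r \<subseteq> {z \<in> - (L - {0}). D z \<in> - {0}}"
    using open_contains_ball by blast
  define g where "g = (\<lambda>z. z ^ 2 / D z)"
  have g: "g holomorphic_on ball 0 r"
    unfolding g_def by (intro holomorphic_intros holomorphic_on_subset[OF D]) (use r in auto)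
  have "\<not> g constant_on ball 0 r"
  proof
    assume "g constant_on ball 0 r"
    then obtain c where c: "\<And>z. z \<in> ball 0 r \<Longrightarrow> g z = c" by (auto simp: constant_on_def)
    have "g 0 = 0" by (simp add: g_def)
    hence "g (of_real (r / 2)) = 0" using c[of 0] c[of "of_real (r / 2)"] r by simp
    moreover have "D (of_real (r / 2)) \<noteq> 0" using r by (auto simp: subset_iff)
    ultimately show False using r by (simp add: g_def)
  qed
  hence "open (g ` ball 0 r)"
    by (intro open_mapping_thm[OF g]) auto
  moreover have "0 \<in> g ` ball 0 r" using r by (intro image_eqI[of _ _ 0]) (auto simp: g_def)
  ultimately obtain e where e: "e > 0" "ball 0 e \<subseteq> g ` ball 0 r"
    using open_contains_ball by blast
  show ?thesis
  proof (intro exI[of _ "1 / e"] allI impI)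
    fix s :: complex assume s: "1 / e < norm s"
    have sp: "norm s > 0" using s e by (meson divide_pos_pos less_trans zero_less_one)
    have "1 / s \<in> ball 0 e" using s e sp by (simp add: norm_divide field_simps)
    then obtain z where z: "z \<in> ball 0 r" "1 / s = g z" using e by auto
    have "z \<noteq> 0" using z sp by (auto simp: g_def)
    hence "z \<notin> L" using r z by auto
    moreover have "D z \<noteq> 0" using r z by auto
    ultimately have "wp_lat L z = s"
      using z(2) \<open>z \<noteq> 0\<close> sp wp[of z] by (auto simp: g_def field_simps)
    with \<open>z \<notin> L\<close> show "\<exists>u. u \<notin> L \<and> wp_lat L u = s" by blast
  qed
qed

end

text \<open>The extra assumption makes Liouville's theorem applicable to differential polynomials in
  \<open>\<wp>\<close>: modulo \<open>L\<close>, every point is bounded or lies where \<open>\<wp>\<close> and \<open>\<wp>''\<close> are bounded. The second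
  alternative is only needed for lattices of rank one.\<close>
locale weierstrass_lattice = summable_lattice +
  assumes bounded_modulo: "\<exists>K. \<forall>z. \<exists>w\<in>L. norm (z - w) \<le> K \<or>
     (z - w \<notin> L \<and> norm (wp_lat L (z - w)) \<le> K \<and> norm (deriv (deriv (wp_lat L)) (z - w)) \<le> K)"
begin

text \<open>The defect, set to 0 on L, is entire: \<open>defect_expansion\<close> removes the
  singularity at 0 with precisely this value, and periodicity carries this to all of L. It is
  bounded by \<open>bounded_modulo\<close>, hence constant by Liouville, and it vanishes at
  0.\<close>

lemma wp_second_order_ode:
  assumes "z \<notin> L"
  shows "deriv wp' z = 6 * wp_lat L z ^ 2 - lattice_g2 L / 2"
proof -
  obtain k k1 k2 where k: "k holomorphic_on - (L - {0})" "k1 holomorphic_on - (L - {0})"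
      "k2 holomorphic_on - (L - {0})" and
    e: "\<And>z. z \<notin> L \<Longrightarrow> deriv wp' z - 6 * wp_lat L z ^ 2 + lattice_g2 L / 2 =
       z * (8 * z ^ 2 * k z + 10 * z ^ 3 * k1 z + z ^ 4 * k2 z
       - 6 * z ^ 3 * (lattice_g2 L / 20 + lattice_g3 L / 28 * z ^ 2 + z ^ 3 * k z) ^ 2)"
    using defect_expansion by metis
  define q where "q = (\<lambda>z. z * (8 * z ^ 2 * k z + 10 * z ^ 3 * k1 z + z ^ 4 * k2 z
       - 6 * z ^ 3 * (lattice_g2 L / 20 + lattice_g3 L / 28 * z ^ 2 + z ^ 3 * k z) ^ 2))"
  define f where "f = (\<lambda>z. deriv wp' z - 6 * wp_lat L z ^ 2 + lattice_g2 L / 2)"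
  define F where "F = (\<lambda>z. if z \<in> L then 0 else f z)"
  have op: "open (- (L - {0}))" by (rule open_Compl[OF closed_nonzero])
  have q: "q holomorphic_on - (L - {0})" unfolding q_def by (intro holomorphic_intros k)
  have Fq: "F z = q z" if "z \<in> - (L - {0})" for z
    using that e[of z] zero_mem by (cases "z = 0") (auto simp: F_def f_def q_def)
  have F_periodic: "F (z + l) = F z" if "l \<in> L" for l z
    using wp_periodic[OF that, of z] deriv_wp'_periodic[OF that, of z] add_mem_iff[OF that, of z]
    by (auto simp: F_def f_def)
  have F0: "F field_differentiable (at z)" if "z \<in> - (L - {0})" for z
  proof -
    have "F holomorphic_on - (L - {0})"
      using q by (rule holomorphic_transform) (simp add: Fq)
    thus ?thesis using op that by (simp add: holomorphic_on_imp_differentiable_at)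
  qed
  have F_hol: "F holomorphic_on UNIV"
    unfolding holomorphic_on_def
  proof
    fix z show "F field_differentiable (at z)"
    proof (cases "z \<in> L")
      case True
      obtain d where "(F has_field_derivative d) (at 0)"
        using F0[of 0] by (auto simp: field_differentiable_def)
      hence "((\<lambda>x. F (x - z)) has_field_derivative d * 1) (at z)"
        by (intro DERIV_chain2[of F _ "\<lambda>x. x - z"]) (auto intro!: derivative_eq_intros)
      moreover have "F (x - z) = F x" for x using F_periodic[OF True, of "x - z"] by simp
      ultimately show ?thesis by (auto simp: field_differentiable_def)
    qed (use F0 in auto)
  qed
  obtain K where K: "\<And>z. \<exists>w\<in>L. norm (z - w) \<le> K \<or>
     (z - w \<notin> L \<and> norm (wp_lat L (z - w)) \<le> K \<and> norm (deriv (deriv (wp_lat L)) (z - w)) \<le> K)"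
    using bounded_modulo by blast
  have "bounded (F ` cball 0 K)"
    by (intro compact_imp_bounded compact_continuous_image holomorphic_on_imp_continuous_on
          holomorphic_on_subset[OF F_hol]) auto
  then obtain B where B: "\<And>z. norm z \<le> K \<Longrightarrow> norm (F z) \<le> B"
    unfolding bounded_iff by (metis imageI mem_cball_0)
  have "bounded (range F)"
  proof (rule boundedI)
    fix x assume "x \<in> range F"
    then obtain z where x: "x = F z" by auto
    obtain w where w: "w \<in> L" "norm (z - w) \<le> K \<or>
     (z - w \<notin> L \<and> norm (wp_lat L (z - w)) \<le> K \<and> norm (deriv (deriv (wp_lat L)) (z - w)) \<le> K)"
      using K by blast
    have Fz: "F z = F (z - w)" using F_periodic[OF w(1), of "z - w"] by simp
    show "norm x \<le> max B (K + 6 * K ^ 2 + norm (lattice_g2 L / 2))"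
      using w(2)
    proof
      assume "norm (z - w) \<le> K"
      thus ?thesis using B[of "z - w"] by (simp add: x Fz)
    next
      assume *: "z - w \<notin> L \<and> norm (wp_lat L (z - w)) \<le> K \<and> norm (deriv (deriv (wp_lat L)) (z - w)) \<le> K"
      have "norm (F (z - w)) \<le> norm (deriv wp' (z - w)) + norm (6 * wp_lat L (z - w) ^ 2) + norm (lattice_g2 L / 2)"
      proof -
        have "norm (a - b + c) \<le> norm a + norm b + norm c" for a b c :: complex
          by (intro norm_triangle_le add_mono norm_triangle_ineq4 order_refl)
        moreover have "F (z - w) = deriv wp' (z - w) - 6 * wp_lat L (z - w) ^ 2 + lattice_g2 L / 2"
          using * by (simp add: F_def f_def)
        ultimately show ?thesis by presburger
      qed
      also have "norm (6 * wp_lat L (z - w) ^ 2) \<le> 6 * K ^ 2"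
        using * by (simp add: norm_mult norm_power power_mono)
      also have "norm (deriv wp' (z - w)) \<le> K" using * by (simp add: wp'_def)
      finally show ?thesis by (simp add: x Fz)
    qed
  qed
  with F_hol have "F constant_on UNIV" by (rule Liouville_theorem)
  moreover have "F 0 = 0" using zero_mem by (simp add: F_def)
  ultimately have "F z = 0" by (metis constant_on_def UNIV_I)
  thus ?thesis using assms by (simp add: F_def f_def algebra_simps)
qed

text \<open>This is the integrated form of the second order equation: the defect has derivative wp'
  (2 wp'' - 12 wp^2 + g2) = 0, and its constant value is its limit at 0.\<close>

lemma wp_ode:
  assumes "z \<notin> L"
  shows "wp' z ^ 2 = 4 * wp_lat L z ^ 3 - lattice_g2 L * wp_lat L z - lattice_g3 L"
proof -
  define f where "f = (\<lambda>z. wp' z ^ 2 - 4 * wp_lat L z ^ 3 + lattice_g2 L * wp_lat L z + lattice_g3 L)"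
  have "\<exists>c. \<forall>z. z \<notin> L \<longrightarrow> f z = c"
  proof (rule constant_on_Compl_L)
    fix z assume z: "z \<notin> L"
    have "(f has_field_derivative 2 * wp' z * deriv wp' z - 12 * wp_lat L z ^ 2 * wp' z
           + lattice_g2 L * wp' z) (at z)"
      unfolding f_def
      by (rule derivative_eq_intros wp_deriv[OF z] wp'_deriv[OF z] refl)+ simp
    thus "(f has_field_derivative 0) (at z)"
      unfolding wp_second_order_ode[OF z] by (simp add: algebra_simps)
  qed
  then obtain c where c: "\<And>z. z \<notin> L \<Longrightarrow> f z = c" by blast
  obtain k k1 k2 where k: "k holomorphic_on - (L - {0})" "k1 holomorphic_on - (L - {0})" and
    e: "\<And>z. z \<notin> L \<Longrightarrow> wp' z ^ 2 - 4 * wp_lat L z ^ 3 + lattice_g2 L * wp_lat L z + lattice_g3 L =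
       z * (- 32 * k z - 4 * z * k1 z
            + z * (lattice_g2 L / 10 + lattice_g3 L / 7 * z ^ 2 + 5 * z ^ 3 * k z + z ^ 4 * k1 z) ^ 2
            - 12 * z * (lattice_g2 L / 20 + lattice_g3 L / 28 * z ^ 2 + z ^ 3 * k z) ^ 2
            - 4 * z ^ 5 * (lattice_g2 L / 20 + lattice_g3 L / 28 * z ^ 2 + z ^ 3 * k z) ^ 3
            + lattice_g2 L * z * (lattice_g2 L / 20 + lattice_g3 L / 28 * z ^ 2 + z ^ 3 * k z))"
    using defect_expansion by metis
  define q where "q = (\<lambda>z. - 32 * k z - 4 * z * k1 z
            + z * (lattice_g2 L / 10 + lattice_g3 L / 7 * z ^ 2 + 5 * z ^ 3 * k z + z ^ 4 * k1 z) ^ 2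
            - 12 * z * (lattice_g2 L / 20 + lattice_g3 L / 28 * z ^ 2 + z ^ 3 * k z) ^ 2
            - 4 * z ^ 5 * (lattice_g2 L / 20 + lattice_g3 L / 28 * z ^ 2 + z ^ 3 * k z) ^ 3
            + lattice_g2 L * z * (lattice_g2 L / 20 + lattice_g3 L / 28 * z ^ 2 + z ^ 3 * k z))"
  have op: "open (- (L - {0}))" by (rule open_Compl[OF closed_nonzero])
  have "q holomorphic_on - (L - {0})" unfolding q_def by (intro holomorphic_intros k)
  hence "isCont q 0"
    using holomorphic_on_imp_continuous_on[of q, THEN continuous_on_interior] op by (simp add: interior_open)
  hence "((\<lambda>z. z * q z) \<longlongrightarrow> 0 * q 0) (at 0)"
    unfolding isCont_def by (intro tendsto_intros)
  moreover have "\<forall>\<^sub>F z in at 0. z \<in> - (L - {0}) - {0}"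
    by (rule eventually_at_in_open[OF op]) simp
  hence "\<forall>\<^sub>F z in at 0. z * q z = c"
  proof eventually_elim
    case (elim z)
    hence "z \<notin> L" by auto
    thus ?case using c[of z] e[of z] by (simp add: q_def f_def)
  qed
  ultimately have "((\<lambda>z. c) \<longlongrightarrow> 0) (at (0::complex))" by (simp add: filterlim_cong)
  hence "c = 0" by (simp add: tendsto_const_iff)
  thus ?thesis using c[OF assms] by (simp add: f_def algebra_simps)
qed

end

section \<open>Uniqueness of solutions and of the lattice\<close>

text \<open>The Leibniz rule expresses the derivative of order n + 2 at z0 through those of order at
  most n, so all Taylor coefficients agree. The first order equation would not determine the
  solution: at a root of the cubic it also has a constant solution.\<close>

lemma second_order_ode_unique:
  fixes f g :: "complex \<Rightarrow> complex"
  assumes S: "open S" "connected S" and hol: "f holomorphic_on S" "g holomorphic_on S"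
    and f: "\<And>z. z \<in> S \<Longrightarrow> deriv (deriv f) z = 6 * f z ^ 2 - k"
    and g: "\<And>z. z \<in> S \<Longrightarrow> deriv (deriv g) z = 6 * g z ^ 2 - k"
    and z0: "z0 \<in> S" "f z0 = g z0" "deriv f z0 = deriv g z0" and "z \<in> S"
  shows "f z = g z"
proof (rule holomorphic_fun_eq_on_connected[OF hol S _ z0(1) assms(10)])
  have step: "(deriv ^^ Suc (Suc n)) h z0
      = (6 * (\<Sum>i=0..n. of_nat (n choose i) * (deriv ^^ i) h z0 * (deriv ^^ (n - i)) h z0))
        - (if n = 0 then k else 0)"
    if h: "h holomorphic_on S" "\<And>z. z \<in> S \<Longrightarrow> deriv (deriv h) z = 6 * h z ^ 2 - k" for h n
  proof -
    have "(deriv ^^ Suc (Suc n)) h z0 = (deriv ^^ n) (deriv (deriv h)) z0"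
      by (simp add: funpow_swap1)
    also have "\<dots> = (deriv ^^ n) (\<lambda>z. 6 * (h z * h z) - k) z0"
      by (rule higher_deriv_transform_within_open[OF _ _ S(1) z0(1)])
         (use h in \<open>auto simp: power2_eq_square intro!: holomorphic_intros holomorphic_deriv S\<close>)
    also have "\<dots> = (deriv ^^ n) (\<lambda>z. 6 * (h z * h z)) z0 - (deriv ^^ n) (\<lambda>z. k) z0"
      by (rule higher_deriv_diff[OF _ _ S(1) z0(1)]) (intro holomorphic_intros h)+
    also have "(deriv ^^ n) (\<lambda>z. 6 * (h z * h z)) z0 = 6 * (deriv ^^ n) (\<lambda>z. h z * h z) z0"
      by (rule higher_deriv_cmult[OF _ z0(1) S(1)]) (intro holomorphic_intros h)
    also have "(deriv ^^ n) (\<lambda>z. h z * h z) z0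
        = (\<Sum>i=0..n. of_nat (n choose i) * (deriv ^^ i) h z0 * (deriv ^^ (n - i)) h z0)"
      by (rule higher_deriv_mult[OF h(1) h(1) S(1) z0(1)])
    finally show ?thesis by simp
  qed
  show "(deriv ^^ n) f z0 = (deriv ^^ n) g z0" for n
  proof (induction n rule: less_induct)
    case (less n)
    show ?case
    proof (cases "n \<le> 1")
      case True
      thus ?thesis using z0 by (cases n) auto
    next
      case False
      then obtain m where n: "n = Suc (Suc m)"
        by (metis One_nat_def not0_implies_Suc le0 le_SucI nat_le_linear not_less_eq_eq old.nat.exhaust)
      have IH: "(deriv ^^ i) f z0 = (deriv ^^ i) g z0" if "i \<le> m" for i
        by (rule less) (use that n in simp)
      have "(\<Sum>i=0..m. of_nat (m choose i) * (deriv ^^ i) f z0 * (deriv ^^ (m - i)) f z0)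
        = (\<Sum>i=0..m. of_nat (m choose i) * (deriv ^^ i) g z0 * (deriv ^^ (m - i)) g z0)"
        by (rule sum.cong) (simp_all add: IH)
      moreover have "(deriv ^^ Suc (Suc m)) f z0
          = (6 * (\<Sum>i=0..m. of_nat (m choose i) * (deriv ^^ i) f z0 * (deriv ^^ (m - i)) f z0))
            - (if m = 0 then k else 0)"
        by (rule step) (fact hol f)+
      moreover have "(deriv ^^ Suc (Suc m)) g z0
          = (6 * (\<Sum>i=0..m. of_nat (m choose i) * (deriv ^^ i) g z0 * (deriv ^^ (m - i)) g z0))
            - (if m = 0 then k else 0)"
        by (rule step) (fact hol g)+
      ultimately show ?thesis unfolding n by (simp only:)
    qed
  qed
qed

text \<open>Initial data propagate, by the second order equation, to all points that are poles of
  neither translate, and the double poles of one side must then be poles of the other.\<close>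
lemma lattice_translates_eq:
  assumes "weierstrass_lattice L1" "weierstrass_lattice L2"
    and g2: "lattice_g2 L1 = lattice_g2 L2"
    and uv: "u \<notin> L1" "v \<notin> L2" "wp_lat L1 u = wp_lat L2 v"
      "deriv (wp_lat L1) u = deriv (wp_lat L2) v"
  shows "u + z \<in> L1 \<longleftrightarrow> v + z \<in> L2"
proof -
  interpret A: weierstrass_lattice L1 by fact
  interpret B: weierstrass_lattice L2 by fact
  \<comment> \<open>The points where neither translate has a pole; the complement of a countable set
    is connected, so agreement at 0 spreads over all of S.\<close>
  define S where "S = - ((\<lambda>w. - u + w) ` L1 \<union> (\<lambda>w. - v + w) ` L2)"
  have S_iff: "z \<in> S \<longleftrightarrow> u + z \<notin> L1 \<and> v + z \<notin> L2" for z
    unfolding S_def by (auto simp: image_iff algebra_simps)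
  have S: "open S" "connected S"
    unfolding S_def
    by (rule open_Compl, rule closed_Un, rule A.closed_translate, rule B.closed_translate)
       (rule path_connected_imp_connected, rule path_connected_complement_countable,
        auto intro!: countable_image A.countable_L B.countable_L)
  have der: "((\<lambda>z. wp_lat L (w + z)) has_field_derivative summable_lattice.wp' L (w + z)) (at z)"
      "((\<lambda>z. summable_lattice.wp' L (w + z)) has_field_derivative deriv (summable_lattice.wp' L) (w + z)) (at z)"
    if "weierstrass_lattice L" "w + z \<notin> L" for L w z
  proof -
    interpret weierstrass_lattice L by fact
    have sh: "((\<lambda>z. w + z) has_field_derivative 1) (at z)"
      by (auto intro!: derivative_eq_intros)
    show "((\<lambda>z. wp_lat L (w + z)) has_field_derivative wp' (w + z)) (at z)"
      using DERIV_chain2[where g = "\<lambda>z. w + z", OF wp_deriv[OF that(2)] sh] by simp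
    show "((\<lambda>z. wp' (w + z)) has_field_derivative deriv wp' (w + z)) (at z)"
      using DERIV_chain2[where g = "\<lambda>z. w + z", OF wp'_deriv[OF that(2)] sh] by simp
  qed
  have dd: "deriv (deriv (\<lambda>z. wp_lat L (w + z))) z = 6 * (wp_lat L (w + z)) ^ 2 - lattice_g2 L / 2"
    if L: "weierstrass_lattice L" and w: "\<And>z. z \<in> S \<Longrightarrow> w + z \<notin> L" and z: "z \<in> S" for L w z
  proof -
    interpret weierstrass_lattice L by fact
    have "(deriv (\<lambda>z. wp_lat L (w + z)) has_field_derivative deriv wp' (w + z)) (at z)"
      by (rule has_field_derivative_transform_within_open[OF der(2)[OF L w[OF z]] S(1) z])
         (use der(1)[OF L w] DERIV_imp_deriv in \<open>metis\<close>)
    thus ?thesis using wp_second_order_ode[OF w[OF z]] DERIV_imp_deriv by metis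
  qed
  have eq: "(\<lambda>z. wp_lat L1 (u + z)) z = (\<lambda>z. wp_lat L2 (v + z)) z" if "z \<in> S" for z
  proof (rule second_order_ode_unique[OF S, of "\<lambda>z. wp_lat L1 (u + z)" "\<lambda>z. wp_lat L2 (v + z)"
          "lattice_g2 L1 / 2" 0 z])
    show "(\<lambda>z. wp_lat L1 (u + z)) holomorphic_on S"
      unfolding holomorphic_on_open[OF S(1)] using der(1)[OF assms(1)] S_iff by blast
    show "(\<lambda>z. wp_lat L2 (v + z)) holomorphic_on S"
      unfolding holomorphic_on_open[OF S(1)] using der(1)[OF assms(2)] S_iff by blast
    show "deriv (deriv (\<lambda>z. wp_lat L1 (u + z))) z = 6 * (wp_lat L1 (u + z)) ^ 2 - lattice_g2 L1 / 2"
      if "z \<in> S" for z by (rule dd[OF assms(1) _ that]) (simp add: S_iff)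
    show "deriv (deriv (\<lambda>z. wp_lat L2 (v + z))) z = 6 * (wp_lat L2 (v + z)) ^ 2 - lattice_g2 L1 / 2"
      if "z \<in> S" for z unfolding g2 by (rule dd[OF assms(2) _ that]) (simp add: S_iff)
    show "0 \<in> S" using uv by (simp add: S_iff)
    show "deriv (\<lambda>z. wp_lat L1 (u + z)) 0 = deriv (\<lambda>z. wp_lat L2 (v + z)) 0"
      using der(1)[OF assms(1), of u 0] der(1)[OF assms(2), of v 0] uv
      by (metis DERIV_imp_deriv A.wp'_def B.wp'_def add.right_neutral)
  qed (use uv that in auto)
  \<comment> \<open>Stated for arbitrary lattices so that it applies in both directions. If only the
    first translate had a pole at z, the second would be a finite limit for it there.\<close>
  have pole: "v' + z \<in> L2'"
    if L: "weierstrass_lattice L1'" "weierstrass_lattice L2'"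
      and eq: "\<And>z. u' + z \<notin> L1' \<Longrightarrow> v' + z \<notin> L2' \<Longrightarrow> wp_lat L1' (u' + z) = wp_lat L2' (v' + z)"
      and z: "u' + z \<in> L1'"
    for L1' L2' u' v'
  proof (rule ccontr)
    interpret P: weierstrass_lattice L1' by fact
    interpret Q: weierstrass_lattice L2' by fact
    assume nin: "v' + z \<notin> L2'"
    have "isCont (wp_lat L2') (v' + z)" using Q.wp_deriv[OF nin] DERIV_isCont by blast
    hence lim: "((\<lambda>h. wp_lat L2' (v' + z + h)) \<longlongrightarrow> wp_lat L2' (v' + z)) (at 0)"
      by (simp add: isCont_def LIM_offset_zero)
    have "\<forall>\<^sub>F h in at 0. h \<in> - (L1' - {0}) - {0}"
      by (rule eventually_at_in_open[OF open_Compl[OF P.closed_nonzero]]) simp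
    moreover have "open (- (\<lambda>w. - (v' + z) + w) ` L2')"
      using Q.closed_translate by blast
    hence "\<forall>\<^sub>F h in at 0. h \<in> - (\<lambda>w. - (v' + z) + w) ` L2'"
    proof (rule eventually_at_in_open')
      have "x = v' + z" if "0 = - (v' + z) + x" for x
        using that by (metis add_cancel_right_right add_minus_cancel)
      thus "0 \<in> - (\<lambda>w. - (v' + z) + w) ` L2'" using nin by blast
    qed
    ultimately have "\<forall>\<^sub>F h in at 0. wp_lat L2' (v' + z + h) = wp_lat L1' (u' + z + h)"
    proof eventually_elim
      case (elim h)
      have "h \<notin> L1'" using elim by auto
      hence "u' + (z + h) \<notin> L1'" using P.add_mem_iff[OF z, of h] by (simp add: algebra_simps)
      moreover have "v' + (z + h) \<notin> L2'"
      proof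
        assume "v' + (z + h) \<in> L2'"
        moreover have "h = - (v' + z) + (v' + (z + h))" by simp
        ultimately show False using elim(2) by blast
      qed
      ultimately show ?case using eq[of "z + h"] by (simp add: add.assoc)
    qed
    with lim have "((\<lambda>h. wp_lat L1' (u' + z + h)) \<longlongrightarrow> wp_lat L2' (v' + z)) (at 0)"
      by (simp add: filterlim_cong)
    hence "(wp_lat L1' \<longlongrightarrow> wp_lat L2' (v' + z)) (at (u' + z))"
      by (rule LIM_offset_zero_cancel)
    thus False using P.wp_no_limit_at_lattice[OF z] by blast
  qed
  show ?thesis
    using pole[OF assms(1,2), of u v] pole[OF assms(2,1), of v u] eq S_iff by metis
qed

text \<open>Take points u and v where the two functions share a large value. Equal invariants make
  the derivatives agree up to sign, and replacing v by - v corrects the sign. The translates then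
  have the same poles, so L1 - u = L2 - v', and the shift v' - u is itself a period of L2.\<close>

lemma weierstrass_lattice_unique:
  assumes "weierstrass_lattice L1" "weierstrass_lattice L2"
    and g2: "lattice_g2 L1 = lattice_g2 L2" and g3: "lattice_g3 L1 = lattice_g3 L2"
  shows "L1 = L2"
proof -
  interpret A: weierstrass_lattice L1 by fact
  interpret B: weierstrass_lattice L2 by fact
  obtain M1 where M1: "\<And>s. norm s > M1 \<Longrightarrow> \<exists>u. u \<notin> L1 \<and> wp_lat L1 u = s"
    using A.wp_attains_large_values by blast
  obtain M2 where M2: "\<And>s. norm s > M2 \<Longrightarrow> \<exists>u. u \<notin> L2 \<and> wp_lat L2 u = s"
    using B.wp_attains_large_values by blast
  define s :: complex where "s = of_real (max 0 (max M1 M2) + 1)"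
  have s: "norm s > M1" "norm s > M2" unfolding s_def norm_of_real by auto
  obtain u v where uv: "u \<notin> L1" "wp_lat L1 u = s" "v \<notin> L2" "wp_lat L2 v = s"
    using M1[OF s(1)] M2[OF s(2)] by blast
  have "A.wp' u ^ 2 = B.wp' v ^ 2"
    unfolding A.wp_ode[OF uv(1)] B.wp_ode[OF uv(3)] uv g2 g3 by simp
  hence "A.wp' u = B.wp' v \<or> A.wp' u = B.wp' (- v)"
    using B.wp'_odd[OF uv(3)] by (auto simp: power2_eq_iff)
  then obtain v' where v': "v' \<notin> L2" "wp_lat L2 v' = s" "A.wp' u = B.wp' v'"
    using uv B.wp_even B.uminus_mem_iff by metis
  have iff: "u + z \<in> L1 \<longleftrightarrow> v' + z \<in> L2" for z
    by (rule lattice_translates_eq[OF assms(1,2) g2 uv(1) v'(1)])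
       (use uv v' in \<open>auto simp: A.wp'_def B.wp'_def\<close>)
  have "v' - u \<in> L2" using iff[of "- u"] A.zero_mem by simp
  have "x \<in> L1 \<longleftrightarrow> x \<in> L2" for x
  proof -
    have "x \<in> L1 \<longleftrightarrow> x + (v' - u) \<in> L2" using iff[of "x - u"] by (simp add: algebra_simps)
    thus ?thesis using B.add_mem_iff[OF \<open>v' - u \<in> L2\<close>] by blast
  qed
  thus ?thesis by blast
qed

section \<open>Period lattices of rank two and one\<close>

lemma summable_int_powr: "(\<lambda>n::int. (1 + \<bar>real_of_int n\<bar>) powr (-3/2)) summable_on UNIV"
proof -
  let ?f = "\<lambda>n::int. (1 + \<bar>real_of_int n\<bar>) powr (-3/2)"
  have "summable (\<lambda>n. real n powr (-3/2))" by (subst summable_real_powr_iff) simp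
  hence s: "summable (\<lambda>n. real (Suc n) powr (-3/2))" by (subst summable_Suc_iff)
  have 1: "(\<lambda>n. ?f (int n)) summable_on UNIV"
    by (rule summable_nonneg_imp_summable_on) (use s in \<open>auto simp: add.commute\<close>)
  have 2: "(\<lambda>n. ?f (- int n)) summable_on UNIV"
    using 1 by simp
  have "?f summable_on (range int)"
    using 1 by (subst summable_on_reindex) (auto simp: o_def)
  moreover have "?f summable_on (range (\<lambda>n. - int n))"
    using 2 by (subst summable_on_reindex) (auto simp: o_def inj_on_def)
  moreover have "?f summable_on ((range (\<lambda>n. - int n)) - range int)"
    by (rule summable_on_subset_banach[OF calculation(2)]) auto
  ultimately have "?f summable_on (range int \<union> (range (\<lambda>n. - int n) - range int))"
    by (intro summable_on_Un_disjoint) auto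
  moreover have "x \<in> range int \<union> range (\<lambda>n. - int n)" for x :: int
    by (cases x rule: int_cases2) auto
  hence "range int \<union> (range (\<lambda>n. - int n) - range int) = UNIV" by blast
  ultimately show ?thesis by simp
qed

lemma summable_int_pairs:
  "(\<lambda>(m, n). ((1 + \<bar>real_of_int m\<bar>) * (1 + \<bar>real_of_int n\<bar>)) powr (-3/2)) summable_on (UNIV :: (int \<times> int) set)"
proof -
  let ?f = "\<lambda>n::int. (1 + \<bar>real_of_int n\<bar>) powr (-3/2)"
  define s where "s = infsum ?f UNIV"
  have "(?f has_sum s) UNIV" unfolding s_def by (rule has_sum_infsum[OF summable_int_powr])
  hence "((\<lambda>n. ?f m * ?f n) has_sum ?f m * s) UNIV" for m by (rule has_sum_cmult_right)
  moreover have "(\<lambda>m. ?f m * s) summable_on UNIV"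
    by (intro summable_on_cmult_left summable_int_powr)
  ultimately have "(\<lambda>(m, n). ?f m * ?f n) summable_on Sigma UNIV (\<lambda>_. UNIV)"
    by (intro summable_on_SigmaI) auto
  thus ?thesis by (simp add: powr_mult case_prod_unfold)
qed

lemma powr_neg_three_halves: "x powr (-3/2) = 1 / x powr (3/2)" for x :: real
  by (simp only: minus_divide_left[symmetric] powr_minus_divide)

text \<open>If N is the norm of the vector, then |m|, |n| and 1 are all at most C N, so (1 + |m|) (1
  + |n|) is at most (2 C N)^2. The power - 3/2 of this product therefore bounds 1 / N^3, and it
  factors into two convergent sums over the integers.\<close>

lemma lattice_vector_lower_bound:
  fixes a b :: complex
  assumes "a \<noteq> 0" "Im (b / a) \<noteq> 0"
  shows "\<exists>C>0. \<forall>m n. (m, n) \<noteq> (0, 0) \<longrightarrow>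
      1 / norm (of_int m * a + of_int n * b) ^ 3 \<le> C * ((1 + \<bar>real_of_int m\<bar>) * (1 + \<bar>real_of_int n\<bar>)) powr (-3/2)"
proof -
  define x y where "x = Re (b / a)" and "y = Im (b / a)"
  \<comment> \<open>Imaginary parts give |n| \<le> |w| / |y|, real parts |m| \<le> |w| + |n| |x|; C
    is the sum of both constants, rescaled from w to a w.\<close>
  define C where "C = (1 + (1 + \<bar>x\<bar>) / \<bar>y\<bar>) / norm a"
  have y: "\<bar>y\<bar> > 0" using assms by (simp add: y_def)
  have C: "C > 0" unfolding C_def using assms y by (intro divide_pos_pos add_pos_nonneg) auto
  have "1 / norm (of_int m * a + of_int n * b) ^ 3 \<le> (2 * C) ^ 3 * ((1 + \<bar>real_of_int m\<bar>) * (1 + \<bar>real_of_int n\<bar>)) powr (-3/2)"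
    if mn: "(m, n) \<noteq> (0, 0)" for m n
  proof -
    define w where "w = of_int m + of_int n * (b / a)"
    define N where "N = norm (of_int m * a + of_int n * b)"
    have N: "N = norm a * norm w" unfolding N_def w_def norm_mult[symmetric]
      using assms by (simp add: algebra_simps)
    have Im: "Im w = real_of_int n * y" and Re: "Re w = real_of_int m + real_of_int n * x"
      by (simp_all add: w_def x_def y_def del: times_divide_eq_right times_divide_eq_left)
    have "\<bar>real_of_int n\<bar> * \<bar>y\<bar> \<le> norm w"
      using abs_Im_le_cmod[of w] by (simp add: Im abs_mult)
    hence n: "\<bar>real_of_int n\<bar> \<le> norm w / \<bar>y\<bar>" using y by (simp add: field_simps)
    have "\<bar>real_of_int m\<bar> \<le> \<bar>Re w\<bar> + \<bar>real_of_int n\<bar> * \<bar>x\<bar>"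
      unfolding Re abs_mult[symmetric] by linarith
    also have "\<dots> \<le> norm w + norm w / \<bar>y\<bar> * \<bar>x\<bar>"
      by (intro add_mono abs_Re_le_cmod mult_right_mono n) auto
    finally have m: "\<bar>real_of_int m\<bar> \<le> norm w + norm w / \<bar>y\<bar> * \<bar>x\<bar>" .
    have CN: "C * N = norm w + norm w / \<bar>y\<bar> * \<bar>x\<bar> + norm w / \<bar>y\<bar>"
      unfolding C_def N using assms y by (simp add: field_simps)
    have nn: "0 \<le> norm w / \<bar>y\<bar>" "0 \<le> norm w / \<bar>y\<bar> * \<bar>x\<bar>" by auto
    have mC: "\<bar>real_of_int m\<bar> \<le> C * N" using m nn CN by linarith
    have nC: "\<bar>real_of_int n\<bar> \<le> C * N" using n nn CN norm_ge_zero[of w] by linarith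
    have "1 \<le> \<bar>m\<bar> \<or> 1 \<le> \<bar>n\<bar>" using mn by auto
    hence "1 \<le> \<bar>real_of_int m\<bar> \<or> 1 \<le> \<bar>real_of_int n\<bar>" by linarith
    hence one: "1 \<le> C * N" using mC nC by linarith
    hence N0: "N > 0" using C by (metis less_le_trans zero_less_mult_pos zero_less_one)
    define Q where "Q = (1 + \<bar>real_of_int m\<bar>) * (1 + \<bar>real_of_int n\<bar>)"
    have Q: "Q > 0" unfolding Q_def by (intro mult_pos_pos) auto
    have "Q \<le> (2 * C * N) * (2 * C * N)"
      unfolding Q_def by (intro mult_mono) (use mC nC one in auto)
    hence "Q powr (3/2) \<le> ((2 * C * N) * (2 * C * N)) powr (3/2)"
      using Q by (intro powr_mono2) auto
    also have "\<dots> = (2 * C * N) ^ 3"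
    proof -
      have "(X * X) powr (3/2) = X ^ 3" if "X > 0" for X :: real
      proof -
        have "(X * X) powr (3/2) = (X powr 2) powr (3/2)"
          using that by (simp add: powr_numeral power2_eq_square)
        also have "\<dots> = X powr 3" by (subst powr_powr) simp
        finally show ?thesis using that by (simp add: powr_numeral)
      qed
      from this[of "2 * C * N"] show ?thesis using C N0 by (simp only: mult_pos_pos zero_less_numeral)
    qed
    also have "\<dots> = (2 * C) ^ 3 * N ^ 3" by (simp add: power_mult_distrib)
    finally have "Q powr (3/2) \<le> (2 * C) ^ 3 * N ^ 3" .
    hence "1 / N ^ 3 \<le> (2 * C) ^ 3 / Q powr (3/2)"
      using N0 Q by (simp add: field_simps)
    also have "\<dots> = (2 * C) ^ 3 * Q powr (-3/2)"
      by (simp only: powr_neg_three_halves) simp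
    finally show ?thesis by (simp add: N_def Q_def)
  qed
  thus ?thesis using C by (intro exI[of _ "(2 * C) ^ 3"]) auto
qed

lemma lattice_map_inj:
  fixes a b :: complex
  assumes "a \<noteq> 0" "Im (b / a) \<noteq> 0"
  shows "inj (\<lambda>(m, n). of_int m * a + of_int n * b)"
proof (rule injI, clarify)
  fix m n m' n' :: int
  assume "of_int m * a + of_int n * b = of_int m' * a + of_int n' * b"
  hence "(of_int m * a + of_int n * b) / a = (of_int m' * a + of_int n' * b) / a" by simp
  hence eq: "of_int m + of_int n * (b / a) = of_int m' + of_int n' * (b / a)"
    using assms by (simp add: add_divide_distrib)
  from arg_cong[OF eq, of Im] have "n = n'"
    using assms by (simp del: times_divide_eq_right times_divide_eq_left)
  with eq show "m = m' \<and> n = n'" by simp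
qed

lemma lattice_gen_image: "lattice_gen a b = (\<lambda>(m, n). of_int m * a + of_int n * b) ` UNIV"
  by (auto simp: lattice_gen_def)

lemma lattice_gen_nonzero_image:
  fixes a b :: complex
  assumes "a \<noteq> 0" "Im (b / a) \<noteq> 0"
  shows "lattice_gen a b - {0} = (\<lambda>(m, n). of_int m * a + of_int n * b) ` (UNIV - {(0, 0)})"
proof -
  let ?h = "\<lambda>(m, n). of_int m * a + of_int n * b"
  have "?h ` (UNIV - {(0, 0)}) = ?h ` UNIV - ?h ` {(0, 0)}"
    by (rule image_set_diff[OF lattice_map_inj[OF assms]])
  thus ?thesis by (simp add: lattice_gen_image)
qed

lemma summable_cubes_lattice_gen:
  fixes a b :: complex
  assumes "a \<noteq> 0" "Im (b / a) \<noteq> 0"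
  shows "(\<lambda>w. 1 / norm w ^ 3) summable_on (lattice_gen a b - {0})"
proof -
  obtain C where C: "\<And>m n. (m, n) \<noteq> (0, 0) \<Longrightarrow>
      1 / norm (of_int m * a + of_int n * b) ^ 3 \<le> C * ((1 + \<bar>real_of_int m\<bar>) * (1 + \<bar>real_of_int n\<bar>)) powr (-3/2)"
    using lattice_vector_lower_bound[OF assms] by blast
  have "(\<lambda>p. C * (case p of (m, n) \<Rightarrow> ((1 + \<bar>real_of_int m\<bar>) * (1 + \<bar>real_of_int n\<bar>)) powr (-3/2)))
      summable_on (UNIV - {(0, 0)})"
    by (intro summable_on_cmult_right summable_on_subset_banach[OF summable_int_pairs]) auto
  hence "((\<lambda>w. 1 / norm w ^ 3) \<circ> (\<lambda>(m, n). of_int m * a + of_int n * b)) summable_on (UNIV - {(0, 0)})"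
  proof (rule summable_on_comparison_test)
    fix p :: "int \<times> int" assume p: "p \<in> UNIV - {(0, 0)}"
    obtain m n where mn: "p = (m, n)" by fastforce
    show "((\<lambda>w. 1 / norm w ^ 3) \<circ> (\<lambda>(m, n). of_int m * a + of_int n * b)) p
      \<le> C * (case p of (m, n) \<Rightarrow> ((1 + \<bar>real_of_int m\<bar>) * (1 + \<bar>real_of_int n\<bar>)) powr (-3/2))"
      using C[of m n] p unfolding mn by simp
  qed auto
  thus ?thesis
    unfolding lattice_gen_nonzero_image[OF assms]
    by (subst summable_on_reindex[OF inj_on_subset[OF lattice_map_inj[OF assms]]]) auto
qed

lemma lattice_gen_mem_iff: "w \<in> lattice_gen a b \<longleftrightarrow> (\<exists>m n. w = of_int m * a + of_int n * b)"
  by (auto simp: lattice_gen_def)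

lemma lattice_gen_group:
  shows "0 \<in> lattice_gen a b" "v \<in> lattice_gen a b \<Longrightarrow> w \<in> lattice_gen a b \<Longrightarrow> v + w \<in> lattice_gen a b"
    and "w \<in> lattice_gen a b \<Longrightarrow> - w \<in> lattice_gen a b"
proof -
  show "0 \<in> lattice_gen a b" unfolding lattice_gen_mem_iff by (intro exI[of _ 0]) simp
  show "v + w \<in> lattice_gen a b" if "v \<in> lattice_gen a b" "w \<in> lattice_gen a b"
  proof -
    from that obtain m n m' n' where "v = of_int m * a + of_int n * b" "w = of_int m' * a + of_int n' * b"
      unfolding lattice_gen_mem_iff by blast
    hence "v + w = of_int (m + m') * a + of_int (n + n') * b" by (simp add: algebra_simps)
    thus ?thesis unfolding lattice_gen_mem_iff by blast
  qed
  show "- w \<in> lattice_gen a b" if "w \<in> lattice_gen a b"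
  proof -
    from that obtain m n where "w = of_int m * a + of_int n * b"
      unfolding lattice_gen_mem_iff by blast
    hence "- w = of_int (- m) * a + of_int (- n) * b" by (simp add: algebra_simps)
    thus ?thesis unfolding lattice_gen_mem_iff by blast
  qed
qed

lemma summable_lattice_rank2:
  assumes "a \<noteq> 0" "Im (b / a) \<noteq> 0"
  shows "summable_lattice (lattice_gen a b)"
  by unfold_locales (use lattice_gen_group summable_cubes_lattice_gen[OF assms] in auto)

text \<open>Summability is inherited from the square lattice generated by a and i a.\<close>

lemma summable_lattice_rank1:
  assumes "a \<noteq> 0"
  shows "summable_lattice (lattice_gen a 0)"
proof unfold_locales
  have "lattice_gen a 0 \<subseteq> lattice_gen a (\<i> * a)"
  proof
    fix w assume "w \<in> lattice_gen a 0"
    then obtain m where "w = of_int m * a + of_int 0 * (\<i> * a)" by (auto simp: lattice_gen_mem_iff)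
    thus "w \<in> lattice_gen a (\<i> * a)" unfolding lattice_gen_mem_iff by blast
  qed
  moreover have "(\<lambda>w. 1 / norm w ^ 3) summable_on (lattice_gen a (\<i> * a) - {0})"
    by (rule summable_cubes_lattice_gen) (use assms in auto)
  ultimately show "(\<lambda>w. 1 / norm w ^ 3) summable_on (lattice_gen a 0 - {0})"
    by (elim summable_on_subset_banach) auto
qed (use lattice_gen_group in auto)

text \<open>Rounding down both coordinates with respect to a and b moves every point into the
  fundamental parallelogram, so the first alternative of \<open>bounded_modulo\<close> always
  holds.\<close>

lemma weierstrass_lattice_rank2:
  assumes "a \<noteq> 0" "Im (b / a) \<noteq> 0"
  shows "weierstrass_lattice (lattice_gen a b)"
proof -
  interpret summable_lattice "lattice_gen a b" by (rule summable_lattice_rank2[OF assms])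
  have "\<exists>w\<in>lattice_gen a b. norm (z - w) \<le> norm a + norm b" for z
  proof -
    define t where "t = Im (z / a) / Im (b / a)"
    define s where "s = Re (z / a) - t * Re (b / a)"
    have "z / a = of_real s + of_real t * (b / a)"
      using assms by (simp add: complex_eq_iff s_def t_def del: times_divide_eq_right)
    hence z: "z = of_real s * a + of_real t * b" using assms by (simp add: field_simps)
    have "z - (of_int \<lfloor>s\<rfloor> * a + of_int \<lfloor>t\<rfloor> * b) = of_real (frac s) * a + of_real (frac t) * b"
      by (simp add: z frac_def algebra_simps)
    also have "norm \<dots> \<le> \<bar>frac s\<bar> * norm a + \<bar>frac t\<bar> * norm b"
      using norm_triangle_ineq[of "of_real (frac s) * a" "of_real (frac t) * b"]
      unfolding norm_mult norm_of_real .
    also have "\<dots> \<le> 1 * norm a + 1 * norm b"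
      by (intro add_mono mult_right_mono) (auto intro: less_imp_le frac_lt_1)
    finally show ?thesis using lattice_gen_mem_iff by fastforce
  qed
  thus ?thesis by unfold_locales blast
qed

section \<open>Rank one lattices far from the line of periods\<close>

lemma rank1_round:
  fixes a z :: complex
  assumes "a \<noteq> 0"
  obtains w where "w \<in> lattice_gen a 0" "\<bar>Re ((z - w) / a)\<bar> \<le> 1" "Im ((z - w) / a) = Im (z / a)"
proof
  let ?w = "of_int \<lfloor>Re (z / a)\<rfloor> * a"
  show "?w \<in> lattice_gen a 0" by (auto simp: lattice_gen_mem_iff)
  have "(z - ?w) / a = z / a - of_int \<lfloor>Re (z / a)\<rfloor>" using assms by (simp add: field_simps)
  thus "\<bar>Re ((z - ?w) / a)\<bar> \<le> 1" "Im ((z - ?w) / a) = Im (z / a)" by (simp, linarith?)+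
qed

lemma rank1_distance:
  fixes a z w :: complex
  assumes a: "a \<noteq> 0" and w: "w \<in> lattice_gen a 0 - {0}"
    and z: "\<bar>Re (z / a)\<bar> \<le> 1" "\<bar>Im (z / a)\<bar> \<ge> 1"
  shows "norm w / 2 \<le> norm (z - w)" "norm a * \<bar>Im (z / a)\<bar> \<le> norm (z - w)" "norm w > 0"
proof -
  obtain m where m: "w = of_int m * a" "m \<noteq> 0" using w by (auto simp: lattice_gen_mem_iff)
  define x y M where "x = Re (z / a)" and "y = Im (z / a)" and "M = real_of_int m"
  have za: "z - w = a * (z / a - of_int m)" using a m by (simp add: field_simps)
  have n: "norm (z - w) = norm a * norm (z / a - of_int m)" unfolding za norm_mult ..
  have "\<bar>m\<bar> \<ge> 1" using m by auto
  hence M: "\<bar>M\<bar> \<ge> 1" unfolding M_def by linarith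
  have "\<bar>M\<bar> - 1 \<le> \<bar>x - M\<bar>" using z(1) unfolding x_def[symmetric] by linarith
  hence "(\<bar>M\<bar> - 1) ^ 2 \<le> (x - M) ^ 2" using M by (metis abs_le_square_iff abs_of_nonneg diff_ge_0_iff_ge)
  moreover have "1 ^ 2 \<le> \<bar>y\<bar> ^ 2" using z(2) unfolding y_def by (intro power_mono) auto
  \<comment> \<open>The difference of the two sides is (3 |M| - 4)^2 / 12 + 2/3.\<close>
  moreover have "(\<bar>M\<bar> / 2) ^ 2 \<le> (\<bar>M\<bar> - 1) ^ 2 + 1"
    using zero_le_power2[of "3 * \<bar>M\<bar> - 4"] by (simp add: power2_eq_square algebra_simps)
  ultimately have "(\<bar>M\<bar> / 2) ^ 2 \<le> (x - M) ^ 2 + y ^ 2" by simp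
  hence "\<bar>M\<bar> / 2 \<le> sqrt ((x - M) ^ 2 + y ^ 2)" by (rule real_le_rsqrt)
  also have "\<dots> = norm (z / a - of_int m)" by (simp add: cmod_def x_def y_def M_def)
  finally have "norm a * (\<bar>M\<bar> / 2) \<le> norm (z - w)" unfolding n by (rule mult_left_mono) simp
  thus "norm w / 2 \<le> norm (z - w)" by (simp add: m norm_mult M_def mult.commute)
  have "\<bar>y\<bar> \<le> norm (z / a - of_int m)" using abs_Im_le_cmod[of "z / a - of_int m"] by (simp add: y_def)
  thus "norm a * \<bar>Im (z / a)\<bar> \<le> norm (z - w)" unfolding n y_def by (rule mult_left_mono) simp
  show "norm w > 0" using w by auto
qed

lemma rank1_summable_squares:
  fixes a :: complex
  assumes "a \<noteq> 0"
  shows "(\<lambda>w. 1 / norm w ^ 2) summable_on (lattice_gen a 0 - {0})"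
proof -
  have eq: "lattice_gen a 0 - {0} = (\<lambda>m. of_int m * a) ` (UNIV - {0})"
    using assms by (auto simp: lattice_gen_mem_iff image_iff) blast
  have inj: "inj_on (\<lambda>m. of_int m * a) (UNIV - {0})" using assms by (auto simp: inj_on_def)
  have "(\<lambda>m. 4 / norm a ^ 2 * (1 + \<bar>real_of_int m\<bar>) powr (-3/2)) summable_on (UNIV - {0})"
    by (intro summable_on_cmult_right summable_on_subset_banach[OF summable_int_powr]) auto
  hence "((\<lambda>w. 1 / norm w ^ 2) \<circ> (\<lambda>m. of_int m * a)) summable_on (UNIV - {0})"
  proof (rule summable_on_comparison_test)
    fix m :: int assume "m \<in> UNIV - {0}"
    define M where "M = \<bar>real_of_int m\<bar>"
    have "\<bar>m\<bar> \<ge> 1" using \<open>m \<in> _\<close> by auto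
    hence M: "M \<ge> 1" unfolding M_def by linarith
    have "(1 + M) powr (3/2) \<le> (1 + M) powr 2" using M by (intro powr_mono) auto
    also have "\<dots> = (1 + M) ^ 2" using M by (simp add: powr_numeral)
    also have "\<dots> \<le> (2 * M) ^ 2" using M by (intro power_mono) auto
    finally have "(1 + M) powr (3/2) \<le> 4 * M ^ 2" by simp
    hence "1 / M ^ 2 \<le> 4 / (1 + M) powr (3/2)" using M by (simp add: field_simps)
    hence "1 / norm a ^ 2 * (1 / M ^ 2) \<le> 1 / norm a ^ 2 * (4 / (1 + M) powr (3/2))"
      by (rule mult_left_mono) simp
    also have "4 / (1 + M) powr (3/2) = 4 * (1 + M) powr (-3/2)"
      by (simp only: powr_neg_three_halves)
    finally show "((\<lambda>w. 1 / norm w ^ 2) \<circ> (\<lambda>m. of_int m * a)) m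
        \<le> 4 / norm a ^ 2 * (1 + \<bar>real_of_int m\<bar>) powr (-3/2)"
      by (simp add: norm_mult power_mult_distrib M_def mult.commute)
  qed auto
  thus ?thesis unfolding eq by (subst summable_on_reindex[OF inj])
qed

text \<open>After reduction to |Re (z / a)| \<le> 1, each z - w has norm at least norm w / 2 and at
  least norm a * |Im (z / a)|. In rank one already the inverse squares are summable, which bounds
  wp; in the sum for wp' the third factor is left over and yields the decay.\<close>

lemma rank1_strip_bounds:
  fixes a :: complex
  assumes a: "a \<noteq> 0"
  shows "\<exists>K. \<forall>z. \<bar>Im (z / a)\<bar> \<ge> 1 \<longrightarrow> z \<notin> lattice_gen a 0 \<and> norm (wp_lat (lattice_gen a 0) z) \<le> K
     \<and> norm (deriv (wp_lat (lattice_gen a 0)) z) \<le> K / \<bar>Im (z / a)\<bar>"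
proof -
  let ?L = "lattice_gen a 0"
  interpret summable_lattice ?L by (rule summable_lattice_rank1[OF a])
  define S where "S = infsum (\<lambda>w. 1 / norm w ^ 2) (?L - {0})"
  have S: "((\<lambda>w. 1 / norm w ^ 2) has_sum S) (?L - {0})"
    unfolding S_def by (rule has_sum_infsum[OF rank1_summable_squares[OF a]])
  have S0: "S \<ge> 0" unfolding S_def by (rule infsum_nonneg) auto
  define K where "K = max (1 / norm a ^ 2 + 5 * S) (2 / norm a ^ 3 + 8 / norm a * S)"
  have notin: "z \<notin> ?L" if "\<bar>Im (z / a)\<bar> \<ge> 1" for z
    using that a by (auto simp: lattice_gen_mem_iff)
  have main: "norm (wp_lat ?L z) \<le> 1 / norm a ^ 2 + 5 * S \<and> norm (wp' z) \<le> (2 / norm a ^ 3 + 8 / norm a * S) / \<bar>Im (z / a)\<bar>"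
    if z: "\<bar>Re (z / a)\<bar> \<le> 1" "\<bar>Im (z / a)\<bar> \<ge> 1" for z
  proof
    note d = rank1_distance[OF a _ z]
    define y where "y = \<bar>Im (z / a)\<bar>"
    have y: "y \<ge> 1" using z by (simp add: y_def)
    have "y \<le> norm (z / a)" unfolding y_def by (rule abs_Im_le_cmod)
    hence za: "norm a * y \<le> norm z" using a by (simp add: norm_divide field_simps)
    have ay: "norm a \<le> norm a * y" using y by (simp add: mult_le_cancel_left1)
    have an: "norm a > 0" using a by simp
    have az: "norm a \<le> norm z" "norm z > 0" using ay za an by linarith+
    have "norm (infsum (\<lambda>w. 1 / (z - w) ^ 2 - 1 / w ^ 2) (?L - {0})) \<le> 5 * S"
    proof (rule norm_infsum_le[OF has_sum_infsum[OF wp_summable] has_sum_cmult_right[OF S]])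
      fix w assume w: "w \<in> ?L - {0}"
      have "norm (1 / (z - w) ^ 2 - 1 / w ^ 2) \<le> norm (1 / (z - w) ^ 2) + norm (1 / w ^ 2)"
        by (rule norm_triangle_ineq4)
      also have "\<dots> = 1 / norm (z - w) ^ 2 + 1 / norm w ^ 2" by (simp add: norm_divide norm_power)
      also have "\<dots> \<le> 1 / (norm w / 2) ^ 2 + 1 / norm w ^ 2"
        using d[OF w] by (intro add_right_mono divide_left_mono power_mono mult_pos_pos zero_less_power) auto
      also have "\<dots> = 5 * (1 / norm w ^ 2)" by (simp add: power_divide)
      finally show "norm (1 / (z - w) ^ 2 - 1 / w ^ 2) \<le> 5 * (1 / norm w ^ 2)" .
    qed
    moreover have "norm (1 / z ^ 2) \<le> 1 / norm a ^ 2"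
      unfolding norm_divide norm_power norm_one
      by (intro divide_left_mono power_mono mult_pos_pos zero_less_power) (use az an in auto)
    ultimately show "norm (wp_lat ?L z) \<le> 1 / norm a ^ 2 + 5 * S"
      unfolding wp_lat_def by (intro norm_triangle_le add_mono)
    have "((\<lambda>w. -2 / (z - w) ^ 3) has_sum (wp' z - -2 / (z - 0) ^ 3)) (?L - {0})"
      using has_sum_Diff[OF wp'_has_sum[OF notin[OF z(2)]], of "{0}" "-2 / (z - 0) ^ 3"] zero_mem
      by (simp add: has_sum_finiteI)
    hence "norm (wp' z - -2 / (z - 0) ^ 3) \<le> 8 / (norm a * y) * S"
    proof (rule norm_infsum_le[OF _ has_sum_cmult_right[OF S]])
      fix w assume w: "w \<in> ?L - {0}"
      have "norm (-2 / (z - w) ^ 3) = 2 / (norm (z - w) * norm (z - w) ^ 2)"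
        by (simp add: norm_divide norm_mult power3_eq_cube power2_eq_square)
      also have "\<dots> \<le> 2 / ((norm a * y) * (norm w / 2) ^ 2)"
        using d[OF w] an y
        by (intro divide_left_mono mult_mono power_mono mult_pos_pos zero_less_power) (auto simp: y_def)
      also have "\<dots> = 8 / (norm a * y) * (1 / norm w ^ 2)" by (simp add: power_divide)
      finally show "norm (-2 / (z - w) ^ 3) \<le> 8 / (norm a * y) * (1 / norm w ^ 2)" .
    qed
    moreover have "norm (-2 / (z - 0) ^ 3) \<le> 2 / norm a ^ 3 / y"
    proof -
      have "norm (-2 / (z - 0) ^ 3) = 2 / norm z ^ 3" by (simp add: norm_divide norm_power)
      also have "\<dots> \<le> 2 / (norm a * y) ^ 3"
        by (intro divide_left_mono power_mono mult_pos_pos zero_less_power za) (use az an y in auto)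
      also have "\<dots> = 2 / norm a ^ 3 / y ^ 3" by (simp add: power_mult_distrib)
      also have "\<dots> \<le> 2 / norm a ^ 3 / y ^ 1"
        by (rule divide_left_mono[OF power_increasing]) (use y an in auto)
      finally show ?thesis by simp
    qed
    ultimately have "norm (wp' z) \<le> 8 / (norm a * y) * S + 2 / norm a ^ 3 / y"
      using norm_triangle_ineq[of "wp' z - -2 / (z - 0) ^ 3" "-2 / (z - 0) ^ 3"] by simp
    also have "\<dots> = (2 / norm a ^ 3 + 8 / norm a * S) / y" using y an by (simp add: field_simps)
    finally show "norm (wp' z) \<le> (2 / norm a ^ 3 + 8 / norm a * S) / \<bar>Im (z / a)\<bar>" by (simp add: y_def)
  qed
  have "z \<notin> ?L \<and> norm (wp_lat ?L z) \<le> K \<and> norm (deriv (wp_lat ?L) z) \<le> K / \<bar>Im (z / a)\<bar>"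
    if z: "\<bar>Im (z / a)\<bar> \<ge> 1" for z
  proof -
    obtain w where w: "w \<in> ?L" "\<bar>Re ((z - w) / a)\<bar> \<le> 1" "Im ((z - w) / a) = Im (z / a)"
      using rank1_round[OF a] by blast
    have zw: "z - w \<notin> ?L" by (rule notin) (use w z in simp)
    have eq: "wp_lat ?L z = wp_lat ?L (z - w)" "wp' z = wp' (z - w)"
      using wp_periodic[OF w(1) zw] wp'_periodic[OF w(1) zw] by simp_all
    have "norm (wp_lat ?L (z - w)) \<le> 1 / norm a ^ 2 + 5 * S"
      and bd: "norm (wp' (z - w)) \<le> (2 / norm a ^ 3 + 8 / norm a * S) / \<bar>Im (z / a)\<bar>"
      using main[of "z - w"] w z by auto
    hence "norm (wp_lat ?L z) \<le> K" unfolding eq K_def by simp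
    moreover have "(2 / norm a ^ 3 + 8 / norm a * S) / \<bar>Im (z / a)\<bar> \<le> K / \<bar>Im (z / a)\<bar>"
      by (intro divide_right_mono) (auto simp: K_def)
    with bd have "norm (wp' z) \<le> K / \<bar>Im (z / a)\<bar>" unfolding eq by (rule order_trans)
    ultimately show ?thesis using notin[OF z] unfolding wp'_def by blast
  qed
  thus ?thesis by blast
qed

text \<open>Cauchy's inequality for wp' on the disc of radius norm a: inside it Im (z / a) changes
  by at most 1, whence the threshold 2 and the denominator |Im (z / a)| - 1.\<close>

lemma rank1_second_deriv_bound:
  fixes a :: complex
  assumes a: "a \<noteq> 0"
  shows "\<exists>K. (\<forall>z. \<bar>Im (z / a)\<bar> \<ge> 2 \<longrightarrow> z \<notin> lattice_gen a 0 \<and> norm (wp_lat (lattice_gen a 0) z) \<le> K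
     \<and> norm (deriv (wp_lat (lattice_gen a 0)) z) \<le> K / \<bar>Im (z / a)\<bar>
     \<and> norm (deriv (deriv (wp_lat (lattice_gen a 0))) z) \<le> K / (\<bar>Im (z / a)\<bar> - 1)) \<and> K \<ge> 0"
proof -
  let ?L = "lattice_gen a 0"
  interpret summable_lattice ?L by (rule summable_lattice_rank1[OF a])
  obtain K where K: "\<And>z. \<bar>Im (z / a)\<bar> \<ge> 1 \<Longrightarrow> z \<notin> ?L \<and> norm (wp_lat ?L z) \<le> K
     \<and> norm (wp' z) \<le> K / \<bar>Im (z / a)\<bar>"
    using rank1_strip_bounds[OF a] unfolding wp'_def by blast
  have "Im (\<i> * a / a) = 1" using a by simp
  hence "norm (wp_lat ?L (\<i> * a)) \<le> K" using K[of "\<i> * a"] by simp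
  hence K0: "K \<ge> 0" using norm_ge_zero order_trans by blast
  have an: "norm a > 0" using a by simp
  have bd: "norm (deriv wp' z) \<le> (K / norm a) / (\<bar>Im (z / a)\<bar> - 1)" if z: "\<bar>Im (z / a)\<bar> \<ge> 2" for z
  proof -
    have close: "\<bar>Im (x / a)\<bar> \<ge> \<bar>Im (z / a)\<bar> - 1" if "x \<in> cball z (norm a)" for x
    proof -
      have "\<bar>Im (z / a - x / a)\<bar> \<le> norm ((z - x) / a)"
        using abs_Im_le_cmod[of "z / a - x / a"] by (simp add: diff_divide_distrib)
      also have "\<dots> \<le> 1" using that an by (simp add: norm_divide dist_norm)
      finally show ?thesis by simp
    qed
    have sub: "cball z (norm a) \<subseteq> - ?L"
    proof
      fix x assume "x \<in> cball z (norm a)"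
      thus "x \<in> - ?L" using close[of x] z K[of x] by auto
    qed
    have "norm ((deriv ^^ 1) wp' z) \<le> fact 1 * (K / (\<bar>Im (z / a)\<bar> - 1)) / norm a ^ 1"
    proof (rule Cauchy_inequality)
      show "wp' holomorphic_on ball z (norm a)"
        by (rule holomorphic_on_subset[OF wp'_holomorphic]) (use sub ball_subset_cball in blast)
      show "continuous_on (cball z (norm a)) wp'"
        by (rule holomorphic_on_imp_continuous_on, rule holomorphic_on_subset[OF wp'_holomorphic sub])
      fix x assume "norm (z - x) = norm a"
      hence x: "\<bar>Im (x / a)\<bar> \<ge> \<bar>Im (z / a)\<bar> - 1" by (intro close) (auto simp: dist_norm)
      hence "norm (wp' x) \<le> K / \<bar>Im (x / a)\<bar>" using z by (intro K[THEN conjunct2, THEN conjunct2]) auto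
      also have "\<dots> \<le> K / (\<bar>Im (z / a)\<bar> - 1)"
        by (intro divide_left_mono x K0 mult_pos_pos) (use x z in auto)
      finally show "norm (wp' x) \<le> K / (\<bar>Im (z / a)\<bar> - 1)" .
    qed (use an in auto)
    thus ?thesis by (simp add: field_simps)
  qed
  define K' where "K' = max K (K / norm a)"
  have "z \<notin> ?L \<and> norm (wp_lat ?L z) \<le> K' \<and> norm (wp' z) \<le> K' / \<bar>Im (z / a)\<bar>
     \<and> norm (deriv wp' z) \<le> K' / (\<bar>Im (z / a)\<bar> - 1)" if z: "\<bar>Im (z / a)\<bar> \<ge> 2" for z
  proof -
    have "K / \<bar>Im (z / a)\<bar> \<le> K' / \<bar>Im (z / a)\<bar>"
      by (intro divide_right_mono) (auto simp: K'_def)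
    moreover have "(K / norm a) / (\<bar>Im (z / a)\<bar> - 1) \<le> K' / (\<bar>Im (z / a)\<bar> - 1)"
      by (intro divide_right_mono) (use z in \<open>auto simp: K'_def\<close>)
    moreover have "K \<le> K'" by (simp add: K'_def)
    ultimately show ?thesis using K[of z] bd[OF z] z by (meson order_trans one_le_numeral)
  qed
  moreover have "K' \<ge> 0" using K0 by (simp add: K'_def)
  ultimately show ?thesis unfolding wp'_def by blast
qed

text \<open>Inside the strip |Im (z / a)| < 2 subtracting a period leaves a point of norm at most (1
  + 2) * norm a; outside it the bounds on wp and wp'' apply with w = 0.\<close>

lemma weierstrass_lattice_rank1:
  assumes a: "a \<noteq> 0"
  shows "weierstrass_lattice (lattice_gen a 0)"
proof -
  let ?L = "lattice_gen a 0"
  interpret summable_lattice ?L by (rule summable_lattice_rank1[OF a])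
  obtain K where K: "\<And>z. \<bar>Im (z / a)\<bar> \<ge> 2 \<Longrightarrow> z \<notin> ?L \<and> norm (wp_lat ?L z) \<le> K
     \<and> norm (deriv (deriv (wp_lat ?L)) z) \<le> K / (\<bar>Im (z / a)\<bar> - 1)" and K0: "K \<ge> 0"
    using rank1_second_deriv_bound[OF a] by blast
  show ?thesis
  proof (unfold_locales, intro exI allI)
    fix z
    show "\<exists>w\<in>?L. norm (z - w) \<le> max (3 * norm a) K \<or> (z - w \<notin> ?L \<and> norm (wp_lat ?L (z - w)) \<le> max (3 * norm a) K
       \<and> norm (deriv (deriv (wp_lat ?L)) (z - w)) \<le> max (3 * norm a) K)"
    proof (cases "\<bar>Im (z / a)\<bar> \<ge> 2")
      case True
      have "K / (\<bar>Im (z / a)\<bar> - 1) \<le> K / 1"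
        by (intro divide_left_mono K0) (use True in auto)
      hence "K / (\<bar>Im (z / a)\<bar> - 1) \<le> max (3 * norm a) K" by simp
      thus ?thesis using K[OF True] zero_mem by (intro bexI[of _ 0]) (auto intro: order_trans)
    next
      case False
      obtain w where w: "w \<in> ?L" "\<bar>Re ((z - w) / a)\<bar> \<le> 1" "Im ((z - w) / a) = Im (z / a)"
        using rank1_round[OF a] by blast
      have "norm ((z - w) / a) \<le> \<bar>Re ((z - w) / a)\<bar> + \<bar>Im ((z - w) / a)\<bar>" by (rule cmod_le)
      also have "\<dots> \<le> 3" using w False by simp
      finally have "norm (z - w) \<le> 3 * norm a" using a by (simp add: norm_divide field_simps)
      thus ?thesis using w(1) by (intro bexI[of _ w]) auto
    qed
  qed
qed

lemma period_lattice_weierstrass: "period_lattice L \<Longrightarrow> weierstrass_lattice L"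
  unfolding period_lattice_def using weierstrass_lattice_rank1 weierstrass_lattice_rank2 by blast

text \<open>Far away from the line of periods, \<open>\<wp>'\<close> and \<open>\<wp>''\<close> tend to zero, so that both differential
  equations degenerate into \<open>g2 = 12 e^2\<close> and \<open>g3 = - 8 e^3\<close>, with \<open>e\<close> a limit point of \<open>\<wp>\<close>.\<close>
lemma rank1_discriminant:
  fixes a :: complex
  assumes a: "a \<noteq> 0"
  shows "27 * lattice_g3 (lattice_gen a 0) ^ 2 = lattice_g2 (lattice_gen a 0) ^ 3"
proof -
  let ?L = "lattice_gen a 0"
  interpret weierstrass_lattice ?L by (rule weierstrass_lattice_rank1[OF a])
  obtain K where K: "\<And>z. \<bar>Im (z / a)\<bar> \<ge> 2 \<Longrightarrow> z \<notin> ?L \<and> norm (wp_lat ?L z) \<le> K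
     \<and> norm (wp' z) \<le> K / \<bar>Im (z / a)\<bar>
     \<and> norm (deriv wp' z) \<le> K / (\<bar>Im (z / a)\<bar> - 1)"
    using rank1_second_deriv_bound[OF a] unfolding wp'_def by blast
  define z where "z = (\<lambda>n. of_real (real n + 2) * \<i> * a)"
  have Im: "\<bar>Im (z n / a)\<bar> = real n + 2" for n using a by (simp add: z_def)
  have K': "z n \<notin> ?L" "norm (wp_lat ?L (z n)) \<le> K" "norm (wp' (z n)) \<le> K / (real n + 2)"
    "norm (deriv wp' (z n)) \<le> K / (real n + 1)" for n
    using K[of "z n"] unfolding Im by (auto simp: add.commute)
  have "wp_lat ?L (z n) \<in> cball 0 K" for n using K'(2)[of n] by simp
  \<comment> \<open>Boundedness gives convergence of wp only along a subsequence, which is enough: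
    the limit \<open>e\<close> becomes the double root of the cubic 4 (s - e)^2 (s + 2 e).\<close>
  then obtain e r where r: "strict_mono r" and e: "((\<lambda>n. wp_lat ?L (z n)) \<circ> r) \<longlonglongrightarrow> e"
    using compact_imp_seq_compact[OF compact_cball[of "0::complex" K]]
    unfolding seq_compact_def by metis
  have K1: "(\<lambda>n. K / (real n + 1)) \<longlonglongrightarrow> 0"
    using tendsto_mult_right_zero[OF LIMSEQ_inverse_real_of_nat, of K] by (simp add: divide_inverse add.commute)
  moreover have "(\<lambda>n. K / (real n + 2)) \<longlonglongrightarrow> 0"
    using LIMSEQ_Suc[OF K1] by (simp add: add.assoc add.commute)
  ultimately have "(\<lambda>n. wp' (z n)) \<longlonglongrightarrow> 0" "(\<lambda>n. deriv wp' (z n)) \<longlonglongrightarrow> 0"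
    using Lim_null_comparison[of "\<lambda>n. wp' (z n)" "\<lambda>n. K / (real n + 2)" sequentially] K'
      Lim_null_comparison[of "\<lambda>n. deriv wp' (z n)" "\<lambda>n. K / (real n + 1)" sequentially] by auto
  hence lim: "((\<lambda>n. wp' (z n)) \<circ> r) \<longlonglongrightarrow> 0" "((\<lambda>n. deriv wp' (z n)) \<circ> r) \<longlonglongrightarrow> 0"
    using r by (auto intro: LIMSEQ_subseq_LIMSEQ)
  have "(\<lambda>n. 12 * ((\<lambda>n. wp_lat ?L (z n)) \<circ> r) n ^ 2 - 2 * ((\<lambda>n. deriv wp' (z n)) \<circ> r) n) \<longlonglongrightarrow> 12 * e ^ 2 - 2 * 0"
    by (intro tendsto_intros e lim)
  moreover have "(\<lambda>n. 12 * ((\<lambda>n. wp_lat ?L (z n)) \<circ> r) n ^ 2 - 2 * ((\<lambda>n. deriv wp' (z n)) \<circ> r) n) = (\<lambda>n. lattice_g2 ?L)"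
    using wp_second_order_ode[OF K'(1)] by (auto simp: o_def fun_eq_iff)
  ultimately have g2: "lattice_g2 ?L = 12 * e ^ 2" by (simp add: LIMSEQ_const_iff)
  have "(\<lambda>n. 4 * ((\<lambda>n. wp_lat ?L (z n)) \<circ> r) n ^ 3 - lattice_g2 ?L * ((\<lambda>n. wp_lat ?L (z n)) \<circ> r) n
      - (((\<lambda>n. wp' (z n)) \<circ> r) n) ^ 2) \<longlonglongrightarrow> 4 * e ^ 3 - lattice_g2 ?L * e - 0 ^ 2"
    by (intro tendsto_intros e lim)
  moreover have "(\<lambda>n. 4 * ((\<lambda>n. wp_lat ?L (z n)) \<circ> r) n ^ 3 - lattice_g2 ?L * ((\<lambda>n. wp_lat ?L (z n)) \<circ> r) n
      - (((\<lambda>n. wp' (z n)) \<circ> r) n) ^ 2) = (\<lambda>n. lattice_g3 ?L)"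
    using wp_ode[OF K'(1)] by (auto simp: algebra_simps)
  ultimately have "lattice_g3 ?L = 4 * e ^ 3 - lattice_g2 ?L * e" by (simp add: LIMSEQ_const_iff)
  thus ?thesis unfolding g2 by algebra
qed

section \<open>Existence of rectangular lattices with given invariants\<close>

lemma lattice_scale_image:
  "(\<lambda>w. c * w) ` lattice_gen a b = lattice_gen (c * a) (c * b)"
  by (simp add: lattice_gen_image image_image case_prod_unfold distrib_left mult.left_commute)

lemma lattice_power_sum_scale:
  fixes c :: complex
  assumes "c \<noteq> 0"
  shows "infsum (\<lambda>w. 1 / w ^ k) ((\<lambda>w. c * w) ` L - {0}) = infsum (\<lambda>w. 1 / w ^ k) (L - {0}) / c ^ k"
proof -
  have "(\<lambda>w. c * w) ` L - {0} = (\<lambda>w. c * w) ` (L - {0})" using assms by auto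
  moreover have "inj_on (\<lambda>w. c * w) (L - {0})" using assms by (auto simp: inj_on_def)
  ultimately have "infsum (\<lambda>w. 1 / w ^ k) ((\<lambda>w. c * w) ` L - {0}) = infsum (\<lambda>w. 1 / c ^ k * (1 / w ^ k)) (L - {0})"
    by (simp add: infsum_reindex o_def power_mult_distrib)
  also have "\<dots> = 1 / c ^ k * infsum (\<lambda>w. 1 / w ^ k) (L - {0})"
    by (rule infsum_cmult_right')
  finally show ?thesis by simp
qed

lemma lattice_invariants_scale:
  assumes "c \<noteq> 0"
  shows "lattice_g2 (lattice_gen (c * a) (c * b)) = lattice_g2 (lattice_gen a b) / c ^ 4"
    and "lattice_g3 (lattice_gen (c * a) (c * b)) = lattice_g3 (lattice_gen a b) / c ^ 6"
  unfolding lattice_g2_def lattice_g3_def lattice_scale_image[symmetric]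
  by (simp_all add: lattice_power_sum_scale[OF assms])

text \<open>Multiplication by i sends the generators a and i b to i a and - b; this identity brings
  them back to rectangular form with the two sides exchanged.\<close>

lemma lattice_gen_rotate: "lattice_gen b (- a) = lattice_gen a b"
proof (intro set_eqI iffI)
  fix w assume "w \<in> lattice_gen b (- a)"
  then obtain m n where "w = of_int m * b + of_int n * - a" by (auto simp: lattice_gen_mem_iff)
  hence "w = of_int (- n) * a + of_int m * b" by simp
  thus "w \<in> lattice_gen a b" unfolding lattice_gen_mem_iff by blast
next
  fix w assume "w \<in> lattice_gen a b"
  then obtain m n where "w = of_int m * a + of_int n * b" by (auto simp: lattice_gen_mem_iff)
  hence "w = of_int n * b + of_int (- m) * - a" by simp
  thus "w \<in> lattice_gen b (- a)" unfolding lattice_gen_mem_iff by blast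
qed

text \<open>Rectangular period lattices; \<open>b = 0\<close> is the degenerate case, an infinite imaginary period.\<close>
definition rect_lattice :: "real \<Rightarrow> real \<Rightarrow> complex set" where
  "rect_lattice a b = lattice_gen (of_real a) (\<i> * of_real b)"

lemma rect_lattice_mem_iff:
  "w \<in> rect_lattice a b \<longleftrightarrow> (\<exists>m n. Re w = of_int m * a \<and> Im w = of_int n * b)"
  by (auto simp: rect_lattice_def lattice_gen_mem_iff complex_eq_iff)

lemma period_lattice_rect:
  assumes "a > 0"
  shows "period_lattice (rect_lattice a b)"
proof (cases "b = 0")
  case True
  thus ?thesis using assms unfolding period_lattice_def rect_lattice_def
    by (intro disjI2 exI[of _ "of_real a"]) simp
next
  case False
  have "Im (\<i> * of_real b / of_real a) = b / a"
    by (metis Im_complex_of_real Re_complex_of_real Im_i_times of_real_divide times_divide_eq_right)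
  thus ?thesis using assms False unfolding period_lattice_def rect_lattice_def
    by (intro disjI1 exI[of _ "of_real a"] exI[of _ "\<i> * of_real b"]) auto
qed

section \<open>Conjugation symmetry of rectangular lattices\<close>

lemma cnj_rect_lattice_iff: "cnj w \<in> rect_lattice a b \<longleftrightarrow> w \<in> rect_lattice a b"
proof -
  have "(\<exists>n::int. - x = of_int n * b) \<longleftrightarrow> (\<exists>n::int. x = of_int n * b)" for x
    by (metis minus_mult_left minus_minus of_int_minus)
  thus ?thesis by (simp add: rect_lattice_mem_iff)
qed

lemma infsum_rect_cnj:
  "cnj (infsum f (rect_lattice a b - {0})) = infsum (\<lambda>w. cnj (f (cnj w))) (rect_lattice a b - {0})"
proof -
  have "infsum f (rect_lattice a b - {0}) = infsum (\<lambda>w. f (cnj w)) (rect_lattice a b - {0})"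
    by (rule infsum_reindex_bij_witness[of _ cnj cnj]) (auto simp: cnj_rect_lattice_iff)
  thus ?thesis by (simp add: infsum_cnj)
qed

lemma rect_invariants_real: "lattice_g2 (rect_lattice a b) \<in> \<real>" "lattice_g3 (rect_lattice a b) \<in> \<real>"
  unfolding lattice_g2_def lattice_g3_def
  by (auto intro!: Reals_mult simp: Reals_cnj_iff infsum_rect_cnj)

lemma wp_rect_cnj: "wp_lat (rect_lattice a b) (cnj z) = cnj (wp_lat (rect_lattice a b) z)"
  by (simp add: wp_lat_def infsum_rect_cnj)

lemma wzeta_rect_cnj: "wzeta_lat (rect_lattice a b) (cnj z) = cnj (wzeta_lat (rect_lattice a b) z)"
  by (simp add: wzeta_lat_def infsum_rect_cnj)

context weierstrass_lattice
begin

text \<open>\<open>lattice_translates_eq\<close> for L against itself: the translates by u and v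
  have the same poles, and - v is a pole of the second.\<close>

lemma diff_mem_if_wp_eq:
  assumes "u \<notin> L" "v \<notin> L" "wp_lat L u = wp_lat L v" "wp' u = wp' v"
  shows "u - v \<in> L"
proof -
  have "u + z \<in> L \<longleftrightarrow> v + z \<in> L" for z
    by (rule lattice_translates_eq) (use assms weierstrass_lattice_axioms in \<open>auto simp: wp'_def\<close>)
  from this[of "- v"] show ?thesis using zero_mem by simp
qed

lemma wp'_half_period:
  assumes "l \<in> L" "l / 2 \<notin> L"
  shows "wp' (l / 2) = 0"
proof -
  have n: "- (l / 2) \<notin> L" using assms uminus_mem_iff by blast
  have "wp' (- (l / 2) + l) = wp' (- (l / 2))" by (rule wp'_periodic[OF assms(1) n])
  also have "\<dots> = - wp' (l / 2)" by (rule wp'_odd[OF assms(2)])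
  finally have "wp' (l / 2) = - wp' (l / 2)" by simp
  thus ?thesis by simp
qed

end

text \<open>The values of \<open>\<wp>\<close> at the half periods \<open>a/2\<close> and \<open>b i/2\<close> are distinct real roots of the cubic.\<close>
lemma rect_g2_pos:
  assumes "a > 0" "b > 0"
  shows "Re (lattice_g2 (rect_lattice a b)) > 0"
proof -
  let ?L = "rect_lattice a b"
  interpret weierstrass_lattice ?L
    by (rule period_lattice_weierstrass[OF period_lattice_rect[OF assms(1)]])
  define u v where "u = of_real a / (2::complex)" and "v = \<i> * of_real b / 2"
  have half: "\<not> (\<exists>m::int. x / 2 = of_int m * x)" if "x > 0" for x :: real
  proof
    assume "\<exists>m::int. x / 2 = of_int m * x"
    then obtain m :: int where "x / 2 = of_int m * x" by blast
    hence "real_of_int (2 * m) = 1" using that by (simp add: field_simps)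
    hence "2 * m = 1" by linarith
    thus False by presburger
  qed
  have uL: "u \<notin> ?L" "2 * u \<in> ?L" and vL: "v \<notin> ?L" "2 * v \<in> ?L" and uv: "u - v \<notin> ?L"
    using half[OF assms(1)] half[OF assms(2)]
    by (auto simp: rect_lattice_mem_iff u_def v_def intro: exI[of _ 0] exI[of _ 1])
  have wp0: "wp' u = 0" "wp' v = 0"
    using wp'_half_period[of "2 * u"] wp'_half_period[of "2 * v"] uL vL by simp_all
  define p q where "p = wp_lat ?L u" and "q = wp_lat ?L v"
  have "p \<noteq> q" using diff_mem_if_wp_eq[OF uL(1) vL(1)] wp0 uv by (auto simp: p_def q_def)
  have "cnj p = p" unfolding p_def wp_rect_cnj[symmetric] by (simp add: u_def)
  moreover have "cnj q = q" unfolding q_def wp_rect_cnj[symmetric]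
    using wp_even[of v] by (simp add: v_def)
  ultimately obtain x y where xy: "p = of_real x" "q = of_real y"
    by (metis Reals_cnj_iff Reals_cases)
  obtain g where g: "lattice_g2 ?L = of_real g" using rect_invariants_real Reals_cases by metis
  have "0 = 4 * p ^ 3 - lattice_g2 ?L * p - lattice_g3 ?L" "0 = 4 * q ^ 3 - lattice_g2 ?L * q - lattice_g3 ?L"
    using wp_ode[OF uL(1)] wp_ode[OF vL(1)] unfolding wp0 p_def q_def by simp_all
  hence "4 * p ^ 3 - lattice_g2 ?L * p = 4 * q ^ 3 - lattice_g2 ?L * q"
    by algebra
  hence "of_real (4 * x ^ 3 - g * x) = (of_real (4 * y ^ 3 - g * y) :: complex)" by (simp add: xy g)
  hence "4 * x ^ 3 - g * x = 4 * y ^ 3 - g * y" by (simp only: of_real_eq_iff)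
  \<comment> \<open>Dividing the difference of the cubic at its two roots by x - y expresses g2 as a
    positive definite quadratic form in the roots.\<close>
  hence "(x - y) * (4 * (x ^ 2 + x * y + y ^ 2) - g) = 0" by algebra
  hence "g = 4 * (x ^ 2 + x * y + y ^ 2)" using \<open>p \<noteq> q\<close> xy by simp
  also have "4 * (x ^ 2 + x * y + y ^ 2) = (2 * x + y) ^ 2 + 3 * y ^ 2" by algebra
  also have "\<dots> > 0"
    using \<open>p \<noteq> q\<close> xy by (cases "y = 0") (auto intro: add_nonneg_pos add_pos_nonneg)
  finally show ?thesis by (simp add: g)
qed

text \<open>All periods are real, so no term of g3 is negative and the one at a is positive; the
  sign of g2 is then read off 27 g3^2 = g2^3.\<close>

lemma rank1_invariants_pos:
  assumes "a > 0"
  shows "Re (lattice_g2 (rect_lattice a 0)) > 0" "Re (lattice_g3 (rect_lattice a 0)) > 0"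
proof -
  let ?L = "rect_lattice a 0"
  interpret weierstrass_lattice ?L
    by (rule period_lattice_weierstrass[OF period_lattice_rect[OF assms(1)]])
  have real: "w = of_real (Re w)" if "w \<in> ?L" for w
    using that by (auto simp: rect_lattice_mem_iff complex_eq_iff)
  have "((\<lambda>w. Re (1 / w ^ 6)) has_sum Re (infsum (\<lambda>w. 1 / w ^ 6) (?L - {0}))) (?L - {0})"
    by (rule has_sum_Re[OF has_sum_infsum[OF power_summable]]) simp
  moreover have nn: "Re (1 / w ^ 6) \<ge> 0" if "w \<in> ?L" for w
  proof -
    have "1 / w ^ 6 = of_real (1 / Re w ^ 6)" by (subst real[OF that]) simp
    thus ?thesis by simp
  qed
  moreover have a: "of_real a \<in> ?L - {0}"
    using assms by (auto simp: rect_lattice_mem_iff intro: exI[of _ 1])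
  ultimately have "(\<Sum>w\<in>{of_real a}. Re (1 / w ^ 6)) \<le> Re (infsum (\<lambda>w. 1 / w ^ 6) (?L - {0}))"
    by (intro finite_sum_le_has_sum) auto
  moreover have "Re (1 / (of_real a :: complex) ^ 6) = 1 / a ^ 6"
    by (metis Re_complex_of_real of_real_1 of_real_divide of_real_power)
  ultimately have "1 / a ^ 6 \<le> Re (infsum (\<lambda>w. 1 / w ^ 6) (?L - {0}))" by simp
  moreover have "0 < 1 / a ^ 6" using assms by simp
  ultimately have "0 < Re (infsum (\<lambda>w. 1 / w ^ 6) (?L - {0}))" by linarith
  thus g3: "Re (lattice_g3 ?L) > 0" by (simp add: lattice_g3_def)
  obtain x y where xy: "lattice_g2 ?L = of_real x" "lattice_g3 ?L = of_real y"
    using rect_invariants_real Reals_cases by metis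
  have "27 * lattice_g3 ?L ^ 2 = lattice_g2 ?L ^ 3"
    using rank1_discriminant[of "of_real a"] assms by (simp add: rect_lattice_def)
  hence "of_real (27 * y ^ 2) = (of_real (x ^ 3) :: complex)" by (simp add: xy)
  hence "27 * y ^ 2 = x ^ 3" by (simp only: of_real_eq_iff)
  moreover have "y ^ 2 > 0" using g3 xy by simp
  ultimately have "x ^ 3 > 0" by linarith
  thus "Re (lattice_g2 ?L) > 0" by (simp add: xy zero_less_power_eq)
qed

text \<open>The square lattice is invariant under multiplication by i, which divides g3 by i^6 =
  -1.\<close>

lemma square_lattice_g3: "lattice_g3 (rect_lattice 1 1) = 0"
proof -
  have "lattice_gen (\<i> * 1) (\<i> * \<i>) = lattice_gen 1 \<i>"
    using lattice_gen_rotate[of \<i> 1] by simp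
  hence "lattice_g3 (lattice_gen 1 \<i>) = lattice_g3 (lattice_gen 1 \<i>) / \<i> ^ 6"
    using lattice_invariants_scale(2)[of \<i> 1 \<i>] by simp
  also have "\<i> ^ 6 = (-1 :: complex)" by (simp add: eval_nat_numeral)
  finally have "lattice_g3 (lattice_gen 1 \<i>) = - lattice_g3 (lattice_gen 1 \<i>)" by simp
  thus ?thesis by (simp add: rect_lattice_def)
qed

text \<open>The lattices \<open>\<int> + \<int> i/u\<close>, written so that their power sums are continuous up to \<open>u = 0\<close>.\<close>
definition rect_term :: "nat \<Rightarrow> int \<times> int \<Rightarrow> real \<Rightarrow> complex" where
  "rect_term k = (\<lambda>(m, n) u. if n = 0 then 1 / of_int m ^ k
      else (of_real u / (of_int m * of_real u + of_int n * \<i>)) ^ k)"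

lemma rect_power_sum:
  assumes u: "u \<ge> 0" and k: "k > 0"
  shows "infsum (\<lambda>w. 1 / w ^ k) (rect_lattice 1 (inverse u) - {0})
    = infsum (\<lambda>p. rect_term k p u) (UNIV - {(0, 0)})"
proof (cases "u = 0")
  \<comment> \<open>Since \<open>inverse 0 = 0\<close>, the parameter u = 0 denotes the rank one
    lattice of the integers; the terms with n \<noteq> 0 vanish there.\<close>
  case True
  have "infsum (\<lambda>p. rect_term k p u) (UNIV - {(0, 0)}) = infsum (\<lambda>p. rect_term k p u) ((\<lambda>m. (m, 0)) ` (UNIV - {0}))"
    by (rule infsum_cong_neutral) (use True k in \<open>auto simp: rect_term_def image_iff split: if_splits\<close>)
  also have "\<dots> = infsum (\<lambda>m. 1 / of_int m ^ k) (UNIV - {0})"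
    by (subst infsum_reindex) (auto simp: inj_on_def o_def rect_term_def)
  also have "\<dots> = infsum (\<lambda>w. 1 / w ^ k) (of_int ` (UNIV - {0}))"
    by (subst infsum_reindex) (auto simp: inj_on_def o_def)
  also have "of_int ` (UNIV - {0}) = rect_lattice 1 (inverse u) - {0}"
    using True by (auto simp: rect_lattice_def lattice_gen_mem_iff image_iff) blast
  finally show ?thesis ..
next
  case False
  hence u: "u > 0" using assms by simp
  define b where "b = \<i> * of_real (inverse u)"
  have b: "Im (b / 1) \<noteq> 0" using u by (simp add: b_def)
  have L: "rect_lattice 1 (inverse u) - {0} = (\<lambda>(m, n). of_int m * 1 + of_int n * b) ` (UNIV - {(0, 0)})"
    unfolding rect_lattice_def b_def[symmetric] of_real_1 by (rule lattice_gen_nonzero_image[OF _ b]) simp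
  have "infsum (\<lambda>w. 1 / w ^ k) (rect_lattice 1 (inverse u) - {0})
     = infsum ((\<lambda>w. 1 / w ^ k) \<circ> (\<lambda>(m, n). of_int m * 1 + of_int n * b)) (UNIV - {(0, 0)})"
    unfolding L by (rule infsum_reindex[OF inj_on_subset[OF lattice_map_inj[OF _ b]]]) auto
  also have "\<dots> = infsum (\<lambda>p. rect_term k p u) (UNIV - {(0, 0)})"
  proof (rule infsum_cong)
    fix p :: "int \<times> int"
    obtain m n where p: "p = (m, n)" by fastforce
    have "of_int m + of_int n * b = (of_int m * of_real u + of_int n * \<i>) / of_real u"
      using u by (simp add: b_def field_simps)
    thus "((\<lambda>w. 1 / w ^ k) \<circ> (\<lambda>(m, n). of_int m * 1 + of_int n * b)) p = rect_term k p u"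
      using u by (cases "n = 0") (simp_all add: p rect_term_def power_divide b_def power_mult_distrib)
  qed
  finally show ?thesis .
qed

text \<open>For 0 \<le> u \<le> 1 the norm of m u + n i is at least u times that of m + n i, so the
  square lattice supplies a majorant independent of u, and the M-test gives continuity up to the
  degenerate end u = 0.\<close>

lemma rect_term_bound:
  assumes u: "0 \<le> u" "u \<le> 1" and k: "k \<ge> 3" and p: "(m, n) \<noteq> (0, 0)"
  shows "norm (rect_term k (m, n) u) \<le> 1 / norm (of_int m * 1 + of_int n * \<i> :: complex) ^ 3"
proof -
  define N where "N = norm (of_int m * 1 + of_int n * \<i> :: complex)"
  have N: "N = sqrt (real_of_int m ^ 2 + real_of_int n ^ 2)" by (simp add: N_def cmod_def)
  have "1 \<le> m ^ 2 + n ^ 2"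
    using p by (metis Pair_inject add.commute int_one_le_iff_zero_less sum_power2_gt_zero_iff)
  hence "1 \<le> real_of_int m ^ 2 + real_of_int n ^ 2"
    by (metis of_int_1 of_int_add of_int_le_iff of_int_power)
  hence N1: "N \<ge> 1" unfolding N by simp
  have "norm (rect_term k (m, n) u) \<le> (1 / N) ^ k"
  proof (cases "n = 0")
    case True
    thus ?thesis by (simp add: rect_term_def N norm_divide norm_power power_divide)
  next
    case False
    define d where "d = norm (of_int m * of_real u + of_int n * \<i> :: complex)"
    have d: "d = sqrt ((real_of_int m * u) ^ 2 + real_of_int n ^ 2)" by (simp add: d_def cmod_def)
    have d0: "d > 0" unfolding d using False by (simp add: add_nonneg_pos)
    have "u ^ 2 \<le> 1" using u by (simp add: power_le_one)
    hence "(real_of_int n * u) ^ 2 \<le> real_of_int n ^ 2"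
      by (simp add: power_mult_distrib mult_left_le)
    hence "(u * N) ^ 2 \<le> d ^ 2"
      unfolding N d power_mult_distrib using u by (simp add: algebra_simps)
    hence "u * N \<le> d" by (rule power2_le_imp_le) (use d0 in simp)
    hence "u / d \<le> 1 / N" using d0 N1 by (simp add: field_simps)
    hence "(u / d) ^ k \<le> (1 / N) ^ k" using u d0 by (intro power_mono) auto
    moreover have "norm (rect_term k (m, n) u) = (u / d) ^ k"
      using False u by (simp add: rect_term_def d_def norm_power norm_divide)
    ultimately show ?thesis by simp
  qed
  also have "\<dots> \<le> (1 / N) ^ 3" using N1 k by (intro power_decreasing) auto
  finally show ?thesis by (simp add: N_def power_divide)
qed

lemma rect_power_sum_continuous:
  assumes k: "k \<ge> 3"
  shows "continuous_on {0..1} (\<lambda>u. infsum (\<lambda>w. 1 / w ^ k) (rect_lattice 1 (inverse u) - {0}))"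
proof -
  define M where "M = (\<lambda>p. case p of (m, n) \<Rightarrow> 1 / norm (of_int m * 1 + of_int n * \<i> :: complex) ^ 3)"
  have i: "Im (\<i> / 1) \<noteq> 0" by simp
  have "(\<lambda>w. 1 / norm w ^ 3) summable_on (lattice_gen 1 \<i> - {0})"
    by (rule summable_cubes_lattice_gen[OF _ i]) simp
  hence "((\<lambda>w. 1 / norm w ^ 3) \<circ> (\<lambda>(m, n). of_int m * 1 + of_int n * \<i>)) summable_on (UNIV - {(0, 0)})"
    unfolding lattice_gen_nonzero_image[OF one_neq_zero i]
    by (subst (asm) summable_on_reindex[OF inj_on_subset[OF lattice_map_inj[OF one_neq_zero i]]]) auto
  hence M: "M summable_on (UNIV - {(0, 0)})" by (simp add: M_def o_def case_prod_unfold)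
  have "uniform_limit {0..1} (\<lambda>X u. \<Sum>p\<in>X. rect_term k p u)
      (\<lambda>u. \<Sum>\<^sub>\<infinity>p\<in>UNIV - {(0, 0)}. rect_term k p u) (finite_subsets_at_top (UNIV - {(0, 0)}))"
    by (rule Weierstrass_m_test_general[OF _ M]) (use rect_term_bound[OF _ _ k] in \<open>auto simp: M_def\<close>)
  moreover have "\<forall>\<^sub>F X in finite_subsets_at_top (UNIV - {(0, 0)}).
      continuous_on {0..1} (\<lambda>u. \<Sum>p\<in>X. rect_term k p u)"
  proof (rule eventually_finite_subsets_at_top_weakI, rule continuous_on_sum)
    fix p :: "int \<times> int"
    obtain m n where p: "p = (m, n)" by fastforce
    show "continuous_on {0..1} (rect_term k p)"
    proof (cases "n = 0")
      case False
      have "of_int m * of_real u + of_int n * \<i> \<noteq> 0" for u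
        using False by (simp add: complex_eq_iff)
      thus ?thesis using False by (auto simp: p rect_term_def intro!: continuous_intros)
    qed (simp add: p rect_term_def)
  qed
  ultimately have "continuous_on {0..1} (\<lambda>u. \<Sum>\<^sub>\<infinity>p\<in>UNIV - {(0, 0)}. rect_term k p u)"
    by (intro uniform_limit_theorem) auto
  thus ?thesis
    by (rule continuous_on_cong[THEN iffD1, rotated 2]) (use k in \<open>auto simp: rect_power_sum\<close>)
qed

text \<open>By the intermediate value theorem between the square lattice, where \<open>g3 = 0\<close>, and the
  degenerate lattice, where \<open>27 g3^2 = g2^3\<close>, every value of \<open>27 g3^2 / g2^3\<close> in \<open>[0, 1]\<close> occurs;
  scaling, and a quarter turn if \<open>g3\<close> has the wrong sign, then adjust the invariants.\<close>
lemma rect_lattice_exists: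
  fixes A B :: real
  assumes A: "A > 0" and le: "27 * B ^ 2 \<le> A ^ 3" and deg: "27 * B ^ 2 = A ^ 3 \<Longrightarrow> B > 0"
  shows "\<exists>a b. a > 0 \<and> b \<ge> 0 \<and> lattice_g2 (rect_lattice a b) = of_real A \<and> lattice_g3 (rect_lattice a b) = of_real B"
proof -
  \<comment> \<open>The quotient 27 g3^2 / g2^3 does not change under scaling; \<open>q\<close> is
    its prescribed value.\<close>
  define q where "q = 27 * B ^ 2 / A ^ 3"
  have q: "0 \<le> q" "q \<le> 1" using A le by (auto simp: q_def)
  define G2 where "G2 = (\<lambda>u. Re (lattice_g2 (rect_lattice 1 (inverse u))))"
  define G3 where "G3 = (\<lambda>u. Re (lattice_g3 (rect_lattice 1 (inverse u))))"
  have g: "lattice_g2 (rect_lattice 1 (inverse u)) = of_real (G2 u)"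
    "lattice_g3 (rect_lattice 1 (inverse u)) = of_real (G3 u)" for u
    unfolding G2_def G3_def using rect_invariants_real by (metis of_real_Re)+
  have "continuous_on {0..1} G2" "continuous_on {0..1} G3"
    unfolding G2_def G3_def lattice_g2_def lattice_g3_def
    by (intro continuous_intros rect_power_sum_continuous; simp)+
  hence cont: "continuous_on {0..1} (\<lambda>u. q * G2 u ^ 3 - 27 * G3 u ^ 2)"
    by (intro continuous_intros)
  have G2_pos: "G2 u > 0" if "u \<ge> 0" for u
    using rect_g2_pos[of 1 "inverse u"] rank1_invariants_pos(1)[of 1] that
    by (cases "u = 0") (auto simp: G2_def)
  have G3_0: "G3 0 > 0" using rank1_invariants_pos(2)[of 1] by (simp add: G3_def)
  have disc0: "27 * G3 0 ^ 2 = G2 0 ^ 3"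
  proof -
    have "27 * lattice_g3 (rect_lattice 1 0) ^ 2 = lattice_g2 (rect_lattice 1 0) ^ 3"
      using rank1_discriminant[of 1] by (simp add: rect_lattice_def)
    hence "of_real (27 * G3 0 ^ 2) = (of_real (G2 0 ^ 3) :: complex)"
      using g[of 0] by simp
    thus ?thesis by (simp only: of_real_eq_iff)
  qed
  have "\<exists>u. 0 \<le> u \<and> u \<le> 1 \<and> q * G2 u ^ 3 - 27 * G3 u ^ 2 = 0"
  proof (rule IVT'[OF _ _ _ cont])
    show "q * G2 0 ^ 3 - 27 * G3 0 ^ 2 \<le> 0"
      using G2_pos[of 0] q by (simp add: disc0 mult_le_cancel_right1)
    show "0 \<le> q * G2 1 ^ 3 - 27 * G3 1 ^ 2"
      using G2_pos[of 1] q square_lattice_g3 by (simp add: G3_def)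
  qed simp
  then obtain u where u: "0 \<le> u" "q * G2 u ^ 3 = 27 * G3 u ^ 2" by auto
  \<comment> \<open>Scaling by s divides g2 by s^4, so a fourth root adjusts g2; then g3 is right up
    to its sign.\<close>
  define s where "s = sqrt (sqrt (G2 u / A))"
  have pos: "G2 u > 0" by (rule G2_pos[OF u(1)])
  have s: "s > 0" unfolding s_def using pos A by simp
  have s4: "s ^ 4 = G2 u / A"
  proof -
    have "s ^ 4 = (s ^ 2) ^ 2" by simp
    also have "\<dots> = G2 u / A" unfolding s_def using pos A by simp
    finally show ?thesis .
  qed
  have g2s: "G2 u / s ^ 4 = A" using pos A by (simp add: s4)
  have "(G3 u / s ^ 6) ^ 2 = G3 u ^ 2 / (s ^ 4) ^ 3" by (simp add: power_divide flip: power_mult)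
  also have "\<dots> = B ^ 2"
    using u(2) pos A unfolding s4 q_def by (simp add: field_simps)
  finally have "G3 u / s ^ 6 = B \<or> G3 u / s ^ 6 = - B" by (simp add: power2_eq_iff)
  thus ?thesis
  proof
    assume B: "G3 u / s ^ 6 = B"
    have sc: "rect_lattice s (s * inverse u) = lattice_gen (of_real s * 1) (of_real s * (\<i> * of_real (inverse u)))"
      by (simp add: rect_lattice_def mult_ac)
    have s0: "of_real s \<noteq> (0::complex)" using s by simp
    have "lattice_g2 (rect_lattice s (s * inverse u)) = of_real (G2 u) / of_real s ^ 4"
      "lattice_g3 (rect_lattice s (s * inverse u)) = of_real (G3 u) / of_real s ^ 6"
      unfolding sc lattice_invariants_scale[OF s0] g[symmetric] by (simp_all add: rect_lattice_def)
    hence "lattice_g2 (rect_lattice s (s * inverse u)) = of_real A"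
      "lattice_g3 (rect_lattice s (s * inverse u)) = of_real B"
      unfolding g2s[symmetric] B[symmetric] by simp_all
    thus ?thesis using s u(1) by (intro exI[of _ s] exI[of _ "s * inverse u"]) auto
  next
    assume B: "G3 u / s ^ 6 = - B"
    show ?thesis
    proof (cases "u = 0")
      \<comment> \<open>A turned rank one lattice would have only imaginary periods. Here q = 1, so
        \<open>deg\<close> forces B > 0, against the positive g3 of the lattice of integers.\<close>
      case True
      have "q = 1" using u(2) disc0 True pos by simp
      hence "27 * B ^ 2 = A ^ 3" using A by (simp add: q_def)
      hence "B > 0" by (rule deg)
      moreover have "G3 u / s ^ 6 > 0" using G3_0 True s by simp
      ultimately show ?thesis using B by simp
    next
      case False
      define t where "t = inverse u"
      have t: "t > 0" using False u by (simp add: t_def)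
      \<comment> \<open>As i^4 = 1 and i^6 = -1, the quarter turn keeps g2 and reverses the sign of
        g3.\<close>
      define c where "c = \<i> * of_real s"
      have i: "\<i> ^ 4 = (1 :: complex)" "\<i> ^ 6 = (- 1 :: complex)"
        by (simp_all add: eval_nat_numeral)
      have c: "c \<noteq> 0" "c ^ 4 = of_real (s ^ 4)" "c ^ 6 = - of_real (s ^ 6)"
        using s i by (simp_all add: c_def power_mult_distrib)
      have sc: "rect_lattice (s * t) s = lattice_gen (c * 1) (c * (\<i> * of_real t))"
        using lattice_gen_rotate[of "\<i> * of_real s" "of_real (s * t)"]
        by (simp add: rect_lattice_def c_def mult_ac)
      have "lattice_g2 (rect_lattice (s * t) s) = of_real (G2 u) / c ^ 4"
        "lattice_g3 (rect_lattice (s * t) s) = of_real (G3 u) / c ^ 6"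
        unfolding sc lattice_invariants_scale[OF c(1)] g[symmetric] by (simp_all add: rect_lattice_def t_def)
      hence "lattice_g2 (rect_lattice (s * t) s) = of_real (G2 u / s ^ 4)"
        "lattice_g3 (rect_lattice (s * t) s) = of_real (- (G3 u / s ^ 6))"
        unfolding c by simp_all
      thus ?thesis using s t unfolding g2s B
        by (intro exI[of _ "s * t"] exI[of _ s]) auto
    qed
  qed
qed

section \<open>The real half period and the spectral condition\<close>

locale rect_weierstrass_lattice =
  fixes a b :: real
  assumes a_pos: "a > 0"

sublocale rect_weierstrass_lattice \<subseteq> weierstrass_lattice "rect_lattice a b"
  by (rule period_lattice_weierstrass[OF period_lattice_rect[OF a_pos]])

context rect_weierstrass_lattice
begin

abbreviation \<Lambda> where "\<Lambda> \<equiv> rect_lattice a b"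

section \<open>Behaviour of wp on the real axis\<close>

lemma wp'_rect_cnj:
  assumes "z \<notin> \<Lambda>"
  shows "wp' (cnj z) = cnj (wp' z)"
proof -
  have "cnj z \<notin> \<Lambda>" using assms by (simp add: cnj_rect_lattice_iff)
  from wp'_has_sum[OF this] have "((\<lambda>w. -2 / (cnj z - w) ^ 3) has_sum wp' (cnj z)) \<Lambda>" .
  also have "?this \<longleftrightarrow> ((\<lambda>w. cnj (-2 / (z - w) ^ 3)) has_sum wp' (cnj z)) \<Lambda>"
    by (rule has_sum_reindex_bij_witness[of _ cnj cnj]) (auto simp: cnj_rect_lattice_iff)
  finally have "((\<lambda>w. cnj (-2 / (z - w) ^ 3)) has_sum wp' (cnj z)) \<Lambda>" .
  moreover have "((\<lambda>w. cnj (-2 / (z - w) ^ 3)) has_sum cnj (wp' z)) \<Lambda>"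
    using wp'_has_sum[OF assms] by (subst has_sum_cnj_iff)
  ultimately show ?thesis by (rule has_sum_unique)
qed

lemma real_mem_iff: "complex_of_real x \<in> \<Lambda> \<longleftrightarrow> (\<exists>m. x = of_int m * a)"
  by (auto simp: rect_lattice_mem_iff intro: exI[of _ 0])

lemma real_not_mem:
  assumes "0 < x" "x < a"
  shows "complex_of_real x \<notin> \<Lambda>"
proof
  assume "complex_of_real x \<in> \<Lambda>"
  then obtain m where m: "x = of_int m * a" by (auto simp: real_mem_iff)
  have "0 < of_int m * a" "of_int m * a < 1 * a" using assms m by auto
  hence "0 < real_of_int m" "real_of_int m < 1" using a_pos by (auto simp: zero_less_mult_iff)
  hence "0 < m" "m < 1" by simp_all
  thus False by simp
qed

lemma half_period_not_mem: "of_real a / 2 \<notin> \<Lambda>"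
  using real_not_mem[of "a / 2"] a_pos by simp

definition p :: "real \<Rightarrow> real" where "p x = Re (wp_lat \<Lambda> (of_real x))"
definition p' :: "real \<Rightarrow> real" where "p' x = Re (wp' (of_real x))"

lemma wp_of_real: "wp_lat \<Lambda> (of_real x) = of_real (p x)"
  unfolding p_def using wp_rect_cnj[of a b "of_real x"] by (simp add: complex_eq_iff)

lemma wp'_of_real: "0 < x \<Longrightarrow> x < a \<Longrightarrow> wp' (of_real x) = of_real (p' x)"
  unfolding p'_def using wp'_rect_cnj[OF real_not_mem[of x]] by (simp add: complex_eq_iff)

lemma p_deriv:
  assumes "0 < x" "x < a"
  shows "(p has_real_derivative p' x) (at x)"
proof -
  have "((\<lambda>x. wp_lat \<Lambda> (of_real x)) has_vector_derivative wp' (of_real x)) (at x)"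
    by (rule has_vector_derivative_real_field[OF wp_deriv[OF real_not_mem[OF assms]]])
  hence "((\<lambda>x. Re (wp_lat \<Lambda> (of_real x))) has_vector_derivative Re (wp' (of_real x))) (at x)"
    by (rule bounded_linear.has_vector_derivative[OF bounded_linear_Re])
  thus ?thesis by (simp add: p_def[abs_def] p'_def has_real_derivative_iff_has_vector_derivative)
qed

lemma p_large_near_0:
  assumes "x0 > 0"
  shows "\<exists>y. 0 < y \<and> y < x0 \<and> p y > M"
proof -
  have "filterlim complex_of_real (at 0) (at_right 0)"
    unfolding filterlim_at
    by (auto simp: eventually_at_filter intro!: tendsto_eq_intros)
  from filterlim_compose[OF square_times_wp_tendsto this]
  have "((\<lambda>x. Re (of_real x ^ 2 * wp_lat \<Lambda> (of_real x))) \<longlongrightarrow> Re 1) (at_right 0)"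
    by (intro tendsto_Re)
  hence "((\<lambda>x. x ^ 2 * p x) \<longlongrightarrow> 1) (at_right 0)"
    by (simp add: wp_of_real flip: of_real_power of_real_mult)
  hence "\<forall>\<^sub>F x in at_right 0. x ^ 2 * p x > 1 / 2" by (rule order_tendstoD) simp
  \<comment> \<open>For 0 < y < d one has y^2 \<le> y < 1 / (2 (|M| + 1)), so y^2 p(y) > 1/2 exceeds
    y^2 (|M| + 1).\<close>
  moreover define d where "d = min x0 (min 1 (1 / (2 * (\<bar>M\<bar> + 1))))"
  have "d > 0" using assms by (simp add: d_def)
  hence "\<forall>\<^sub>F x in at_right 0. x \<in> {0<..<d}" by (rule eventually_at_right_real)
  ultimately have "\<forall>\<^sub>F x in at_right 0. 0 < x \<and> x < d \<and> x ^ 2 * p x > 1 / 2"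
    by eventually_elim auto
  then obtain y where y: "0 < y" "y < d" "y ^ 2 * p y > 1 / 2"
    using eventually_happens'[OF trivial_limit_at_right_real] by blast
  have y1: "y < 1" "y < x0" "y < 1 / (2 * (\<bar>M\<bar> + 1))" using y(2) unfolding d_def by linarith+
  have "y * (2 * (\<bar>M\<bar> + 1)) < 1" using y1(3) by (simp add: field_simps)
  moreover have "y ^ 2 \<le> y" using y(1) y1(1) by (simp add: power2_eq_square mult_left_le)
  hence "y ^ 2 * (2 * (\<bar>M\<bar> + 1)) \<le> y * (2 * (\<bar>M\<bar> + 1))" by (rule mult_right_mono) simp
  ultimately have "2 * (y ^ 2 * (\<bar>M\<bar> + 1)) < 1" by (simp only: mult.left_commute)
  hence "y ^ 2 * (\<bar>M\<bar> + 1) < y ^ 2 * p y" using y(3) by linarith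
  hence "\<bar>M\<bar> + 1 < p y" by (simp add: mult_less_cancel_left)
  thus ?thesis using y(1) y1(2) by (intro exI[of _ y]) auto
qed

lemma real_diff_multiple:
  assumes "complex_of_real x \<in> \<Lambda>" "\<bar>x\<bar> < a"
  shows "x = 0"
proof -
  obtain m where m: "x = of_int m * a" using assms by (auto simp: real_mem_iff)
  hence "\<bar>real_of_int m\<bar> * a < 1 * a" using assms a_pos by (simp add: abs_mult)
  hence "\<bar>real_of_int m\<bar> < 1" using a_pos by simp
  hence "\<bar>m\<bar> < 1" by (simp flip: of_int_abs)
  hence "m = 0" by simp
  thus ?thesis using m by simp
qed

text \<open>Equal values make wp' equal up to sign, so x - y or x + y is a period, and both are
  shorter than a. Admitting a / 2 for x but not for y keeps x + y < a and still allows comparison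
  with the half period.\<close>

lemma p_inj:
  assumes "0 < x" "x \<le> a / 2" "0 < y" "y < a / 2" "p x = p y"
  shows "x = y"
proof -
  have n: "complex_of_real x \<notin> \<Lambda>" "complex_of_real y \<notin> \<Lambda>" using real_not_mem assms by auto
  have "wp' (of_real x) ^ 2 = wp' (of_real y) ^ 2"
    unfolding wp_ode[OF n(1)] wp_ode[OF n(2)] wp_of_real assms(5) ..
  then consider "wp' (of_real x) = wp' (of_real y)" | "wp' (of_real x) = wp' (- of_real y)"
    using wp'_odd[OF n(2)] by (auto simp: power2_eq_iff)
  thus ?thesis
  proof cases
    case 1
    hence "complex_of_real x - of_real y \<in> \<Lambda>"
      by (intro diff_mem_if_wp_eq n) (use assms in \<open>auto simp: wp_of_real\<close>)
    hence "complex_of_real (x - y) \<in> \<Lambda>" by simp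
    hence "x - y = 0" by (rule real_diff_multiple) (use assms in auto)
    thus ?thesis by simp
  next
    case 2
    hence "complex_of_real x - (- of_real y) \<in> \<Lambda>"
      by (intro diff_mem_if_wp_eq n) (use assms n in \<open>auto simp: wp_of_real wp_even uminus_mem_iff\<close>)
    hence "complex_of_real (x + y) \<in> \<Lambda>" by simp
    hence "x + y = 0" by (rule real_diff_multiple) (use assms in auto)
    thus ?thesis using assms by simp
  qed
qed

lemma p'_nonzero:
  assumes "0 < x" "x < a / 2"
  shows "p' x \<noteq> 0"
proof
  assume "p' x = 0"
  have n: "complex_of_real x \<notin> \<Lambda>" using real_not_mem assms by auto
  have "wp' (of_real x) = 0" using wp'_of_real[of x] \<open>p' x = 0\<close> assms by simp
  hence "complex_of_real x - (- of_real x) \<in> \<Lambda>"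
    by (intro diff_mem_if_wp_eq) (use n wp'_odd[OF n] in \<open>auto simp: wp_even uminus_mem_iff\<close>)
  hence "complex_of_real (2 * x) \<in> \<Lambda>" by simp
  hence "2 * x = 0" by (rule real_diff_multiple) (use assms in auto)
  thus False using assms by simp
qed

lemma p_continuous: "0 < x \<Longrightarrow> y < a \<Longrightarrow> continuous_on {x..y} p"
  by (rule DERIV_continuous_on[of _ _ p'], rule has_field_derivative_at_within, rule p_deriv) auto

text \<open>Injectivity and the intermediate value theorem do the work of monotonicity: p is large
  near 0, so a value below p(a / 2) would force p(a / 2) to be taken once more before a / 2.\<close>

lemma p_image: "p ` {0<..<a / 2} = {p (a / 2)<..}"
proof (intro set_eqI iffI)
  fix s assume "s \<in> p ` {0<..<a / 2}"
  then obtain x where x: "0 < x" "x < a / 2" "s = p x" by auto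
  have "s \<noteq> p (a / 2)" using p_inj[of "a / 2" x] x by auto
  moreover have "\<not> s < p (a / 2)"
  proof
    assume less: "s < p (a / 2)"
    obtain y where y: "0 < y" "y < x" "p y > p (a / 2)" using p_large_near_0[OF x(1)] by blast
    obtain t where t: "y \<le> t" "t \<le> x" "p t = p (a / 2)"
      using IVT2'[of p x "p (a / 2)" y] y x less p_continuous[of y x] by auto
    have "a / 2 = t" by (rule p_inj) (use x y t in auto)
    thus False using t x by simp
  qed
  ultimately show "s \<in> {p (a / 2)<..}" by simp
next
  fix s assume s: "s \<in> {p (a / 2)<..}"
  obtain y where y: "0 < y" "y < a / 2" "p y > s" using p_large_near_0[of "a / 2" s] a_pos by auto
  obtain t where t: "y \<le> t" "t \<le> a / 2" "p t = s"
    using IVT2'[of p "a / 2" s y] y s p_continuous[of y "a / 2"] by auto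
  have "t \<noteq> a / 2" using t s by auto
  thus "s \<in> p ` {0<..<a / 2}" using t y by (intro image_eqI[of _ _ t]) auto
qed

context
  fixes A B :: real
  assumes inv: "lattice_g2 \<Lambda> = of_real A" "lattice_g3 \<Lambda> = of_real B"
begin

lemma p_ode:
  assumes "0 < x" "x < a"
  shows "p' x ^ 2 = 4 * p x ^ 3 - A * p x - B"
proof -
  have "complex_of_real (p' x ^ 2) = of_real (4 * p x ^ 3 - A * p x - B)"
    using wp_ode[OF real_not_mem[OF assms]] wp'_of_real[OF assms] by (simp add: wp_of_real inv)
  thus ?thesis by (simp only: of_real_eq_iff)
qed

text \<open>The half period gives a root because wp' vanishes there. A larger root would be p x with
  0 < x < a / 2 by \<open>p_image\<close>, but p' has no zero on that interval.\<close>

lemma largest_root: "Max {s. 4 * s ^ 3 - A * s - B = 0} = p (a / 2)"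
proof (rule Max_eqI)
  have "{s. 4 * s ^ 3 - A * s - B = 0} = {s. poly [:- B, - A, 0, 4:] s = 0}"
    by (auto simp: algebra_simps power3_eq_cube)
  moreover have "finite {s. poly [:- B, - A, 0, 4:] s = 0}" by (rule poly_roots_finite) simp
  ultimately show "finite {s. 4 * s ^ 3 - A * s - B = 0}" by simp
  have "wp' (of_real a / 2) = 0"
    by (rule wp'_half_period) (use half_period_not_mem real_mem_iff[of a] in \<open>auto intro: exI[of _ 1]\<close>)
  hence "p' (a / 2) = 0" by (simp add: p'_def)
  thus "p (a / 2) \<in> {s. 4 * s ^ 3 - A * s - B = 0}" using p_ode[of "a / 2"] a_pos by simp
next
  fix s assume s: "s \<in> {s. 4 * s ^ 3 - A * s - B = 0}"
  show "s \<le> p (a / 2)"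
  proof (rule ccontr)
    assume "\<not> s \<le> p (a / 2)"
    hence "s \<in> p ` {0<..<a / 2}" unfolding p_image by simp
    then obtain x where x: "0 < x" "x < a / 2" "s = p x" by auto
    thus False using s p_ode[of x] p'_nonzero[of x] a_pos by simp
  qed
qed

text \<open>Under s = p x the factor |p'| equals the square root of the cubic, so the transformed
  integrand is 1. The change of variables theorem delivers integrability of the original integrand
  together with the value.\<close>

lemma half_period_integral:
  "integral {p (a / 2)..} (\<lambda>s. 1 / sqrt (4 * s ^ 3 - A * s - B)) = a / 2"
proof -
  define f where "f = (\<lambda>s. 1 / sqrt (4 * s ^ 3 - A * s - B))"
  let ?S = "{0<..<a / 2}"
  have one: "\<bar>p' x\<bar> * f (p x) = 1" if "x \<in> ?S" for x
    using p_ode[of x] p'_nonzero[of x] that by (simp add: f_def flip: p_ode)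
  have "((\<lambda>x. 1) has_integral (1 * (a / 2 - 0))) {0..a / 2}"
    using has_integral_const_real[of "1::real" 0 "a / 2"] a_pos by simp
  hence "((\<lambda>x. 1) has_integral a / 2) ?S" by (simp add: has_integral_Icc_iff_Ioo)
  hence hi: "((\<lambda>x. \<bar>p' x\<bar> * f (p x)) has_integral a / 2) ?S"
    by (rule has_integral_eq[rotated]) (simp add: one)
  moreover have "(\<lambda>x. \<bar>p' x\<bar> * f (p x)) absolutely_integrable_on ?S"
    by (rule nonnegative_absolutely_integrable_1) (use hi one in auto)
  moreover have "(\<lambda>x. \<bar>p' x\<bar> * f (p x)) absolutely_integrable_on ?S \<and>
        integral ?S (\<lambda>x. \<bar>p' x\<bar> * f (p x)) = a / 2
     \<longleftrightarrow> f absolutely_integrable_on (p ` ?S) \<and> integral (p ` ?S) f = a / 2"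
  proof (rule has_absolute_integral_change_of_variables_1')
    show "(p has_real_derivative p' x) (at x within ?S)" if "x \<in> ?S" for x
      by (rule has_field_derivative_at_within, rule p_deriv) (use that a_pos in auto)
    show "inj_on p ?S"
    proof (rule inj_onI)
      fix x y assume "x \<in> ?S" "y \<in> ?S" "p x = p y"
      thus "x = y" by (intro p_inj[of x y]) auto
    qed
  qed simp
  ultimately have "integral (p ` ?S) f = a / 2" using integral_unique by blast
  hence "integral {p (a / 2)<..} f = a / 2" by (simp add: p_image)
  moreover have "integral {p (a / 2)<..} f = integral {p (a / 2)..} f"
    by (rule integral_spike_set) (rule negligible_subset[of "{p (a / 2)}"]; auto)+
  ultimately show ?thesis by (simp add: f_def)
qed

end

text \<open>The hypotheses say that \<open>\<wp>\<close> and \<open>\<wp>'\<close> take the same values at \<open>\<rho>\<close> and at its reflection in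
  the imaginary axis, so that both points are congruent modulo \<open>\<Lambda>\<close>.\<close>
lemma Re_quasi_period_combination:
  assumes \<rho>: "\<rho> \<notin> \<Lambda>" and real: "cnj (wp_lat \<Lambda> \<rho>) = wp_lat \<Lambda> \<rho>" and imag: "cnj (wp' \<rho>) = - wp' \<rho>"
  shows "Re (wzeta_lat \<Lambda> \<rho> * of_real (a / 2) - wzeta_lat \<Lambda> (of_real (a / 2)) * \<rho>) = 0"
proof -
  have cn: "cnj \<rho> \<notin> \<Lambda>" using \<rho> by (simp add: cnj_rect_lattice_iff)
  have "- cnj \<rho> - \<rho> \<in> \<Lambda>"
  proof (rule diff_mem_if_wp_eq[OF _ \<rho>])
    show "- cnj \<rho> \<notin> \<Lambda>" using cn by (simp add: uminus_mem_iff)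
    show "wp_lat \<Lambda> (- cnj \<rho>) = wp_lat \<Lambda> \<rho>" by (simp add: wp_even wp_rect_cnj real)
    show "wp' (- cnj \<rho>) = wp' \<rho>" by (simp add: wp'_odd[OF cn] wp'_rect_cnj[OF \<rho>] imag)
  qed
  then obtain m where m: "- 2 * Re \<rho> = of_int m * a" by (auto simp: rect_lattice_mem_iff)
  have shift: "- cnj \<rho> = \<rho> + of_int m * of_real a"
    using m by (simp add: complex_eq_iff)
  define h where "h = Re (wzeta_lat \<Lambda> (of_real a / 2))"
  have h: "wzeta_lat \<Lambda> (of_real a / 2) = of_real h"
    unfolding h_def using wzeta_rect_cnj[of a b "of_real a / 2"] by (simp add: complex_eq_iff)
  have "- cnj (wzeta_lat \<Lambda> \<rho>) = wzeta_lat \<Lambda> (- cnj \<rho>)" by (simp add: wzeta_odd wzeta_rect_cnj)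
  also have "\<dots> = wzeta_lat \<Lambda> \<rho> + 2 * of_int m * of_real h"
    unfolding shift h[symmetric]
    by (rule wzeta_add_multiple) (use \<rho> half_period_not_mem real_mem_iff[of a] in \<open>auto intro: exI[of _ 1]\<close>)
  \<comment> \<open>Real parts give Re wzeta(rho) = - m h, while Re rho = - m a / 2; multiplied by a
    / 2 and h respectively, these are equal.\<close>
  finally have "Re (- cnj (wzeta_lat \<Lambda> \<rho>)) = Re (wzeta_lat \<Lambda> \<rho> + 2 * of_int m * of_real h)" by simp
  hence "Re (wzeta_lat \<Lambda> \<rho>) = - of_int m * h" by simp
  moreover have "Re \<rho> = - of_int m * a / 2" using m by simp
  ultimately have "Re (wzeta_lat \<Lambda> \<rho>) * (a / 2) - h * Re \<rho> = 0" by simp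
  thus ?thesis using h by simp
qed

end

text \<open>On [e, e + 1] the factor s + 2 e is at most 3 e + 1, so the integrand dominates k / (s -
  e), whose integral from e + d to e + 1 is - k ln d and unbounded as d tends to 0.\<close>

lemma degenerate_integrand_not_integrable:
  fixes e :: real
  assumes e: "e > 0"
  shows "\<not> (\<lambda>s. 1 / sqrt (4 * (s - e) ^ 2 * (s + 2 * e))) integrable_on {e..}"
proof
  define f where "f = (\<lambda>s. 1 / sqrt (4 * (s - e) ^ 2 * (s + 2 * e)))"
  assume "(\<lambda>s. 1 / sqrt (4 * (s - e) ^ 2 * (s + 2 * e))) integrable_on {e..}"
  hence int: "f integrable_on {e..}" by (simp add: f_def)
  have f_nonneg: "f s \<ge> 0" if "s \<ge> e" for s using that e by (simp add: f_def)
  have sub: "f integrable_on {x..y}" if "e \<le> x" for x y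
    by (rule integrable_on_subinterval[OF int]) (use that in auto)
  define k where "k = 1 / (2 * sqrt (3 * e + 1))"
  have k: "k > 0" using e by (simp add: k_def)
  have bound: "- (k * ln d) \<le> integral {e..} f" if d: "0 < d" "d < 1" for d
  proof -
    have "((\<lambda>s. k / (s - e)) has_integral (k * ln (e + 1 - e) - k * ln (e + d - e))) {e + d..e + 1}"
    proof (rule fundamental_theorem_of_calculus)
      fix s assume "s \<in> {e + d..e + 1}"
      hence "s > e" using d by simp
      thus "((\<lambda>s. k * ln (s - e)) has_vector_derivative k / (s - e)) (at s within {e + d..e + 1})"
        unfolding has_real_derivative_iff_has_vector_derivative[symmetric]
        by (auto intro!: derivative_eq_intros)
    qed (use d in simp)
    hence "- (k * ln d) = integral {e + d..e + 1} (\<lambda>s. k / (s - e))"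
      and ki: "(\<lambda>s. k / (s - e)) integrable_on {e + d..e + 1}"
      by (auto simp: has_integral_iff)
    note this(1)
    also have "integral {e + d..e + 1} (\<lambda>s. k / (s - e)) \<le> integral {e + d..e + 1} f"
    proof (rule integral_le[OF ki sub])
      fix s assume s: "s \<in> {e + d..e + 1}"
      have "f s = 1 / (2 * (s - e) * sqrt (s + 2 * e))"
        using s d by (simp add: f_def real_sqrt_mult)
      moreover have "k / (s - e) = 1 / (2 * (s - e) * sqrt (3 * e + 1))" by (simp add: k_def)
      moreover have "2 * (s - e) * sqrt (s + 2 * e) \<le> 2 * (s - e) * sqrt (3 * e + 1)"
        using s d by (intro mult_left_mono) auto
      moreover have "2 * (s - e) * sqrt (s + 2 * e) > 0"
        using s d e by (intro mult_pos_pos) auto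
      ultimately show "k / (s - e) \<le> f s" by (simp only: divide_left_mono frac_le)
    qed (use d in auto)
    also have "\<dots> \<le> integral {e..} f"
      by (rule integral_subset_le[OF _ sub int]) (use d f_nonneg in auto)
    finally show ?thesis .
  qed
  define I where "I = integral {e..} f"
  have I: "I \<ge> 0" unfolding I_def by (rule integral_nonneg[OF int]) (use f_nonneg in auto)
  \<comment> \<open>With this value for d the lower bound - k ln d equals I + 1.\<close>
  have "exp (- ((I + 1) / k)) < 1" using I k by simp
  from bound[OF exp_gt_zero this] k have "I + 1 \<le> I" by (simp add: I_def)
  thus False by simp
qed

section \<open>The sine-Gordon invariants and the spectral data\<close>

text \<open>With D = c^2 - 1 the three roots differ by E / (2 D), (E - 2) / (2 D) and 1 / D; the
  right side is 16 times the product of the squared differences.\<close>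

lemma sg_discriminant:
  assumes "c ^ 2 \<noteq> 1"
  shows "sg_g2 c E ^ 3 - 27 * sg_g3 c E ^ 2 = E ^ 2 * (E - 2) ^ 2 / (c ^ 2 - 1) ^ 6"
proof -
  define D where "D = c ^ 2 - 1"
  have D: "D \<noteq> 0" using assms by (simp add: D_def)
  have "(4 - 2 * E + E ^ 2) ^ 3 - (8 - 6 * E - 3 * E ^ 2 + E ^ 3) ^ 2 = 27 * (E ^ 2 * (E - 2) ^ 2)"
    by algebra
  moreover have "sg_g2 c E ^ 3 = (4 - 2 * E + E ^ 2) ^ 3 / (27 * D ^ 6)"
    by (simp add: sg_g2_def D_def power_divide power_mult_distrib flip: power_mult)
  moreover have "27 * sg_g3 c E ^ 2 = (8 - 6 * E - 3 * E ^ 2 + E ^ 3) ^ 2 / (27 * D ^ 6)"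
    by (simp add: sg_g3_def D_def power_divide power_mult_distrib flip: power_mult)
  ultimately show ?thesis using D by (simp add: D_def[symmetric] flip: diff_divide_distrib)
qed

text \<open>Existence ensures that the choice in \<open>wlattice\<close> has the right invariants,
  and uniqueness identifies it with the rectangular lattice. At E = 2, g3 = - 8 / (27 (c^2 - 1)^3),
  so \<open>deg\<close> provides the sign that \<open>rect_lattice_exists\<close> demands.\<close>

lemma sg_lattice_eq_rect:
  assumes c: "c ^ 2 \<noteq> 1" and E: "E \<noteq> 0" and deg: "E = 2 \<Longrightarrow> c ^ 2 < 1"
  shows "\<exists>a b. a > 0 \<and> sg_lattice c E = rect_lattice a b
    \<and> lattice_g2 (rect_lattice a b) = of_real (sg_g2 c E)
    \<and> lattice_g3 (rect_lattice a b) = of_real (sg_g3 c E)"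
proof -
  have "4 - 2 * E + E ^ 2 = (E - 1) ^ 2 + 3" by algebra
  hence "4 - 2 * E + E ^ 2 > 0" using zero_le_power2[of "E - 1"] by linarith
  hence pos: "sg_g2 c E > 0" using c by (simp add: sg_g2_def)
  have "sg_g2 c E ^ 3 - 27 * sg_g3 c E ^ 2 \<ge> 0"
    unfolding sg_discriminant[OF c] by simp
  moreover have "sg_g3 c E > 0" if "27 * sg_g3 c E ^ 2 = sg_g2 c E ^ 3"
  proof -
    have "E = 2" using sg_discriminant[OF c, of E] that E c by simp
    moreover have "(c ^ 2 - 1) ^ 3 < 0" using deg[OF \<open>E = 2\<close>] by (simp add: power_less_zero_eq)
    ultimately show ?thesis by (simp add: sg_g3_def eval_nat_numeral divide_neg_neg)
  qed
  ultimately obtain a b where ab: "a > 0" "lattice_g2 (rect_lattice a b) = of_real (sg_g2 c E)"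
      "lattice_g3 (rect_lattice a b) = of_real (sg_g3 c E)"
    using rect_lattice_exists[OF pos, of "sg_g3 c E"] by auto
  have "period_lattice (sg_lattice c E) \<and> lattice_g2 (sg_lattice c E) = of_real (sg_g2 c E)
      \<and> lattice_g3 (sg_lattice c E) = of_real (sg_g3 c E)"
    unfolding sg_lattice_def wlattice_def
    by (rule someI[of _ "rect_lattice a b"]) (use ab period_lattice_rect in auto)
  hence "sg_lattice c E = rect_lattice a b"
    by (intro weierstrass_lattice_unique period_lattice_weierstrass period_lattice_rect)
       (use ab in auto)
  thus ?thesis using ab by blast
qed

text \<open>The roots are e, counted twice, and - 2 e. For c^2 > 1 the double root is the larger
  one, so the integral starts at a singularity of type 1 / (s - e).\<close>

lemma sg_omega1_degenerate:
  assumes "c ^ 2 > 1"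
  shows "sg_omega1 c 2 = 0"
proof -
  define e where "e = 1 / (3 * (c ^ 2 - 1))"
  have e: "e > 0" using assms by (simp add: e_def)
  have g: "sg_g2 c 2 = 12 * e ^ 2" "sg_g3 c 2 = - 8 * e ^ 3"
    unfolding sg_g2_def sg_g3_def e_def power_divide power_mult_distrib by simp_all
  have cubic: "4 * s ^ 3 - sg_g2 c 2 * s - sg_g3 c 2 = 4 * (s - e) ^ 2 * (s + 2 * e)" for s
    unfolding g by algebra
  have "{s. 4 * s ^ 3 - sg_g2 c 2 * s - sg_g3 c 2 = 0} = {e, - 2 * e}"
    unfolding cubic by auto
  hence "sg_e1 c 2 = e" unfolding sg_e1_def using e by simp
  thus ?thesis
    unfolding sg_omega1_def cubic
    using degenerate_integrand_not_integrable[OF e] by (simp add: not_integrable_integral)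
qed

text \<open>With x and y as in the proof, - 64 Omega^2 equals x^2 + y^2 + 2 x y (E - 1), that is (x
  + y)^2 + 2 x y (E - 2) or (x - y)^2 + 2 x y E. As x y = 4 (c^2 - 1), the sign of c^2 - 1 decides
  which form is visibly nonnegative.\<close>

lemma sg_Omega_imaginary:
  fixes c E \<zeta> :: real
  assumes regime: "(\<bar>c\<bar> < 1 \<and> E \<le> 2) \<or> (\<bar>c\<bar> > 1 \<and> 0 \<le> E)"
    and \<zeta>: "\<zeta> \<noteq> 0" and Omega: "\<Omega> ^ 2 = sg_Omega_sq c E (of_real \<zeta>)"
  shows "\<exists>W. \<Omega> = \<i> * of_real W \<and> 64 * W ^ 2 = 8 * (c ^ 2 - 1) * (E - 1) + (c - 1) ^ 2 / \<zeta> ^ 2 + 16 * (c + 1) ^ 2 * \<zeta> ^ 2"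
proof -
  define T where "T = 8 * (c ^ 2 - 1) * (E - 1) + (c - 1) ^ 2 / \<zeta> ^ 2 + 16 * (c + 1) ^ 2 * \<zeta> ^ 2"
  define x y where "x = (c - 1) / \<zeta>" and "y = 4 * (c + 1) * \<zeta>"
  have "x * y = (c - 1) * (4 * (c + 1))" using \<zeta> by (simp add: x_def y_def)
  hence xy: "x * y = 4 * (c ^ 2 - 1)" by (simp add: power2_eq_square algebra_simps)
  have "T = 8 * (c ^ 2 - 1) * (E - 1) + x ^ 2 + y ^ 2"
    unfolding T_def x_def y_def power_divide power_mult_distrib by simp
  hence T: "T = 2 * (x * y) * (E - 1) + x ^ 2 + y ^ 2" by (simp add: xy)
  have "T \<ge> 0"
  proof (cases "\<bar>c\<bar> < 1")
    case True
    hence "x * y \<le> 0" unfolding xy by (simp add: abs_square_le_1)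
    moreover have "E - 2 \<le> 0" using regime True by auto
    ultimately have "0 \<le> (x * y) * (E - 2)" by (rule mult_nonpos_nonpos)
    moreover have "T = 2 * ((x * y) * (E - 2)) + (x + y) ^ 2" unfolding T by algebra
    ultimately show ?thesis by simp
  next
    case False
    hence "x * y \<ge> 0" unfolding xy using regime by (simp add: abs_square_less_1[symmetric] not_less)
    moreover have "E \<ge> 0" using regime False by auto
    ultimately have "0 \<le> (x * y) * E" by (rule mult_nonneg_nonneg)
    moreover have "T = 2 * ((x * y) * E) + (x - y) ^ 2" unfolding T by algebra
    ultimately show ?thesis by simp
  qed
  define V where "V = sqrt (T / 64)"
  have V: "64 * V ^ 2 = T" using \<open>T \<ge> 0\<close> by (simp add: V_def)
  have "sg_Omega_sq c E (of_real \<zeta>) = of_real ((1 / 64) * (- 8 * (c ^ 2 - 1) * (E - 1)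
      - (c - 1) ^ 2 / \<zeta> ^ 2 - 16 * (c + 1) ^ 2 * \<zeta> ^ 2))"
    by (simp add: sg_Omega_sq_def)
  also have "(1 / 64) * (- 8 * (c ^ 2 - 1) * (E - 1) - (c - 1) ^ 2 / \<zeta> ^ 2 - 16 * (c + 1) ^ 2 * \<zeta> ^ 2)
      = - (T / 64)"
  proof -
    have "(1 / 64) * (- 8 * k * l - q - 16 * m * n) = - ((8 * k * l + q + 16 * m * n) / 64)"
      for k l m n q :: real by (simp add: field_simps)
    thus ?thesis unfolding T_def by this
  qed
  also have "- (T / 64) = - (V ^ 2)" using V by simp
  finally have "\<Omega> ^ 2 = (\<i> * of_real V) ^ 2" by (simp add: Omega power_mult_distrib)
  hence "\<Omega> = \<i> * of_real V \<or> \<Omega> = \<i> * of_real (- V)" by (simp add: power2_eq_iff)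
  thus ?thesis unfolding T_def[symmetric] using V by (metis power2_minus)
qed

text \<open>The cubic is minus a square at \<open>\<wp>(\<rho>)\<close>: with \<open>u\<close> as below, its value there is
  \<open>-4 (u + (E - 1)/2) (u^2 - 1/4) / (c^2 - 1)^3\<close>, and the equation defining \<open>\<Omega>\<close> makes
  \<open>u^2 - 1/4\<close> proportional to \<open>u + (E - 1)/2\<close>.\<close>
lemma sg_cubic_at_wp_rho:
  fixes c E \<zeta> W :: real
  assumes c: "c ^ 2 \<noteq> 1" and \<zeta>: "\<zeta> \<noteq> 0"
    and W: "64 * W ^ 2 = 8 * (c ^ 2 - 1) * (E - 1) + (c - 1) ^ 2 / \<zeta> ^ 2 + 16 * (c + 1) ^ 2 * \<zeta> ^ 2"
  shows "\<exists>x r. - sg_C4 c E (of_real \<zeta>) (\<i> * of_real W) / sg_C5 c (of_real \<zeta>) = of_real x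
    \<and> 4 * x ^ 3 - sg_g2 c E * x - sg_g3 c E = - (r ^ 2)"
proof -
  define D where "D = c ^ 2 - 1"
  \<comment> \<open>The affine coordinate u = - D x - (E - 1) / 6 places the roots of the cubic at u
    = - (E - 1) / 2 and u = 1/2, - 1/2.\<close>
  define u where "u = 2 * \<zeta> * ((c + 1) * \<zeta> + 2 * W) / (c - 1)"
  define v where "v = u + (E - 1) / 2"
  define x where "x = - (E - 1) / (6 * D) - u / D"
  define r where "r = 4 * \<zeta> * v / (D * (c - 1))"
  have D: "D \<noteq> 0" and c1: "c - 1 \<noteq> 0" "c + 1 \<noteq> 0"
    using c by (auto simp: D_def power2_eq_1_iff add_eq_0_iff2)
  have Dc: "D = (c - 1) * (c + 1)" by (simp add: D_def power2_eq_square algebra_simps)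
  have "- sg_C4 c E (of_real \<zeta>) (\<i> * of_real W) / sg_C5 c (of_real \<zeta>)
    = of_real (- (8 / 3 * \<zeta> * ((c - 1) * (E - 1) + 12 * (c + 1) * \<zeta> ^ 2 + 24 * \<zeta> * W)) / (16 * (c - 1) ^ 2 * (c + 1) * \<zeta>))"
    by (simp add: sg_C4_def sg_C5_def)
  also have "- (8 / 3 * \<zeta> * ((c - 1) * (E - 1) + 12 * (c + 1) * \<zeta> ^ 2 + 24 * \<zeta> * W)) / (16 * (c - 1) ^ 2 * (c + 1) * \<zeta>) = x"
    unfolding x_def u_def Dc using c1 \<zeta> by (simp add: divide_simps) algebra
  finally have 1: "- sg_C4 c E (of_real \<zeta>) (\<i> * of_real W) / sg_C5 c (of_real \<zeta>) = of_real x" .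
  have "u * (c - 1) - 2 * (c + 1) * \<zeta> ^ 2 = 4 * \<zeta> * W"
  proof -
    have "u * (c - 1) = 2 * \<zeta> * ((c + 1) * \<zeta> + 2 * W)" using c1 by (simp add: u_def)
    thus ?thesis by algebra
  qed
  \<comment> \<open>W is isolated and squared, so that its sign disappears and the equation for W^2
    can be inserted.\<close>
  hence "4 * (u * (c - 1) - 2 * (c + 1) * \<zeta> ^ 2) ^ 2 = \<zeta> ^ 2 * (64 * W ^ 2)"
    by (simp add: power_mult_distrib)
  also have "\<dots> = 8 * D * (E - 1) * \<zeta> ^ 2 + (c - 1) ^ 2 + 16 * (c + 1) ^ 2 * \<zeta> ^ 4"
    unfolding W D_def[symmetric] using \<zeta> by (simp add: field_simps eval_nat_numeral)
  finally have "(u ^ 2 - 1 / 4) * (c - 1) ^ 2 = 4 * D * \<zeta> ^ 2 * v"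
    unfolding v_def Dc by algebra
  hence key: "u ^ 2 - 1 / 4 = 4 * D * \<zeta> ^ 2 * v / (c - 1) ^ 2" using c1 by (simp add: field_simps)
  have "4 * x ^ 3 - sg_g2 c E * x - sg_g3 c E = - 4 * v * (u ^ 2 - 1 / 4) / D ^ 3"
    unfolding sg_g2_def sg_g3_def x_def v_def D_def[symmetric] using D
    by (simp add: divide_simps) algebra
  also have "\<dots> = - (r ^ 2)"
  proof -
    define d where "d = c - 1"
    have "d \<noteq> 0" using c1 by (simp add: d_def)
    thus ?thesis unfolding key r_def d_def[symmetric] using D by (simp add: field_simps eval_nat_numeral)
  qed
  finally show ?thesis using 1 by blast
qed

theorem theorem2:
  fixes c E \<zeta> :: real and \<Omega> \<rho> :: complex
  assumes regime: "(\<bar>c\<bar> < 1 \<and> E < 0) \<or> (\<bar>c\<bar> > 1 \<and> E > 2)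
                   \<or> (\<bar>c\<bar> < 1 \<and> 0 < E \<and> E \<le> 2) \<or> (\<bar>c\<bar> > 1 \<and> 0 < E \<and> E \<le> 2)"
    and nz: "\<zeta> \<noteq> 0"
    and Omega: "\<Omega> ^ 2 = sg_Omega_sq c E (of_real \<zeta>)"
    and rho_reg: "\<rho> \<notin> sg_lattice c E"
    and rho: "sg_wp c E \<rho> = - sg_C4 c E (of_real \<zeta>) \<Omega> / sg_C5 c (of_real \<zeta>)"
  shows "Re (sg_I c E (of_real \<zeta>) \<Omega> \<rho>) = 0"
proof (cases "E = 2 \<and> \<bar>c\<bar> > 1")
  case True
  hence "c ^ 2 > 1" using one_less_power[of "\<bar>c\<bar>" 2] by simp
  with True have "sg_omega1 c E = 0" using sg_omega1_degenerate by blast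
  \<comment> \<open>With omega1 = 0 the zeta function is evaluated at its pole: 1 / 0 = 0, and every
    summand 1 / (0 - w) + 1 / w + 0 vanishes. Hence all terms of I are 0.\<close>
  moreover have "sg_wzeta c E 0 = 0" by (simp add: sg_wzeta_def wzeta_lat_def)
  ultimately show ?thesis by (simp add: sg_I_def)
next
  case False
  have c: "c ^ 2 \<noteq> 1" and E: "E \<noteq> 0" and deg: "E = 2 \<Longrightarrow> c ^ 2 < 1"
    using regime False by (auto simp: power2_eq_1_iff abs_square_less_1)
  obtain a b where a: "a > 0" and L: "sg_lattice c E = rect_lattice a b" and
    inv: "lattice_g2 (rect_lattice a b) = of_real (sg_g2 c E)"
      "lattice_g3 (rect_lattice a b) = of_real (sg_g3 c E)"
    using sg_lattice_eq_rect[OF c E deg] by blast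
  interpret rect_weierstrass_lattice a b by unfold_locales (rule a)
  have omega1: "sg_omega1 c E = a / 2"
    unfolding sg_omega1_def sg_e1_def largest_root[OF inv] by (rule half_period_integral[OF inv])
  obtain W where W: "\<Omega> = \<i> * of_real W"
      "64 * W ^ 2 = 8 * (c ^ 2 - 1) * (E - 1) + (c - 1) ^ 2 / \<zeta> ^ 2 + 16 * (c + 1) ^ 2 * \<zeta> ^ 2"
    using sg_Omega_imaginary[OF _ nz Omega] regime by force
  obtain x r where x: "wp_lat \<Lambda> \<rho> = of_real x"
      and r: "4 * x ^ 3 - sg_g2 c E * x - sg_g3 c E = - (r ^ 2)"
    using sg_cubic_at_wp_rho[OF c nz W(2)] rho by (auto simp: W(1) sg_wp_def L)
  have \<rho>: "\<rho> \<notin> \<Lambda>" using rho_reg by (simp add: L)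
  have "wp' \<rho> ^ 2 = of_real (4 * x ^ 3 - sg_g2 c E * x - sg_g3 c E)"
    unfolding wp_ode[OF \<rho>] x inv by simp
  hence "wp' \<rho> ^ 2 = (\<i> * of_real r) ^ 2" by (simp add: r power_mult_distrib)
  hence imag: "cnj (wp' \<rho>) = - wp' \<rho>" by (auto simp: power2_eq_iff)
  have "Re (wzeta_lat \<Lambda> \<rho> * of_real (a / 2) - wzeta_lat \<Lambda> (of_real (a / 2)) * \<rho>) = 0"
    by (rule Re_quasi_period_combination[OF \<rho> _ imag]) (simp add: x)
  hence bracket: "Re (sg_wzeta c E \<rho> * of_real (sg_omega1 c E) - sg_wzeta c E (of_real (sg_omega1 c E)) * \<rho>) = 0"
    unfolding sg_wzeta_def L omega1 .
  have nu: "sg_nu c E (of_real \<zeta>) \<Omega> \<in> {1, - 1}" by (simp add: sg_nu_def Let_def)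
  have "2 * complex_of_real (sg_omega1 c E) * (\<i> * of_real \<zeta> + \<Omega>) / (of_real c - 1)
     = \<i> * of_real (2 * sg_omega1 c E * (\<zeta> + W) / (c - 1))"
    by (simp add: W(1) algebra_simps)
  hence "Re (2 * of_real (sg_omega1 c E) * (\<i> * of_real \<zeta> + \<Omega>) / (of_real c - 1)) = 0"
    by (metis Re_i_times Im_complex_of_real neg_0_equal_iff_equal)
  thus ?thesis using nu bracket unfolding sg_I_def by auto
qed

end
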